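(* Let $H$ and $H_0$ be two bounded self-adjoint operators in an infinite dimensional separable Hilbert space $\mathcal{H}$ such that $V := H-H_0 \in \mathcal{B}_2(\mathcal{H})$. Put $a=\inf\sigma(H_0)-\|V\|$ and $b=\sup\sigma(H_0)+\|V\|$. Then for every polynomial $p$ (with complex coefficients), $p(H)-p(H_0)-Dp(H_0)\bullet V\in\mathcal{B}_1(\mathcal{H})$, and there exists a unique (up to almost everywhere equality) non-negative function $\eta\in L^1(\mathbb{R})$ supported on $[a,b]$ such that for every polynomial $p$, $$\mathrm{Tr}\{p(H)-p(H_0)-Dp(H_0)\bullet V\}=\int_a^b p''(\lambda)\,\eta(\lambda)\,d\lambda .$$ Furthermore $\int_a^b|\eta(\lambda)|\,d\lambda=\tfrac12\|V\|_2^2$.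
   Context: $\mathcal{H}$ is a complex Hilbert space. $\mathcal{B}(\mathcal{H})$, $\mathcal{B}_1(\mathcal{H})$, $\mathcal{B}_2(\mathcal{H})$ denote the bounded, trace class and Hilbert-Schmidt operators on $\mathcal{H}$, with norms $\|\cdot\|$, $\|\cdot\|_1$, $\|\cdot\|_2$ respectively; $\mathrm{Tr}$ is the trace and $\sigma(\cdot)$ the spectrum. For a polynomial $p$ and bounded self-adjoint $H_0$, $Dp(H_0)$ is the Fréchet derivative at $H_0$ of the map $A\mapsto p(A)$ (in operator norm), and $Dp(H_0)\bullet V$ is its value in the direction $V$; for $p(\lambda)=\lambda^r$, $r\ge 1$, it is $\sum_{j=0}^{r-1}H_0^{r-j-1}VH_0^j$. *)

theory Defs
  imports "HOL-Analysis.Analysis" "HOL-Computational_Algebra.Polynomial"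
begin

section \<open>Complex Hilbert spaces\<close>

class complex_vector = real_vector +
  fixes scaleC :: "complex \<Rightarrow> 'a \<Rightarrow> 'a" (infixr \<open>*\<^sub>C\<close> 75)
  assumes scaleC_add_right: "c *\<^sub>C (x + y) = c *\<^sub>C x + c *\<^sub>C y"
    and scaleC_add_left: "(c + d) *\<^sub>C x = c *\<^sub>C x + d *\<^sub>C x"
    and scaleC_scaleC: "c *\<^sub>C d *\<^sub>C x = (c * d) *\<^sub>C x"
    and scaleC_one: "1 *\<^sub>C x = x"
    and scaleR_scaleC: "r *\<^sub>R x = complex_of_real r *\<^sub>C x"

text \<open>The inner product is linear in its second argument. The last axiom makes it positive
  definite and says that the given norm is the induced one.\<close>

class complex_inner = complex_vector + real_normed_vector +
  fixes cinner :: "'a \<Rightarrow> 'a \<Rightarrow> complex"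
  assumes cinner_commute: "cinner x y = cnj (cinner y x)"
    and cinner_add_right: "cinner x (y + z) = cinner x y + cinner x z"
    and cinner_scaleC_right: "cinner x (c *\<^sub>C y) = c * cinner x y"
    and cinner_self: "cinner x x = complex_of_real ((norm x)\<^sup>2)"

class chilbert_space = complex_inner + complete_space

lemma vector_space_scaleC: "vector_space (scaleC :: complex \<Rightarrow> 'a \<Rightarrow> 'a::complex_vector)"
  by standard (simp_all add: scaleC_add_right scaleC_add_left scaleC_scaleC scaleC_one)

abbreviation cspan :: "'a::complex_vector set \<Rightarrow> 'a set"
  where "cspan \<equiv> module.span scaleC"

definition infinite_dim :: "'a::complex_vector itself \<Rightarrow> bool"
  where "infinite_dim _ \<longleftrightarrow> \<not> (\<exists>B :: 'a set. finite B \<and> cspan B = UNIV)"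

definition is_onb :: "'a::chilbert_space set \<Rightarrow> bool"
  where "is_onb B \<longleftrightarrow>
    (\<forall>x\<in>B. \<forall>y\<in>B. cinner x y = (if x = y then 1 else 0)) \<and> closure (cspan B) = UNIV"

definition some_onb :: "'a::chilbert_space set"
  where "some_onb = (SOME B. is_onb B)"

lemma scaleC_minus_right: "c *\<^sub>C (- x :: 'a::complex_vector) = - (c *\<^sub>C x)"
  using vector_space_scaleC module.scale_minus_right vector_space_def
  by (metis module_iff_vector_space)

lemma scaleC_diff_right: "c *\<^sub>C (x - y :: 'a::complex_vector) = c *\<^sub>C x - c *\<^sub>C y"
  using scaleC_add_right[of c x "- y"] by (simp add: scaleC_minus_right)

lemma scaleC_zero_right: "c *\<^sub>C (0 :: 'a::complex_vector) = 0"
  using scaleC_add_right[of c "0::'a" 0] by simp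

lemma scaleC_scaleR_commute: "c *\<^sub>C r *\<^sub>R (x :: 'a::complex_vector) = r *\<^sub>R c *\<^sub>C x"
  by (simp add: scaleR_scaleC scaleC_scaleC mult.commute)

lemma norm_scaleC: "norm (c *\<^sub>C x :: 'a::complex_inner) = cmod c * norm x"
proof -
  have "cinner (c *\<^sub>C x) (c *\<^sub>C x) = c * cnj (c * cinner x x)"
    by (metis cinner_scaleC_right cinner_commute)
  also have "\<dots> = complex_of_real ((cmod c * norm x)\<^sup>2)"
    by (simp add: cinner_self power_mult_distrib) (simp add: complex_norm_square flip: of_real_power)
  finally have "(norm (c *\<^sub>C x))\<^sup>2 = (cmod c * norm x)\<^sup>2"
    by (simp only: cinner_self of_real_eq_iff)
  thus ?thesis by (simp add: power2_eq_iff_nonneg)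
qed

lemma bounded_linear_scaleC: "bounded_linear (\<lambda>x :: 'a::complex_inner. c *\<^sub>C x)"
  by (rule bounded_linear_intro[where K = "cmod c"])
    (simp_all add: scaleC_add_right scaleC_scaleR_commute norm_scaleC mult.commute)


section \<open>The algebra of bounded operators\<close>

typedef (overloaded) 'a bounded_op =
  "{A :: 'a::complex_inner \<Rightarrow>\<^sub>L 'a. \<forall>c x. blinfun_apply A (c *\<^sub>C x) = c *\<^sub>C blinfun_apply A x}"
  morphisms blinfun_of_op Abs_bounded_op
  by (rule exI[of _ 0]) (simp add: scaleC_zero_right)

setup_lifting type_definition_bounded_op

lift_definition op_apply :: "'a::complex_inner bounded_op \<Rightarrow> 'a \<Rightarrow> 'a" (infixr \<open>\<bullet>\<^sub>o\<close> 80)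
  is blinfun_apply .

text \<open>Multiplication is composition, so that powers of operators are those of
  the class \<^class>\<open>monoid_mult\<close>; the norm is the operator norm.\<close>

instantiation bounded_op :: (complex_inner) "{real_normed_algebra, monoid_mult, complex_vector}"
begin

lift_definition zero_bounded_op :: "'a bounded_op" is 0
  by (simp add: scaleC_zero_right)

lift_definition one_bounded_op :: "'a bounded_op" is id_blinfun
  by simp

lift_definition plus_bounded_op :: "'a bounded_op \<Rightarrow> 'a bounded_op \<Rightarrow> 'a bounded_op" is "(+)"
  by (simp add: plus_blinfun.rep_eq scaleC_add_right)

lift_definition minus_bounded_op :: "'a bounded_op \<Rightarrow> 'a bounded_op \<Rightarrow> 'a bounded_op" is "(-)"
  by (simp add: minus_blinfun.rep_eq scaleC_diff_right)

lift_definition uminus_bounded_op :: "'a bounded_op \<Rightarrow> 'a bounded_op" is uminus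
  by (simp add: uminus_blinfun.rep_eq scaleC_minus_right)

lift_definition times_bounded_op :: "'a bounded_op \<Rightarrow> 'a bounded_op \<Rightarrow> 'a bounded_op"
  is "(o\<^sub>L)"
  by simp

lift_definition scaleR_bounded_op :: "real \<Rightarrow> 'a bounded_op \<Rightarrow> 'a bounded_op" is "(*\<^sub>R)"
  by (simp add: scaleR_blinfun.rep_eq scaleC_scaleR_commute)

lift_definition scaleC_bounded_op :: "complex \<Rightarrow> 'a bounded_op \<Rightarrow> 'a bounded_op"
  is "\<lambda>c A. Blinfun (\<lambda>x. c *\<^sub>C x) o\<^sub>L A"
  by (simp add: bounded_linear_Blinfun_apply bounded_linear_scaleC scaleC_scaleC mult.commute)

lift_definition norm_bounded_op :: "'a bounded_op \<Rightarrow> real" is norm .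

definition "sgn_bounded_op (A :: 'a bounded_op) = scaleR (inverse (norm A)) A"

definition "dist_bounded_op (A :: 'a bounded_op) B = norm (A - B)"

definition "(uniformity :: ('a bounded_op \<times> 'a bounded_op) filter) =
  (INF e\<in>{0 <..}. principal {(x, y). dist x y < e})"

definition "open_bounded_op (S :: 'a bounded_op set) \<longleftrightarrow>
  (\<forall>x\<in>S. \<forall>\<^sub>F (x', y) in uniformity. x' = x \<longrightarrow> y \<in> S)"

instance
proof
  fix A B C :: "'a bounded_op" and r s :: real and c d :: complex and S :: "'a bounded_op set"
  show "A + B + C = A + (B + C)" by transfer simp
  show "A + B = B + A" by transfer simp
  show "0 + A = A" by transfer simp
  show "- A + A = 0" by transfer simp
  show "A - B = A + - B" by transfer simp
  show "r *\<^sub>R (A + B) = r *\<^sub>R A + r *\<^sub>R B" by transfer (simp add: scaleR_add_right)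
  show "(r + s) *\<^sub>R A = r *\<^sub>R A + s *\<^sub>R A" by transfer (simp add: scaleR_add_left)
  show "r *\<^sub>R s *\<^sub>R A = (r * s) *\<^sub>R A" by transfer simp
  show "1 *\<^sub>R A = A" by transfer simp
  show "A * B * C = A * (B * C)" by transfer (simp add: blinfun_eqI)
  show "(A + B) * C = A * C + B * C"
    by transfer (simp add: blinfun_eqI plus_blinfun.rep_eq)
  show "A * (B + C) = A * B + A * C"
    by transfer (simp add: blinfun_eqI plus_blinfun.rep_eq blinfun.add_right)
  show "r *\<^sub>R A * B = r *\<^sub>R (A * B)"
    by transfer (simp add: blinfun_eqI scaleR_blinfun.rep_eq)
  show "A * r *\<^sub>R B = r *\<^sub>R (A * B)"
    by transfer (simp add: blinfun_eqI scaleR_blinfun.rep_eq blinfun.scaleR_right)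
  show "1 * A = A" by transfer (simp add: blinfun_eqI)
  show "A * 1 = A" by transfer (simp add: blinfun_eqI)
  show "norm (A * B) \<le> norm A * norm B" by transfer (rule norm_blinfun_compose)
  show "norm (A + B) \<le> norm A + norm B" by transfer (rule norm_triangle_ineq)
  show "norm A = 0 \<longleftrightarrow> A = 0" by transfer simp
  show "norm (r *\<^sub>R A) = \<bar>r\<bar> * norm A" by transfer simp
  show "c *\<^sub>C (A + B) = c *\<^sub>C A + c *\<^sub>C B"
    by transfer (simp add: blinfun_eqI plus_blinfun.rep_eq blinfun.add_right)
  show "(c + d) *\<^sub>C A = c *\<^sub>C A + d *\<^sub>C A"
    by transfer (simp add: blinfun_eqI plus_blinfun.rep_eq bounded_linear_Blinfun_apply
        bounded_linear_scaleC scaleC_add_left)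
  show "c *\<^sub>C d *\<^sub>C A = (c * d) *\<^sub>C A"
    by transfer (simp add: blinfun_eqI bounded_linear_Blinfun_apply
        bounded_linear_scaleC scaleC_scaleC)
  show "1 *\<^sub>C A = A"
    by transfer (simp add: blinfun_eqI bounded_linear_Blinfun_apply
        bounded_linear_scaleC scaleC_one)
  show "r *\<^sub>R A = complex_of_real r *\<^sub>C A"
    by transfer (simp add: blinfun_eqI bounded_linear_Blinfun_apply
        bounded_linear_scaleC scaleR_scaleC[symmetric] scaleR_blinfun.rep_eq)
  show "sgn A = scaleR (inverse (norm A)) A" by (rule sgn_bounded_op_def)
  show "dist A B = norm (A - B)" by (rule dist_bounded_op_def)
  show "(uniformity :: ('a bounded_op \<times> 'a bounded_op) filter) =
      (INF e\<in>{0 <..}. principal {(x, y). dist x y < e})"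
    by (rule uniformity_bounded_op_def)
  show "open S \<longleftrightarrow> (\<forall>x\<in>S. \<forall>\<^sub>F (x', y) in uniformity. x' = x \<longrightarrow> y \<in> S)"
    by (rule open_bounded_op_def)
qed

end

lemma scaleC_op_apply: "(c *\<^sub>C A) \<bullet>\<^sub>o x = c *\<^sub>C (A \<bullet>\<^sub>o x)"
  by transfer (simp add: bounded_linear_Blinfun_apply bounded_linear_scaleC)

lemma times_op_apply: "(A * B) \<bullet>\<^sub>o x = A \<bullet>\<^sub>o (B \<bullet>\<^sub>o x)"
  by transfer simp

definition self_adjoint :: "'a::chilbert_space bounded_op \<Rightarrow> bool"
  where "self_adjoint A \<longleftrightarrow> (\<forall>x y. cinner (A \<bullet>\<^sub>o x) y = cinner x (A \<bullet>\<^sub>o y))"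

definition positive_op :: "'a::chilbert_space bounded_op \<Rightarrow> bool"
  where "positive_op A \<longleftrightarrow> (\<forall>x. cinner x (A \<bullet>\<^sub>o x) \<in> \<real>\<^sub>\<ge>\<^sub>0)"

definition adj :: "'a::chilbert_space bounded_op \<Rightarrow> 'a bounded_op"
  where "adj A = (THE B. \<forall>x y. cinner (B \<bullet>\<^sub>o x) y = cinner x (A \<bullet>\<^sub>o y))"

definition abs_op :: "'a::chilbert_space bounded_op \<Rightarrow> 'a bounded_op"
  where "abs_op A = (THE P. positive_op P \<and> P * P = adj A * A)"

definition op_spectrum :: "'a::chilbert_space bounded_op \<Rightarrow> complex set"
  where "op_spectrum A =
    {z. \<not> (\<exists>B. B * (A - z *\<^sub>C 1) = 1 \<and> (A - z *\<^sub>C 1) * B = 1)}"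


section \<open>Hilbert-Schmidt and trace class operators\<close>

text \<open>Membership and the values of the two sums below do not depend on the orthonormal basis.\<close>

definition hilbert_schmidt :: "'a::chilbert_space bounded_op \<Rightarrow> bool"
  where "hilbert_schmidt A \<longleftrightarrow>
    (\<exists>B. is_onb B \<and> (\<lambda>e. (norm (A \<bullet>\<^sub>o e))\<^sup>2) summable_on B)"

definition hs_norm :: "'a::chilbert_space bounded_op \<Rightarrow> real"
  where "hs_norm A = sqrt (\<Sum>\<^sub>\<infinity>e\<in>some_onb. (norm (A \<bullet>\<^sub>o e))\<^sup>2)"

definition trace_class :: "'a::chilbert_space bounded_op \<Rightarrow> bool"
  where "trace_class A \<longleftrightarrow>
    (\<exists>B. is_onb B \<and> (\<lambda>e. cinner e (abs_op A \<bullet>\<^sub>o e)) summable_on B)"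

definition op_trace :: "'a::chilbert_space bounded_op \<Rightarrow> complex"
  where "op_trace A = (\<Sum>\<^sub>\<infinity>e\<in>some_onb. cinner e (A \<bullet>\<^sub>o e))"


section \<open>Polynomials of operators\<close>

definition op_poly :: "complex poly \<Rightarrow> 'a::chilbert_space bounded_op \<Rightarrow> 'a bounded_op"
  where "op_poly p A = (\<Sum>k\<le>degree p. coeff p k *\<^sub>C A ^ k)"

text \<open>The derivative is taken over the real scalars; by uniqueness it is also the complex
  derivative, as the explicit form shows.\<close>

lemma has_derivative_op_power:
  fixes A :: "'a::chilbert_space bounded_op"
  shows "((\<lambda>X. X ^ r) has_derivative (\<lambda>V. \<Sum>j<r. A ^ (r - j - 1) * V * A ^ j)) (at A)"
proof (induction r)
  case 0
  show ?case by simp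
next
  case (Suc r)
  have shift: "A * (A ^ (r - j - 1) * V * A ^ j) = A ^ (Suc r - j - 1) * V * A ^ j"
    if "j < r" for j V
  proof -
    have "Suc r - j - 1 = Suc (r - j - 1)" using that by simp
    thus ?thesis by (simp only: power_Suc mult.assoc)
  qed
  have eq: "A * (\<Sum>j<r. A ^ (r - j - 1) * V * A ^ j) + V * A ^ r =
      (\<Sum>j<Suc r. A ^ (Suc r - j - 1) * V * A ^ j)" for V
  proof -
    have "A * (\<Sum>j<r. A ^ (r - j - 1) * V * A ^ j) = (\<Sum>j<r. A ^ (Suc r - j - 1) * V * A ^ j)"
      unfolding sum_distrib_left by (rule sum.cong[OF refl]) (simp only: shift lessThan_iff)
    thus ?thesis by simp
  qed
  have "((\<lambda>X. X * X ^ r) has_derivative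
      (\<lambda>V. A * (\<Sum>j<r. A ^ (r - j - 1) * V * A ^ j) + V * A ^ r)) (at A)"
    by (rule has_derivative_mult[OF has_derivative_ident Suc.IH])
  thus ?case unfolding eq power_Suc .
qed

lemma bounded_op_eqI: "(\<And>x. A \<bullet>\<^sub>o x = B \<bullet>\<^sub>o x) \<Longrightarrow> A = B"
  by transfer (rule blinfun_eqI)

lemma one_op_apply: "1 \<bullet>\<^sub>o x = x"
  by transfer simp

lemma bounded_linear_scaleC_op:
  "bounded_linear (\<lambda>A :: 'a::chilbert_space bounded_op. c *\<^sub>C A)"
proof -
  have "c *\<^sub>C A = (c *\<^sub>C 1) * A" for A :: "'a bounded_op"
    by (rule bounded_op_eqI) (simp only: times_op_apply scaleC_op_apply one_op_apply)
  hence "(\<lambda>A :: 'a bounded_op. c *\<^sub>C A) = (\<lambda>A. (c *\<^sub>C 1) * A)"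
    by (rule ext)
  thus ?thesis by (metis bounded_linear_mult_right)
qed

lemma frechet_derivative_op_poly:
  fixes A :: "'a::chilbert_space bounded_op"
  shows "op_poly p differentiable (at A)"
    and "frechet_derivative (op_poly p) (at A) V =
      (\<Sum>k\<le>degree p. coeff p k *\<^sub>C (\<Sum>j<k. A ^ (k - j - 1) * V * A ^ j))"
proof -
  have *: "(op_poly p has_derivative
      (\<lambda>V. \<Sum>k\<le>degree p. coeff p k *\<^sub>C (\<Sum>j<k. A ^ (k - j - 1) * V * A ^ j))) (at A)"
    unfolding op_poly_def [abs_def]
    by (rule has_derivative_sum, rule bounded_linear.has_derivative[OF bounded_linear_scaleC_op],
        rule has_derivative_op_power)
  thus "op_poly p differentiable (at A)"
    by (auto simp only: differentiable_def)
  show "frechet_derivative (op_poly p) (at A) V =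
      (\<Sum>k\<le>degree p. coeff p k *\<^sub>C (\<Sum>j<k. A ^ (k - j - 1) * V * A ^ j))"
    by (simp only: frechet_derivative_at[OF *, symmetric])
qed

end

theory Submission
  imports Defs
begin

text \<open>
  Put \<open>V = H - H\<^sub>0\<close>, and let \<open>\<rho>(A, B; p)\<close> be the trace of \<open>p(B) - p(A) - Dp(A)(B - A)\<close>
  (\<open>trace_remainder\<close>). The proof rests on the estimate
  \<open>\<bar>\<rho>(A, B; p)\<bar> \<le> 1/2 \<parallel>B - A\<parallel>\<^sub>2\<^sup>2 sup \<bar>p''\<bar>\<close> (\<open>trace_remainder_bound\<close>), with the supremum over any
  interval \<open>[a, b]\<close> that contains the numerical ranges of \<open>A\<close> and \<open>B\<close>. By cyclicity of the trace,
  the remainder has derivative \<open>Tr (B - A)(p'(A\<^sub>s) - p'(A))\<close> along the segment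
  \<open>A\<^sub>s = A + s(B - A)\<close>. The difference \<open>p'(A\<^sub>s) - p'(A)\<close> is the mean over \<open>t\<close> in the unit interval
  of \<open>p''(T\<^sub>t)(A\<^sub>s - A)\<close>, where \<open>T\<^sub>t X = t A\<^sub>s X + (1 - t) X A\<close> is a symmetric operator
  on the Hilbert-Schmidt operators and lies between \<open>a\<close> and \<open>b\<close> (\<open>hip_rpoly_diff_bound\<close>). A
  polynomial \<open>q\<close> of a symmetric operator \<open>T\<close> between \<open>a\<close> and \<open>b\<close> has norm at most the supremum of
  \<open>\<bar>q\<bar>\<close> over \<open>[a, b]\<close>, because the operators \<open>(T - a)\<^sup>k(b - T)\<^sup>m\<close> are non-negative and \<open>q\<close> is a limit
  of its Bernstein polynomials (\<open>ev_norm_bound\<close>).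

  So \<open>\<rho>(H\<^sub>0, H; p)\<close> is a functional of \<open>p''\<close>, bounded by \<open>1/2 \<parallel>V\<parallel>\<^sub>2\<^sup>2\<close> in the supremum norm.
  That it has a density, and is not just a measure, comes from perturbations of finite rank. If
  \<open>B - A\<close> has finite rank, the pairing above involves only finitely many vectors and is controlled by
  \<open>sup \<bar>p'\<bar>\<close>, hence by the \<open>L\<^sup>1\<close>-norm of \<open>p''\<close>. Such a functional is approximated by integration
  against polynomials (\<open>approximate_riesz\<close>). The functional depends continuously on \<open>V\<close> in the
  Hilbert-Schmidt norm, uniformly for \<open>\<bar>p''\<bar> \<le> 1\<close> (\<open>trace_remainder_diff_bound\<close>). For general \<open>V\<close> it is
  therefore a limit of polynomial densities in the dual norm; on densities this norm is the
  \<open>L\<^sup>1\<close>-norm (\<open>L1_norm_le_by_polynomials\<close>), and \<open>L\<^sup>1\<close> is complete (\<open>density_of_approximable\<close>). The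
  polynomial \<open>x\<^sup>2/2\<close> shows that the integral of the density is \<open>1/2 \<parallel>V\<parallel>\<^sub>2\<^sup>2\<close>. Since this is also a
  bound for its \<open>L\<^sup>1\<close>-norm, the density is non-negative (\<open>nonneg_density\<close>). Uniqueness holds because
  polynomials determine an integrable function on an interval.

  The remainders are finite sums of products of two Hilbert-Schmidt operators. To see that such a
  sum \<open>A\<close> is of trace class, \<open>\<bar>A\<bar>\<close> is constructed as the square root of \<open>A\<^sup>*A\<close> from the power
  series of \<open>1 - \<surd>(1 - x)\<close>, and the partial isometry of the polar decomposition is approximated by
  the contractions \<open>A \<kappa>(\<bar>A\<bar>)\<close> with suitable polynomials \<open>\<kappa>\<close> (\<open>polar_approximation\<close>). Finally, the
  spectrum enters through the fact that the infimum and the supremum of the form of a self-adjoint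
  operator belong to it (\<open>spectrum_form_lower_bound\<close>), so that \<open>H\<^sub>0 + W\<close> lies between \<open>a\<close> and \<open>b\<close>
  for every self-adjoint \<open>W\<close> with \<open>\<parallel>W\<parallel> \<le> \<parallel>V\<parallel>\<close>.
\<close>

section \<open>Inner products and adjoints\<close>

lemma cinner_add_left: "cinner (x + y) z = cinner x z + cinner (y :: 'a::complex_inner) z"
  by (metis cinner_commute cinner_add_right complex_cnj_add)

lemma cinner_scaleC_left: "cinner (c *\<^sub>C x) (y :: 'a::complex_inner) = cnj c * cinner x y"
  by (metis cinner_commute cinner_scaleC_right complex_cnj_mult)

lemma cinner_scaleR_right: "cinner x (r *\<^sub>R (y :: 'a::complex_inner)) = of_real r * cinner x y"
  by (simp add: scaleR_scaleC cinner_scaleC_right)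

lemma cinner_scaleR_left: "cinner (r *\<^sub>R x) (y :: 'a::complex_inner) = of_real r * cinner x y"
  by (simp add: scaleR_scaleC cinner_scaleC_left)

lemma cinner_zero [simp]:
  "cinner 0 (x :: 'a::complex_inner) = 0" "cinner x (0 :: 'a::complex_inner) = 0"
  using cinner_scaleR_left[of 0 x x] cinner_scaleR_right[of x 0 x] by simp_all

lemma cinner_minus_left: "cinner (- x) (y :: 'a::complex_inner) = - cinner x y"
  using cinner_scaleR_left[of "-1" x y] by simp

lemma cinner_minus_right: "cinner x (- y :: 'a::complex_inner) = - cinner x y"
  using cinner_scaleR_right[of x "-1" y] by simp

lemma cinner_diff_left: "cinner (x - y) (z :: 'a::complex_inner) = cinner x z - cinner y z"
  using cinner_add_left[of x "- y" z] by (simp add: cinner_minus_left)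

lemma cinner_diff_right: "cinner z (x - y :: 'a::complex_inner) = cinner z x - cinner z y"
  using cinner_add_right[of z x "- y"] by (simp add: cinner_minus_right)

lemma cinner_sum_right: "cinner z (\<Sum>i\<in>I. f i :: 'a::complex_inner) = (\<Sum>i\<in>I. cinner z (f i))"
  by (induction I rule: infinite_finite_induct) (simp_all add: cinner_add_right)

lemma cinner_sum_left: "cinner (\<Sum>i\<in>I. f i :: 'a::complex_inner) z = (\<Sum>i\<in>I. cinner (f i) z)"
  by (induction I rule: infinite_finite_induct) (simp_all add: cinner_add_left)

lemma Re_cinner_self: "Re (cinner x x) = (norm (x :: 'a::complex_inner))\<^sup>2"
  by (simp add: cinner_self)

lemma Re_cinner_commute: "Re (cinner x y) = Re (cinner y (x :: 'a::complex_inner))"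
  by (subst cinner_commute) simp

lemma norm_add_square:
  "(norm (x + y :: 'a::complex_inner))\<^sup>2 = (norm x)\<^sup>2 + 2 * Re (cinner x y) + (norm y)\<^sup>2"
  using Re_cinner_commute[of x y]
  by (simp add: Re_cinner_self[symmetric] cinner_add_left cinner_add_right)

lemma norm_diff_square:
  "(norm (x - y :: 'a::complex_inner))\<^sup>2 = (norm x)\<^sup>2 - 2 * Re (cinner x y) + (norm y)\<^sup>2"
  using norm_add_square[of x "- y"] by (simp add: cinner_minus_right)

lemma Cauchy_Schwarz_cinner: "cmod (cinner x y) \<le> norm x * norm (y :: 'a::complex_inner)"
proof (cases "x = 0")
  case False
  define c where "c = cinner x y / of_real ((norm x)\<^sup>2)"
  have n: "(norm x)\<^sup>2 > 0" using False by simp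
  have "0 \<le> (norm (y - c *\<^sub>C x))\<^sup>2" by simp
  also have "\<dots> = (norm y)\<^sup>2 - 2 * Re (cinner y (c *\<^sub>C x)) + (cmod c * norm x)\<^sup>2"
    by (simp add: norm_diff_square norm_scaleC)
  also have "cinner y (c *\<^sub>C x) = cinner x y * cnj (cinner x y) / of_real ((norm x)\<^sup>2)"
    using cinner_commute[of y x] by (simp add: cinner_scaleC_right c_def)
  also have "\<dots> = of_real ((cmod (cinner x y))\<^sup>2 / (norm x)\<^sup>2)"
    by (simp add: complex_norm_square[symmetric])
  also have "(cmod c * norm x)\<^sup>2 = (cmod (cinner x y))\<^sup>2 / (norm x)\<^sup>2"
  proof -
    have "cmod c = cmod (cinner x y) / (norm x)\<^sup>2"
      by (simp add: c_def norm_divide norm_power)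
    thus ?thesis using False by (simp add: power_mult_distrib power_divide power2_eq_square)
  qed
  finally have "(cmod (cinner x y))\<^sup>2 / (norm x)\<^sup>2 \<le> (norm y)\<^sup>2"
    by (simp only: Re_complex_of_real)
  hence "(cmod (cinner x y))\<^sup>2 \<le> (norm x * norm y)\<^sup>2"
    using n by (simp add: divide_le_eq power_mult_distrib mult.commute)
  thus ?thesis by (rule power2_le_imp_le) simp
qed simp

lemma Re_cinner_le: "\<bar>Re (cinner x y)\<bar> \<le> norm x * norm (y :: 'a::complex_inner)"
  using abs_Re_le_cmod Cauchy_Schwarz_cinner order_trans by blast

lemma bounded_linear_cinner: "bounded_linear (cinner (x :: 'a::complex_inner))"
  by (rule bounded_linear_intro[where K = "norm x"])
    (simp_all add: cinner_add_right cinner_scaleR_right scaleR_conv_of_real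
      Cauchy_Schwarz_cinner mult.commute[of "norm _" "norm x"])

lemma cinner_eqI: "(\<And>y. cinner x y = cinner x' y) \<Longrightarrow> x = (x' :: 'a::complex_inner)"
proof -
  assume "\<And>y. cinner x y = cinner x' y"
  hence "cinner (x - x') (x - x') = 0" by (simp add: cinner_diff_left)
  thus ?thesis by (simp add: cinner_self)
qed

lemma bounded_linear_op_apply: "bounded_linear (op_apply A)"
  by transfer (rule blinfun.bounded_linear_right)

lemma op_apply_add: "A \<bullet>\<^sub>o (x + y) = A \<bullet>\<^sub>o x + A \<bullet>\<^sub>o y"
  and op_apply_diff: "A \<bullet>\<^sub>o (x - y) = A \<bullet>\<^sub>o x - A \<bullet>\<^sub>o y"
  and op_apply_scaleR: "A \<bullet>\<^sub>o (r *\<^sub>R x) = r *\<^sub>R (A \<bullet>\<^sub>o x)"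
  and op_apply_zero: "A \<bullet>\<^sub>o 0 = 0"
  and op_apply_sum: "A \<bullet>\<^sub>o (\<Sum>i\<in>I. f i) = (\<Sum>i\<in>I. A \<bullet>\<^sub>o f i)"
  using bounded_linear_op_apply[of A]
  by (simp_all add: bounded_linear.linear linear_add linear_diff linear_scale linear_0 linear_sum)

lemma op_apply_scaleC: "A \<bullet>\<^sub>o (c *\<^sub>C x) = c *\<^sub>C (A \<bullet>\<^sub>o x)"
  by transfer simp

lemma plus_op_apply: "(A + B) \<bullet>\<^sub>o x = A \<bullet>\<^sub>o x + B \<bullet>\<^sub>o x"
  by transfer (simp add: plus_blinfun.rep_eq)

lemma minus_op_apply: "(A - B) \<bullet>\<^sub>o x = A \<bullet>\<^sub>o x - B \<bullet>\<^sub>o x"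
  by transfer (simp add: minus_blinfun.rep_eq)

lemma uminus_op_apply: "(- A) \<bullet>\<^sub>o x = - (A \<bullet>\<^sub>o x)"
  by transfer (simp add: uminus_blinfun.rep_eq)

lemma scaleR_op_apply: "(r *\<^sub>R A) \<bullet>\<^sub>o x = r *\<^sub>R (A \<bullet>\<^sub>o x)"
  by transfer (simp add: scaleR_blinfun.rep_eq)

lemma zero_op_apply: "0 \<bullet>\<^sub>o x = 0"
  by transfer simp

lemma sum_op_apply: "(\<Sum>i\<in>I. f i) \<bullet>\<^sub>o x = (\<Sum>i\<in>I. f i \<bullet>\<^sub>o x)"
  by (induction I rule: infinite_finite_induct) (simp_all add: plus_op_apply zero_op_apply)

lemmas op_apply_simps = op_apply_add op_apply_diff op_apply_scaleR op_apply_zero op_apply_scaleC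
  plus_op_apply minus_op_apply uminus_op_apply scaleR_op_apply zero_op_apply one_op_apply
  times_op_apply scaleC_op_apply

lemma norm_op_apply: "norm (A \<bullet>\<^sub>o x) \<le> norm A * norm x"
  by transfer (rule norm_blinfun)

lemma norm_op_bound:
  assumes "0 \<le> c" "\<And>x. norm (A \<bullet>\<^sub>o x) \<le> c * norm x"
  shows "norm A \<le> c"
  using assms by transfer (rule norm_blinfun_bound)

lemma scaleC_op_mult:
  fixes A B :: "'a::complex_inner bounded_op"
  shows "(c *\<^sub>C A) * B = c *\<^sub>C (A * B)" "A * (c *\<^sub>C B) = c *\<^sub>C (A * B)"
  by (auto intro!: bounded_op_eqI simp: op_apply_simps)

text \<open>The adjoints needed below are given by explicit formulas or come with the operator; a relation
  between an operator and its adjoint records them.\<close>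

definition is_adj :: "'a::complex_inner bounded_op \<Rightarrow> 'a bounded_op \<Rightarrow> bool"
  where "is_adj A A' \<longleftrightarrow> (\<forall>x y. cinner (A' \<bullet>\<^sub>o x) y = cinner x (A \<bullet>\<^sub>o y))"

lemma is_adjD: "is_adj A A' \<Longrightarrow> cinner (A' \<bullet>\<^sub>o x) y = cinner x (A \<bullet>\<^sub>o y)"
  by (simp add: is_adj_def)

lemma is_adj_sym: "is_adj A A' \<Longrightarrow> is_adj A' A"
  unfolding is_adj_def by (metis cinner_commute)

lemma is_adj_unique: "is_adj A B \<Longrightarrow> is_adj A C \<Longrightarrow> B = C"
  unfolding is_adj_def by (intro bounded_op_eqI cinner_eqI) metis

lemma adj_eq: "is_adj A A' \<Longrightarrow> adj A = (A' :: 'a::chilbert_space bounded_op)"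
  unfolding adj_def by (rule the_equality) (auto simp: is_adj_def[symmetric] intro: is_adj_unique)

lemma self_adjoint_iff: "self_adjoint A \<longleftrightarrow> is_adj A A"
  by (simp add: self_adjoint_def is_adj_def)

lemma is_adj_add: "is_adj A A' \<Longrightarrow> is_adj B B' \<Longrightarrow> is_adj (A + B) (A' + B')"
  and is_adj_diff: "is_adj A A' \<Longrightarrow> is_adj B B' \<Longrightarrow> is_adj (A - B) (A' - B')"
  and is_adj_mult: "is_adj A A' \<Longrightarrow> is_adj B B' \<Longrightarrow> is_adj (A * B) (B' * A')"
  and is_adj_scaleR: "is_adj A A' \<Longrightarrow> is_adj (r *\<^sub>R A) (r *\<^sub>R A')"
  and is_adj_scaleC: "is_adj A A' \<Longrightarrow> is_adj (c *\<^sub>C A) (cnj c *\<^sub>C A')"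
  and is_adj_one: "is_adj 1 1"
  and is_adj_zero: "is_adj 0 0"
  by (simp_all add: is_adj_def op_apply_simps cinner_add_left cinner_add_right cinner_diff_left
      cinner_diff_right cinner_scaleR_left cinner_scaleR_right cinner_scaleC_left cinner_scaleC_right)

lemma is_adj_sum: "(\<And>i. i \<in> I \<Longrightarrow> is_adj (f i) (g i)) \<Longrightarrow> is_adj (\<Sum>i\<in>I. f i) (\<Sum>i\<in>I. g i)"
  by (induction I rule: infinite_finite_induct) (simp_all add: is_adj_add is_adj_zero)

lemma is_adj_power: "is_adj A A' \<Longrightarrow> is_adj (A ^ n) (A' ^ n)"
proof (induction n)
  case (Suc n)
  show ?case using is_adj_mult[OF Suc.prems Suc.IH[OF Suc.prems]] by (simp add: power_commutes)
qed (simp add: is_adj_one)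

lemma norm_adj_apply_le:
  assumes "is_adj A A'" and c: "0 \<le> c" "\<And>x. norm (A \<bullet>\<^sub>o x) \<le> c * norm x"
  shows "norm (A' \<bullet>\<^sub>o x) \<le> c * norm x"
proof (cases "A' \<bullet>\<^sub>o x = 0")
  case False
  have "(norm (A' \<bullet>\<^sub>o x))\<^sup>2 = Re (cinner x (A \<bullet>\<^sub>o (A' \<bullet>\<^sub>o x)))"
    using assms(1) by (simp add: Re_cinner_self[symmetric] is_adjD)
  also have "\<dots> \<le> norm x * (c * norm (A' \<bullet>\<^sub>o x))"
    by (rule order_trans[OF abs_le_D1[OF Re_cinner_le]]) (simp add: c mult_left_mono)
  finally show ?thesis using False by (simp add: power2_eq_square mult.assoc mult.left_commute)
qed (simp add: c)


section \<open>Orthonormal bases\<close>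

lemma cspan_finite_repr:
  assumes "x \<in> cspan B"
  obtains F c where "finite F" "F \<subseteq> B" "x = (\<Sum>e\<in>F. c e *\<^sub>C (e :: 'a::complex_vector))"
proof -
  interpret vector_space "scaleC :: complex \<Rightarrow> 'a \<Rightarrow> 'a" by (rule vector_space_scaleC)
  show thesis using assms that unfolding span_explicit by blast
qed

lemma cinner_orthonormal_sum:
  fixes F :: "'a::complex_inner set"
  assumes F: "finite F" "\<And>e f. e \<in> F \<Longrightarrow> f \<in> F \<Longrightarrow> cinner e f = (if e = f then 1 else 0)"
    and e: "e \<in> F"
  shows "cinner e (\<Sum>f\<in>F. c f *\<^sub>C f) = c e"
proof -
  have "cinner e (\<Sum>f\<in>F. c f *\<^sub>C f) = (\<Sum>f\<in>F. if f = e then c e else 0)"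
    unfolding cinner_sum_right cinner_scaleC_right
    by (rule sum.cong[OF refl]) (use F(2)[OF e] in auto)
  thus ?thesis using F(1) e by simp
qed

text \<open>The error of the Fourier partial sum is orthogonal to the span of \<open>F\<close>. Every other combination
  of the same vectors is therefore worse, by the distance of the coefficients.\<close>

lemma onb_defect:
  fixes F :: "'a::complex_inner set"
  assumes F: "finite F" "\<And>e f. e \<in> F \<Longrightarrow> f \<in> F \<Longrightarrow> cinner e f = (if e = f then 1 else 0)"
  shows "(norm (x - (\<Sum>e\<in>F. c e *\<^sub>C e)))\<^sup>2
    = (norm (x - (\<Sum>e\<in>F. cinner e x *\<^sub>C e)))\<^sup>2 + (\<Sum>e\<in>F. (cmod (cinner e x - c e))\<^sup>2)"
proof -
  define z where "z = x - (\<Sum>e\<in>F. cinner e x *\<^sub>C e)"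
  define w where "w = (\<Sum>e\<in>F. (cinner e x - c e) *\<^sub>C e)"
  have orth: "cinner e z = 0" if "e \<in> F" for e
    using cinner_orthonormal_sum[OF F that] by (simp add: z_def cinner_diff_right)
  have ew: "cinner e w = cinner e x - c e" if "e \<in> F" for e
    using cinner_orthonormal_sum[OF F that] by (simp add: w_def)
  have "w = (\<Sum>e\<in>F. cinner e x *\<^sub>C e) - (\<Sum>e\<in>F. c e *\<^sub>C e)"
  proof -
    have "(cinner e x - c e) *\<^sub>C e = cinner e x *\<^sub>C e - c e *\<^sub>C e" for e
      using scaleC_add_left[of "cinner e x - c e" "c e" e] by (simp add: algebra_simps)
    thus ?thesis by (simp add: w_def sum_subtractf)
  qed
  hence dec: "x - (\<Sum>e\<in>F. c e *\<^sub>C e) = z + w" by (simp add: z_def)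
  have "cinner w z = 0" unfolding w_def by (simp add: cinner_sum_left cinner_scaleC_left orth)
  hence zw: "Re (cinner z w) = 0" using Re_cinner_commute[of z w] by simp
  have "cinner w w = (\<Sum>e\<in>F. cnj (cinner e x - c e) * (cinner e x - c e))"
    by (subst (1) w_def) (simp add: cinner_sum_left cinner_scaleC_left ew)
  also have "\<dots> = (\<Sum>e\<in>F. of_real ((cmod (cinner e x - c e))\<^sup>2))"
    by (rule sum.cong) (simp_all add: complex_norm_square mult.commute del: of_real_power)
  finally have "(norm w)\<^sup>2 = (\<Sum>e\<in>F. (cmod (cinner e x - c e))\<^sup>2)"
    by (metis Re_cinner_self Re_complex_of_real of_real_sum)
  thus ?thesis unfolding dec norm_add_square zw by (simp add: z_def)
qed

locale onb =
  fixes E :: "'a::chilbert_space set"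
  assumes onb: "is_onb E"
begin

lemma onb_cinner: "e \<in> E \<Longrightarrow> f \<in> E \<Longrightarrow> cinner e f = (if e = f then 1 else 0)"
  using onb by (auto simp: is_onb_def)

lemma onb_norm: "e \<in> E \<Longrightarrow> norm e = 1"
  using onb_cinner[of e e] Re_cinner_self[of e] norm_ge_zero[of e]
  by (auto simp: power2_eq_1_iff simp del: norm_ge_zero)

lemma onb_expansion: "((\<lambda>e. cinner e x *\<^sub>C e) has_sum x) E"
  unfolding has_sum_def tendsto_iff eventually_finite_subsets_at_top
proof (intro allI impI)
  fix r :: real assume "r > 0"
  moreover have "x \<in> closure (cspan E)" using onb by (simp add: is_onb_def)
  ultimately obtain y where y: "y \<in> cspan E" "dist y x < r"
    by (metis closure_approachable)
  obtain F c where F: "finite F" "F \<subseteq> E" "y = (\<Sum>e\<in>F. c e *\<^sub>C e)"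
    using cspan_finite_repr[OF y(1)] .
  show "\<exists>X. finite X \<and> X \<subseteq> E \<and>
    (\<forall>Y. finite Y \<and> X \<subseteq> Y \<and> Y \<subseteq> E \<longrightarrow> dist (\<Sum>e\<in>Y. cinner e x *\<^sub>C e) x < r)"
  proof (intro exI[of _ F] conjI allI impI F)
    fix Y assume Y: "finite Y \<and> F \<subseteq> Y \<and> Y \<subseteq> E"
    define d where "d e = (if e \<in> F then c e else 0)" for e
    have z: "0 *\<^sub>C e = 0" for e :: 'a using scaleR_scaleC[of 0 e] by simp
    have "(\<Sum>e\<in>Y. d e *\<^sub>C e) = (\<Sum>e\<in>F. d e *\<^sub>C e)"
      using Y by (intro sum.mono_neutral_right) (auto simp: d_def z)
    hence yd: "y = (\<Sum>e\<in>Y. d e *\<^sub>C e)" by (simp add: F d_def)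
    have "(norm (x - (\<Sum>e\<in>Y. cinner e x *\<^sub>C e)))\<^sup>2 \<le> (norm (x - y))\<^sup>2"
      unfolding yd
      by (subst onb_defect[where c = d])
        (use Y in \<open>auto intro!: sum_nonneg simp: onb_cinner subset_iff\<close>)
    hence "norm (x - (\<Sum>e\<in>Y. cinner e x *\<^sub>C e)) \<le> norm (x - y)"
      by (rule power2_le_imp_le) simp
    thus "dist (\<Sum>e\<in>Y. cinner e x *\<^sub>C e) x < r"
      using y(2) by (simp add: dist_norm norm_minus_commute)
  qed
qed

lemma onb_parseval: "((\<lambda>e. cinner y e * cinner e x) has_sum cinner y x) E"
  using has_sum_bounded_linear[OF bounded_linear_cinner onb_expansion, of y x]
  by (simp add: o_def cinner_scaleC_right mult.commute)

lemma onb_parseval_norm: "((\<lambda>e. (cmod (cinner e x))\<^sup>2) has_sum (norm x)\<^sup>2) E"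
proof -
  have "cinner x e * cinner e x = of_real ((cmod (cinner e x))\<^sup>2)" for e
    by (subst cinner_commute) (simp add: complex_norm_square mult.commute del: of_real_power)
  hence "((\<lambda>e. complex_of_real ((cmod (cinner e x))\<^sup>2)) has_sum cinner x x) E"
    using onb_parseval[of x x] by simp
  from has_sum_Re[OF this] show ?thesis by (simp add: Re_cinner_self)
qed

end

section \<open>Hilbert-Schmidt operators\<close>

context onb
begin

text \<open>With an adjoint as part of the definition, the class is closed under adjoints. The pairing
  \<open>hip\<close> is the real part of the Hilbert-Schmidt inner product; it makes \<open>HS\<close> a real inner product
  space.\<close>

definition HS :: "'a bounded_op set"
  where "HS = {A. (\<exists>A'. is_adj A A') \<and> (\<lambda>e. (norm (A \<bullet>\<^sub>o e))\<^sup>2) summable_on E}"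

definition hip :: "'a bounded_op \<Rightarrow> 'a bounded_op \<Rightarrow> real"
  where "hip A B = (\<Sum>\<^sub>\<infinity>e\<in>E. Re (cinner (A \<bullet>\<^sub>o e) (B \<bullet>\<^sub>o e)))"

lemma abs_summable_mixed:
  assumes "(\<lambda>e. (norm (f e))\<^sup>2) summable_on I" "(\<lambda>e. (norm (g e))\<^sup>2) summable_on I"
    and "\<And>e. e \<in> I \<Longrightarrow> norm (h e) \<le> norm (f e) * norm (g e)"
  shows "(\<lambda>e. norm (h e)) summable_on I"
proof (rule Infinite_Sum.abs_summable_on_comparison_test')
  show "(\<lambda>e. (norm (f e))\<^sup>2 + (norm (g e))\<^sup>2) summable_on I"
    using assms(1,2) by (rule summable_on_add)
  fix e assume "e \<in> I"
  have "2 * (norm (f e) * norm (g e)) \<le> (norm (f e))\<^sup>2 + (norm (g e))\<^sup>2"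
    using sum_squares_bound[of "norm (f e)" "norm (g e)"] by simp
  moreover have "0 \<le> norm (f e) * norm (g e)" by simp
  ultimately show "norm (h e) \<le> (norm (f e))\<^sup>2 + (norm (g e))\<^sup>2"
    using assms(3)[OF \<open>e \<in> I\<close>] by linarith
qed

lemma cinner_summable:
  assumes "(\<lambda>e. (norm (f e :: 'a))\<^sup>2) summable_on I" "(\<lambda>e. (norm (g e))\<^sup>2) summable_on I"
  shows "(\<lambda>e. cinner (f e) (g e)) summable_on I"
  by (rule abs_summable_summable, rule abs_summable_mixed[OF assms Cauchy_Schwarz_cinner])

text \<open>The double series \<open>\<Sum>\<^sub>e\<^sub>,\<^sub>f \<langle>Ae, f\<rangle>\<langle>f, Be\<rangle>\<close> may be summed over \<open>e\<close> first;
  this yields at once the independence of the basis, the invariance of the Hilbert-Schmidt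
  inner product under adjoints, and the cyclicity of the trace.\<close>

lemma hip_transfer_complex:
  assumes A: "is_adj A A'" "(\<lambda>e. (norm (A \<bullet>\<^sub>o e))\<^sup>2) summable_on E"
    and B: "is_adj B B'" "(\<lambda>e. (norm (B \<bullet>\<^sub>o e))\<^sup>2) summable_on E"
    and F: "is_onb F"
  shows "((\<lambda>f. cinner (B' \<bullet>\<^sub>o f) (A' \<bullet>\<^sub>o f)) has_sum (\<Sum>\<^sub>\<infinity>e\<in>E. cinner (A \<bullet>\<^sub>o e) (B \<bullet>\<^sub>o e))) F"
proof -
  interpret F: onb F by unfold_locales fact
  define g where "g e f = cinner (A \<bullet>\<^sub>o e) f * cinner f (B \<bullet>\<^sub>o e)" for e f
  have sq: "(\<lambda>(e, f). (cmod (cinner f (C \<bullet>\<^sub>o e)))\<^sup>2) summable_on E \<times> F"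
    if "(\<lambda>e. (norm (C \<bullet>\<^sub>o e))\<^sup>2) summable_on E" for C
    by (rule summable_on_SigmaI[where g = "\<lambda>e. (norm (C \<bullet>\<^sub>o e))\<^sup>2"])
      (use that in \<open>auto intro: F.onb_parseval_norm\<close>)
  have cm: "cmod (cinner (A \<bullet>\<^sub>o e) f) = cmod (cinner f (A \<bullet>\<^sub>o e))" for e f
    by (subst cinner_commute) simp
  have "(\<lambda>ef. norm (case ef of (e, f) \<Rightarrow> g e f)) summable_on E \<times> F"
  proof (rule abs_summable_mixed)
    show "(\<lambda>ef. (norm (case ef of (e, f) \<Rightarrow> cinner f (A \<bullet>\<^sub>o e)))\<^sup>2) summable_on E \<times> F"
      using sq[OF A(2)] by (simp add: case_prod_unfold)
    show "(\<lambda>ef. (norm (case ef of (e, f) \<Rightarrow> cinner f (B \<bullet>\<^sub>o e)))\<^sup>2) summable_on E \<times> F"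
      using sq[OF B(2)] by (simp add: case_prod_unfold)
  qed (auto simp: g_def norm_mult cm)
  hence "(\<lambda>(e, f). g e f) summable_on E \<times> F"
    by (rule abs_summable_summable)
  then obtain S where S: "((\<lambda>(e, f). g e f) has_sum S) (E \<times> F)"
    by (auto simp: summable_on_def)
  have row: "((\<lambda>f. g e f) has_sum cinner (A \<bullet>\<^sub>o e) (B \<bullet>\<^sub>o e)) F" for e
    unfolding g_def by (rule F.onb_parseval)
  have "((\<lambda>e. cinner (A \<bullet>\<^sub>o e) (B \<bullet>\<^sub>o e)) has_sum S) E"
    by (rule has_sum_SigmaD[OF S]) (simp add: row)
  hence S_eq: "S = (\<Sum>\<^sub>\<infinity>e\<in>E. cinner (A \<bullet>\<^sub>o e) (B \<bullet>\<^sub>o e))"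
    by (simp add: infsumI)
  have "g e f = cinner (B' \<bullet>\<^sub>o f) e * cinner e (A' \<bullet>\<^sub>o f)" for e f
    by (simp add: g_def is_adjD[OF B(1)] is_adjD[OF is_adj_sym[OF A(1)]])
  hence col: "((\<lambda>e. g e f) has_sum cinner (B' \<bullet>\<^sub>o f) (A' \<bullet>\<^sub>o f)) E" for f
    by (simp add: onb_parseval)
  have "((\<lambda>(f, e). g e f) has_sum S) (F \<times> E)"
    using S by (subst (asm) has_sum_swap) (simp add: case_prod_unfold)
  from has_sum_SigmaD[OF this] col show ?thesis by (simp add: S_eq)
qed

lemma hip_transfer:
  assumes A: "is_adj A A'" "A \<in> HS" and B: "is_adj B B'" "B \<in> HS" and F: "is_onb F"
  shows "((\<lambda>f. Re (cinner (B' \<bullet>\<^sub>o f) (A' \<bullet>\<^sub>o f))) has_sum hip A B) F"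
proof -
  have s: "(\<lambda>e. (norm (A \<bullet>\<^sub>o e))\<^sup>2) summable_on E" "(\<lambda>e. (norm (B \<bullet>\<^sub>o e))\<^sup>2) summable_on E"
    using A B by (auto simp: HS_def)
  have "hip A B = Re (\<Sum>\<^sub>\<infinity>e\<in>E. cinner (A \<bullet>\<^sub>o e) (B \<bullet>\<^sub>o e))"
    unfolding hip_def by (rule infsum_Re[OF cinner_summable[OF s]])
  thus ?thesis using has_sum_Re[OF hip_transfer_complex[OF A(1) s(1) B(1) s(2) F]] by simp
qed

lemma HS_adjE: assumes "A \<in> HS" obtains A' where "is_adj A A'"
  using assms by (auto simp: HS_def)

lemma HS_summable: "A \<in> HS \<Longrightarrow> (\<lambda>e. (norm (A \<bullet>\<^sub>o e))\<^sup>2) summable_on E"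
  by (simp add: HS_def)

lemma hip_has_sum:
  "A \<in> HS \<Longrightarrow> B \<in> HS \<Longrightarrow> ((\<lambda>e. Re (cinner (A \<bullet>\<^sub>o e) (B \<bullet>\<^sub>o e))) has_sum hip A B) E"
  unfolding hip_def
  by (intro has_sum_infsum summable_on_Re cinner_summable HS_summable)

lemma hip_self: "hip A A = (\<Sum>\<^sub>\<infinity>e\<in>E. (norm (A \<bullet>\<^sub>o e))\<^sup>2)"
  by (simp add: hip_def Re_cinner_self)

lemma hip_adj: "is_adj A A' \<Longrightarrow> is_adj B B' \<Longrightarrow> A \<in> HS \<Longrightarrow> B \<in> HS \<Longrightarrow> hip A B = hip B' A'"
  using infsumI[OF hip_transfer[OF _ _ _ _ onb]] by (simp add: hip_def)

lemma HS_adj: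
  assumes "is_adj A A'" "A \<in> HS"
  shows "A' \<in> HS"
  using hip_transfer[OF assms assms onb] is_adj_sym[OF assms(1)]
  by (auto simp: HS_def Re_cinner_self has_sum_imp_summable)

lemma HS_I:
  "is_adj A A' \<Longrightarrow> (\<lambda>e. (norm (A \<bullet>\<^sub>o e))\<^sup>2) summable_on E \<Longrightarrow> A \<in> HS"
  by (auto simp: HS_def)

lemma HS_zero: "0 \<in> HS"
  by (rule HS_I[OF is_adj_zero]) (simp add: zero_op_apply)

lemma HS_add:
  assumes A: "A \<in> HS" and B: "B \<in> HS"
  shows "A + B \<in> HS"
proof -
  obtain A' B' where *: "is_adj A A'" "is_adj B B'" using A B by (meson HS_adjE)
  have "(\<lambda>e. 2 * (norm (A \<bullet>\<^sub>o e))\<^sup>2 + 2 * (norm (B \<bullet>\<^sub>o e))\<^sup>2) summable_on E"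
    using A B by (intro summable_on_add summable_on_cmult_right HS_summable)
  hence "(\<lambda>e. (norm ((A + B) \<bullet>\<^sub>o e))\<^sup>2) summable_on E"
  proof (rule summable_on_comparison_test)
    fix e
    have "(norm ((A + B) \<bullet>\<^sub>o e))\<^sup>2 \<le> (norm (A \<bullet>\<^sub>o e) + norm (B \<bullet>\<^sub>o e))\<^sup>2"
      by (intro power_mono) (simp_all add: plus_op_apply norm_triangle_ineq)
    also have "\<dots> \<le> 2 * (norm (A \<bullet>\<^sub>o e))\<^sup>2 + 2 * (norm (B \<bullet>\<^sub>o e))\<^sup>2"
      using sum_squares_bound[of "norm (A \<bullet>\<^sub>o e)" "norm (B \<bullet>\<^sub>o e)"] by (simp add: power2_sum)
    finally show "(norm ((A + B) \<bullet>\<^sub>o e))\<^sup>2 \<le> 2 * (norm (A \<bullet>\<^sub>o e))\<^sup>2 + 2 * (norm (B \<bullet>\<^sub>o e))\<^sup>2" .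
  qed simp
  thus ?thesis by (rule HS_I[OF is_adj_add[OF *]])
qed

lemma HS_mult_left:
  assumes "is_adj B B'" "A \<in> HS"
  shows "B * A \<in> HS"
proof -
  obtain A' where "is_adj A A'" using assms(2) by (rule HS_adjE)
  hence adj: "is_adj (B * A) (A' * B')" by (rule is_adj_mult[OF assms(1)])
  have "(\<lambda>e. (norm B)\<^sup>2 * (norm (A \<bullet>\<^sub>o e))\<^sup>2) summable_on E"
    using assms by (intro summable_on_cmult_right HS_summable)
  hence "(\<lambda>e. (norm ((B * A) \<bullet>\<^sub>o e))\<^sup>2) summable_on E"
    by (rule summable_on_comparison_test)
      (simp_all add: times_op_apply norm_op_apply power_mono flip: power_mult_distrib)
  thus ?thesis by (rule HS_I[OF adj])
qed

lemma HS_mult_right: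
  assumes "is_adj B B'" "A \<in> HS"
  shows "A * B \<in> HS"
proof -
  obtain A' where A': "is_adj A A'" using assms(2) by (rule HS_adjE)
  have "B' * A' \<in> HS"
    using is_adj_sym[OF assms(1)] HS_adj[OF A' assms(2)] by (rule HS_mult_left)
  moreover have "is_adj (B' * A') (A * B)"
    by (rule is_adj_mult[OF is_adj_sym is_adj_sym]) fact+
  ultimately show ?thesis by (rule HS_adj[rotated])
qed

lemma HS_scaleC: "A \<in> HS \<Longrightarrow> c *\<^sub>C A \<in> HS"
  using HS_mult_left[OF is_adj_scaleC[OF is_adj_one], of A c] by (simp add: scaleC_op_mult)

lemma HS_scaleR: "A \<in> HS \<Longrightarrow> r *\<^sub>R A \<in> HS"
  by (simp add: scaleR_scaleC HS_scaleC)

lemma HS_uminus: "A \<in> HS \<Longrightarrow> - A \<in> HS"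
  using HS_scaleR[of A "-1"] by simp

lemma HS_diff: "A \<in> HS \<Longrightarrow> B \<in> HS \<Longrightarrow> A - B \<in> HS"
  using HS_add[of A "- B"] by (simp add: HS_uminus)

lemma HS_sum: "(\<And>i. i \<in> I \<Longrightarrow> f i \<in> HS) \<Longrightarrow> (\<Sum>i\<in>I. f i) \<in> HS"
  by (induction I rule: infinite_finite_induct) (simp_all add: HS_add HS_zero)

lemma hip_commute: "hip A B = hip B A"
  by (simp add: hip_def Re_cinner_commute)

lemma hip_nonneg: "0 \<le> hip A A"
  unfolding hip_self by (rule infsum_nonneg) simp

lemma hip_add_left: "A \<in> HS \<Longrightarrow> B \<in> HS \<Longrightarrow> C \<in> HS \<Longrightarrow> hip (A + B) C = hip A C + hip B C"
  using infsumI[OF has_sum_add[OF hip_has_sum[of A C] hip_has_sum[of B C]]]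
  by (simp add: hip_def plus_op_apply cinner_add_left)

lemma hip_scaleR_left: "A \<in> HS \<Longrightarrow> C \<in> HS \<Longrightarrow> hip (r *\<^sub>R A) C = r * hip A C"
  using infsumI[OF has_sum_cmult_right[OF hip_has_sum[of A C]], of r]
  by (simp add: hip_def scaleR_op_apply cinner_scaleR_left)

lemma hip_add_right: "A \<in> HS \<Longrightarrow> B \<in> HS \<Longrightarrow> C \<in> HS \<Longrightarrow> hip C (A + B) = hip C A + hip C B"
  using hip_add_left by (simp add: hip_commute)

lemma hip_scaleR_right: "A \<in> HS \<Longrightarrow> C \<in> HS \<Longrightarrow> hip C (r *\<^sub>R A) = r * hip C A"
  using hip_scaleR_left by (simp add: hip_commute)

lemma hip_sum_right:
  "(\<And>i. i \<in> I \<Longrightarrow> f i \<in> HS) \<Longrightarrow> C \<in> HS \<Longrightarrow> hip C (\<Sum>i\<in>I. f i) = (\<Sum>i\<in>I. hip C (f i))"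
proof (induction I rule: infinite_finite_induct)
  case (insert i I)
  thus ?case by (simp add: hip_add_right HS_sum)
qed (simp_all add: hip_def zero_op_apply)

lemma hip_mult_left:
  assumes "is_adj B B'" "X \<in> HS" "Y \<in> HS"
  shows "hip (B * X) Y = hip X (B' * Y)"
  unfolding hip_def using is_adjD[OF is_adj_sym[OF assms(1)]] by (simp add: times_op_apply)

text \<open>Taking adjoints turns right multiplications into left multiplications.\<close>

lemma hip_mult_right:
  assumes "is_adj B B'" "X \<in> HS" "Y \<in> HS"
  shows "hip (X * B) Y = hip X (Y * B')"
proof -
  obtain X' Y' where *: "is_adj X X'" "is_adj Y Y'" using assms by (meson HS_adjE)
  have B': "is_adj B' B" by (rule is_adj_sym[OF assms(1)])
  have in_HS: "X' \<in> HS" "Y' \<in> HS" using * assms by (auto intro: HS_adj)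
  have "hip (X * B) Y = hip Y' (B' * X')"
    by (rule hip_adj[OF is_adj_mult[OF *(1) assms(1)] *(2) HS_mult_right[OF assms(1,2)] assms(3)])
  also have "\<dots> = hip (B * Y') X'"
    by (rule hip_mult_left[OF assms(1) in_HS(2,1), symmetric])
  also have "\<dots> = hip X (Y * B')"
    by (rule hip_adj[OF *(1) is_adj_mult[OF *(2) B'] assms(2) HS_mult_right[OF B' assms(3)], symmetric])
  finally show ?thesis .
qed

lemma hip_mono:
  assumes "A \<in> HS" "B \<in> HS" "0 \<le> c" "\<And>x. norm (A \<bullet>\<^sub>o x) \<le> c * norm (B \<bullet>\<^sub>o x)"
  shows "hip A A \<le> c\<^sup>2 * hip B B"
proof -
  have "hip A A \<le> (\<Sum>\<^sub>\<infinity>e\<in>E. c\<^sup>2 * (norm (B \<bullet>\<^sub>o e))\<^sup>2)"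
    unfolding hip_self using assms
    by (intro infsum_mono HS_summable summable_on_cmult_right)
      (simp_all add: power_mono flip: power_mult_distrib)
  thus ?thesis by (simp add: hip_self infsum_cmult_right')
qed

lemma hip_mult_left_le:
  "is_adj B B' \<Longrightarrow> A \<in> HS \<Longrightarrow> 0 \<le> c \<Longrightarrow> (\<And>x. norm (B \<bullet>\<^sub>o x) \<le> c * norm x) \<Longrightarrow>
    hip (B * A) (B * A) \<le> c\<^sup>2 * hip A A"
  by (rule hip_mono) (simp_all add: HS_mult_left times_op_apply)

lemma hip_mult_right_le:
  assumes B: "is_adj B B'" "0 \<le> c" "\<And>x. norm (B \<bullet>\<^sub>o x) \<le> c * norm x" and "A \<in> HS"
  shows "hip (A * B) (A * B) \<le> c\<^sup>2 * hip A A"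
proof -
  obtain A' where A': "is_adj A A'" using assms(4) by (rule HS_adjE)
  note AB = is_adj_mult[OF A' B(1)] and AB_HS = HS_mult_right[OF B(1) assms(4)]
  have "hip (A * B) (A * B) = hip (B' * A') (B' * A')"
    by (rule hip_adj[OF AB AB AB_HS AB_HS])
  also have "\<dots> \<le> c\<^sup>2 * hip A' A'"
    using norm_adj_apply_le[OF B(1,2,3)]
    by (intro hip_mult_left_le[OF is_adj_sym[OF B(1)] HS_adj[OF A' assms(4)] B(2)])
  also have "hip A' A' = hip A A"
    by (rule hip_adj[OF A' A' assms(4,4), symmetric])
  finally show ?thesis .
qed


section \<open>Sums of products of Hilbert-Schmidt operators, and the trace\<close>

text \<open>On these sums the trace is computed by \<open>hip\<close>. The second order Taylor remainders are of this
  form.\<close>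

inductive_set TC :: "'a bounded_op set" where
  TC_mult: "X \<in> HS \<Longrightarrow> Y \<in> HS \<Longrightarrow> X * Y \<in> TC"
| TC_add: "A \<in> TC \<Longrightarrow> B \<in> TC \<Longrightarrow> A + B \<in> TC"

definition rtr :: "'a bounded_op \<Rightarrow> real"
  where "rtr A = (\<Sum>\<^sub>\<infinity>e\<in>E. Re (cinner e (A \<bullet>\<^sub>o e)))"

lemma TC_zero: "0 \<in> TC"
  using TC_mult[OF HS_zero HS_zero] by simp

lemma TC_sum: "(\<And>i. i \<in> I \<Longrightarrow> f i \<in> TC) \<Longrightarrow> (\<Sum>i\<in>I. f i) \<in> TC"
  by (induction I rule: infinite_finite_induct) (simp_all add: TC_add TC_zero)

lemma TC_mult_left: "A \<in> TC \<Longrightarrow> is_adj B B' \<Longrightarrow> B * A \<in> TC"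
proof (induction rule: TC.induct)
  case (TC_mult X Y)
  thus ?case using TC.TC_mult[OF HS_mult_left[of B B' X], of Y] by (simp add: mult.assoc)
qed (simp add: distrib_left TC_add)

lemma TC_scaleC: "A \<in> TC \<Longrightarrow> c *\<^sub>C A \<in> TC"
  using TC_mult_left[OF _ is_adj_scaleC[OF is_adj_one], of A c] by (simp add: scaleC_op_mult)

lemma TC_adjE:
  assumes "A \<in> TC" obtains A' where "is_adj A A'"
proof -
  have "\<exists>A'. is_adj A A'" using assms
  proof (induction rule: TC.induct)
    case (TC_mult X Y)
    thus ?case by (meson HS_adjE is_adj_mult)
  qed (meson is_adj_add)
  thus thesis using that by blast
qed

lemma TC_summable: "A \<in> TC \<Longrightarrow> (\<lambda>e. cinner e (A \<bullet>\<^sub>o e)) summable_on E"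
proof (induction rule: TC.induct)
  case (TC_mult X Y)
  obtain X' where X': "is_adj X X'" using TC_mult(1) by (rule HS_adjE)
  show ?case
    using cinner_summable[OF HS_summable[OF HS_adj[OF X' TC_mult(1)]] HS_summable[OF TC_mult(2)]]
    by (simp add: times_op_apply is_adjD[OF X'])
next
  case (TC_add A B)
  thus ?case by (simp add: plus_op_apply cinner_add_right summable_on_add)
qed

lemma rtr_mult: "is_adj X X' \<Longrightarrow> rtr (X * Y) = hip X' Y"
  by (simp add: rtr_def hip_def times_op_apply is_adjD)

lemma rtr_has_sum: "A \<in> TC \<Longrightarrow> ((\<lambda>e. Re (cinner e (A \<bullet>\<^sub>o e))) has_sum rtr A) E"
  unfolding rtr_def by (intro has_sum_infsum summable_on_Re TC_summable)

lemma rtr_add: "A \<in> TC \<Longrightarrow> B \<in> TC \<Longrightarrow> rtr (A + B) = rtr A + rtr B"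
  using infsumI[OF has_sum_add[OF rtr_has_sum[of A] rtr_has_sum[of B]]]
  by (simp add: rtr_def plus_op_apply cinner_add_right)

lemma rtr_sum: "(\<And>i. i \<in> I \<Longrightarrow> f i \<in> TC) \<Longrightarrow> rtr (\<Sum>i\<in>I. f i) = (\<Sum>i\<in>I. rtr (f i))"
proof (induction I rule: infinite_finite_induct)
  case (insert i I)
  thus ?case by (simp add: rtr_add TC_sum)
qed (simp_all add: rtr_def zero_op_apply)

lemma rtr_commute_HS:
  assumes "X \<in> HS" "Y \<in> HS"
  shows "rtr (X * Y) = rtr (Y * X)"
proof -
  obtain X' Y' where *: "is_adj X X'" "is_adj Y Y'" using assms by (meson HS_adjE)
  have "hip X' Y = hip Y' X"
    by (rule hip_adj[OF is_adj_sym[OF *(1)] *(2) HS_adj[OF *(1) assms(1)] assms(2)])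
  thus ?thesis using * by (simp add: rtr_mult)
qed

text \<open>The trace pairing of a sum of products of Hilbert-Schmidt operators with contractions is
  uniformly bounded. This is the form in which such a sum will be seen to be of trace class.\<close>

lemma TC_contraction_bound:
  "A \<in> TC \<Longrightarrow> \<exists>C. \<forall>(U :: 'a bounded_op) U' F. is_adj U U' \<longrightarrow> (\<forall>x. norm (U \<bullet>\<^sub>o x) \<le> norm x) \<longrightarrow> finite F \<longrightarrow> F \<subseteq> E \<longrightarrow>
    (\<Sum>e\<in>F. Re (cinner (U \<bullet>\<^sub>o e) (A \<bullet>\<^sub>o e))) \<le> C"
proof (induction rule: TC.induct)
  case (TC_mult X Y)
  obtain X' where X': "is_adj X X'" using TC_mult(1) by (rule HS_adjE)
  have X'_HS: "X' \<in> HS" by (rule HS_adj[OF X' TC_mult(1)])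
  show ?case
  proof (intro exI[of _ "hip X' X' + hip Y Y"] allI impI)
    fix U U' :: "'a bounded_op" and F assume U: "is_adj U U'" "\<forall>x. norm (U \<bullet>\<^sub>o x) \<le> norm x" and F: "finite F" "F \<subseteq> E"
    have "Re (cinner (U \<bullet>\<^sub>o e) ((X * Y) \<bullet>\<^sub>o e)) \<le> (norm ((X' * U) \<bullet>\<^sub>o e))\<^sup>2 + (norm (Y \<bullet>\<^sub>o e))\<^sup>2" for e
    proof -
      have "Re (cinner (U \<bullet>\<^sub>o e) ((X * Y) \<bullet>\<^sub>o e)) = Re (cinner ((X' * U) \<bullet>\<^sub>o e) (Y \<bullet>\<^sub>o e))"
        by (simp add: times_op_apply is_adjD[OF X'])
      also have "\<dots> \<le> norm ((X' * U) \<bullet>\<^sub>o e) * norm (Y \<bullet>\<^sub>o e)" by (rule abs_le_D1[OF Re_cinner_le])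
      also have "\<dots> \<le> (norm ((X' * U) \<bullet>\<^sub>o e))\<^sup>2 + (norm (Y \<bullet>\<^sub>o e))\<^sup>2"
        using sum_squares_bound[of "norm ((X' * U) \<bullet>\<^sub>o e)" "norm (Y \<bullet>\<^sub>o e)"]
          mult_nonneg_nonneg[OF norm_ge_zero norm_ge_zero, of "(X' * U) \<bullet>\<^sub>o e" "Y \<bullet>\<^sub>o e"] by linarith
      finally show ?thesis .
    qed
    hence "(\<Sum>e\<in>F. Re (cinner (U \<bullet>\<^sub>o e) ((X * Y) \<bullet>\<^sub>o e)))
        \<le> (\<Sum>e\<in>F. (norm ((X' * U) \<bullet>\<^sub>o e))\<^sup>2) + (\<Sum>e\<in>F. (norm (Y \<bullet>\<^sub>o e))\<^sup>2)"
      by (simp add: sum_mono flip: sum.distrib)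
    also have "\<dots> \<le> hip (X' * U) (X' * U) + hip Y Y"
      unfolding hip_self using F
      by (intro add_mono finite_sum_le_infsum HS_summable HS_mult_right[OF U(1)] X'_HS TC_mult(2)) auto
    also have "hip (X' * U) (X' * U) \<le> hip X' X'"
      using hip_mult_right_le[OF U(1), of 1, OF _ _ X'_HS] U(2) by simp
    finally show "(\<Sum>e\<in>F. Re (cinner (U \<bullet>\<^sub>o e) ((X * Y) \<bullet>\<^sub>o e))) \<le> hip X' X' + hip Y Y"
      by simp
  qed
next
  case (TC_add A B)
  then obtain C D where
    C: "\<And>U U' F. is_adj U U' \<Longrightarrow> (\<forall>x. norm (U \<bullet>\<^sub>o x) \<le> norm x) \<Longrightarrow> finite F \<Longrightarrow> F \<subseteq> E \<Longrightarrow>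
      (\<Sum>e\<in>F. Re (cinner (U \<bullet>\<^sub>o e) (A \<bullet>\<^sub>o e))) \<le> C" and
    D: "\<And>U U' F. is_adj U U' \<Longrightarrow> (\<forall>x. norm (U \<bullet>\<^sub>o x) \<le> norm x) \<Longrightarrow> finite F \<Longrightarrow> F \<subseteq> E \<Longrightarrow>
      (\<Sum>e\<in>F. Re (cinner (U \<bullet>\<^sub>o e) (B \<bullet>\<^sub>o e))) \<le> D"
    by metis
  show ?case
    by (intro exI[of _ "C + D"] allI impI)
      (simp add: plus_op_apply cinner_add_right sum.distrib add_mono C D)
qed

end

section \<open>Polynomials of symmetric operators\<close>

text \<open>The Bernstein basis reproduces \<open>x\<^sup>j\<close> exactly if the node values \<open>(k/n)\<^sup>j\<close> are replaced by the
  ratios on the left. Both are products of \<open>j\<close> factors, which differ by \<open>O(1/n)\<close>.\<close>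

lemma binomial_ratio_bound:
  assumes "k \<le> n" "2 * j < n"
  shows "\<bar>real (k choose j) / real (n choose j) - (real k / real n) ^ j\<bar> \<le> 2 * (real j)\<^sup>2 / real n"
proof -
  have n: "real n > 0" using assms by simp
  have ratio: "real (k choose j) / real (n choose j) = (\<Prod>i<j. (real k - real i) / (real n - real i))"
    by (simp add: binomial_gbinomial gbinomial_prod_rev prod_dividef lessThan_atLeast0)
  have "\<bar>(\<Prod>i<j. (real k - real i) / (real n - real i)) - (\<Prod>i<j. real k / real n)\<bar>
      \<le> (\<Sum>i<j. \<bar>(real k - real i) / (real n - real i) - real k / real n\<bar>)"
    unfolding real_norm_def[symmetric]
  proof (rule norm_prod_diff)
    fix i assume "i \<in> {..<j}"
    thus "norm ((real k - real i) / (real n - real i)) \<le> 1"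
      using assms by (simp add: divide_le_eq_1)
    show "norm (real k / real n) \<le> 1" using assms by (simp add: divide_le_eq_1)
  qed
  also have "\<dots> \<le> (\<Sum>i<j. 2 * real j / real n)"
  proof (rule sum_mono)
    fix i assume "i \<in> {..<j}"
    hence i: "real i \<le> real j" "real n - real i \<ge> real n / 2" using assms by auto
    have "(real k - real i) / (real n - real i) - real k / real n
        = - (real i * ((real n - real k) / real n)) / (real n - real i)"
      using i n by (simp add: field_simps)
    also have "\<bar>\<dots>\<bar> = (real i * ((real n - real k) / real n)) / (real n - real i)"
      using i n assms by (simp add: abs_mult)
    also have "\<dots> \<le> (real j * 1) / (real n / 2)"
      using i n assms by (intro frac_le mult_mono) (auto simp: divide_le_eq_1)
    finally show "\<bar>(real k - real i) / (real n - real i) - real k / real n\<bar> \<le> 2 * real j / real n"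
      by (simp add: mult.commute)
  qed
  also have "\<dots> = 2 * (real j)\<^sup>2 / real n" by (simp add: power2_eq_square)
  finally show ?thesis by (simp add: ratio)
qed

text \<open>A functional that is non-negative on the Bernstein basis is a limit of the discrete positive
  functionals \<open>q \<mapsto> \<Sum>\<^sub>k q(k/n) w\<^sub>k\<close> with weights \<open>w\<^sub>k\<close> of total mass \<open>\<phi>(1)\<close>, and so is
  bounded by the supremum over the unit interval.\<close>

lemma bernstein_functional_bound:
  fixes \<phi> :: "real poly \<Rightarrow> real"
  assumes add: "\<And>p q. \<phi> (p + q) = \<phi> p + \<phi> q"
    and smult: "\<And>c p. \<phi> (smult c p) = c * \<phi> p"
    and pos: "\<And>k m. 0 \<le> \<phi> ([:0, 1:] ^ k * [:1, -1:] ^ m)"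
    and bnd: "\<And>t. 0 \<le> t \<Longrightarrow> t \<le> 1 \<Longrightarrow> \<bar>poly q t\<bar> \<le> M"
  shows "\<bar>\<phi> q\<bar> \<le> M * \<phi> 1"
proof -
  define X Y :: "real poly" where "X = [:0, 1:]" and "Y = [:1, -1:]"
  have XY: "X + Y = 1" by (simp add: X_def Y_def)
  have zero: "\<phi> 0 = 0" using smult[of 0 0] by simp
  have \<phi>_sum: "\<phi> (\<Sum>i\<in>I. f i) = (\<Sum>i\<in>I. \<phi> (f i))" for f :: "nat \<Rightarrow> real poly" and I
    by (induction I rule: infinite_finite_induct) (simp_all add: add zero)
  define w where "w n k = real (n choose k) * \<phi> (X ^ k * Y ^ (n - k))" for n k
  have w_nonneg: "0 \<le> w n k" for n k
    using pos unfolding w_def X_def Y_def by simp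
  have nat_smult: "of_nat m * (p :: real poly) = smult (real m) p" for m p
    by (simp add: of_nat_poly)
  have moment: "\<phi> (X ^ j) = (\<Sum>k\<le>n. real (k choose j) / real (n choose j) * w n k)"
    if j: "j \<le> n" for j n
  proof -
    have "X ^ j = X ^ j * (X + Y) ^ (n - j)" by (simp add: XY)
    also have "\<dots> = (\<Sum>i\<le>n - j. smult (real (n - j choose i)) (X ^ (j + i) * Y ^ (n - (j + i))))"
      unfolding binomial_ring sum_distrib_left
      by (rule sum.cong) (simp_all add: nat_smult power_add mult.assoc)
    finally have "\<phi> (X ^ j) = (\<Sum>i\<le>n - j. real (n - j choose i) * \<phi> (X ^ (j + i) * Y ^ (n - (j + i))))"
      by (metis (no_types, lifting) \<phi>_sum smult sum.cong)
    also have "\<dots> = (\<Sum>k\<in>{j..n}. real (n - j choose (k - j)) * \<phi> (X ^ k * Y ^ (n - k)))"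
      using j by (intro sum.reindex_bij_witness[where i = "\<lambda>k. k - j" and j = "\<lambda>i. j + i"]) auto
    also have "\<dots> = (\<Sum>k\<in>{j..n}. real (k choose j) / real (n choose j) * w n k)"
    proof (rule sum.cong[OF refl])
      fix k assume k: "k \<in> {j..n}"
      hence "real (n choose k) * real (k choose j) = real (n choose j) * real (n - j choose (k - j))"
        by (simp add: choose_mult flip: of_nat_mult)
      moreover have "real (n choose j) > 0" using j by simp
      ultimately have "real (n - j choose (k - j)) = real (k choose j) / real (n choose j) * real (n choose k)"
        by (simp add: field_simps)
      thus "real (n - j choose (k - j)) * \<phi> (X ^ k * Y ^ (n - k))
          = real (k choose j) / real (n choose j) * w n k"
        by (simp add: w_def)
    qed
    also have "\<dots> = (\<Sum>k\<le>n. real (k choose j) / real (n choose j) * w n k)"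
      by (rule sum.mono_neutral_left) auto
    finally show ?thesis .
  qed
  have mass: "(\<Sum>k\<le>n. w n k) = \<phi> 1" for n
    using moment[of 0 n] by simp
  define C where "C = (\<Sum>j\<le>degree q. \<bar>coeff q j\<bar> * (2 * (real j)\<^sup>2)) * \<phi> 1"
  have est: "\<bar>\<phi> q\<bar> \<le> M * \<phi> 1 + C / real n" if n: "n > 2 * degree q" for n
  proof -
    have "q = (\<Sum>j\<le>degree q. smult (coeff q j) (X ^ j))"
      unfolding X_def by (subst poly_as_sum_of_monoms[of q, symmetric]) (simp add: monom_altdef)
    hence "\<phi> q = (\<Sum>j\<le>degree q. coeff q j * \<phi> (X ^ j))"
      by (metis (no_types, lifting) \<phi>_sum smult sum.cong)
    also have "\<dots> = (\<Sum>j\<le>degree q. coeff q j * (\<Sum>k\<le>n. real (k choose j) / real (n choose j) * w n k))"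
      by (rule sum.cong[OF refl]) (use n in \<open>simp add: moment[where n = n]\<close>)
    finally have 1: "\<phi> q = (\<Sum>j\<le>degree q. \<Sum>k\<le>n. coeff q j * (real (k choose j) / real (n choose j)) * w n k)"
      by (simp add: sum_distrib_left mult.assoc)
    have 2: "(\<Sum>k\<le>n. poly q (real k / real n) * w n k)
        = (\<Sum>j\<le>degree q. \<Sum>k\<le>n. coeff q j * (real k / real n) ^ j * w n k)"
      unfolding poly_altdef sum_distrib_right by (rule sum.swap)
    have "\<bar>\<phi> q - (\<Sum>k\<le>n. poly q (real k / real n) * w n k)\<bar>
       = \<bar>\<Sum>j\<le>degree q. \<Sum>k\<le>n. coeff q j *
           (real (k choose j) / real (n choose j) - (real k / real n) ^ j) * w n k\<bar>"
      unfolding 1 2 by (simp add: left_diff_distrib right_diff_distrib flip: sum_subtractf)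
    also have "\<dots> \<le> (\<Sum>j\<le>degree q. \<Sum>k\<le>n. \<bar>coeff q j *
           (real (k choose j) / real (n choose j) - (real k / real n) ^ j) * w n k\<bar>)"
      by (intro order_trans[OF sum_abs] sum_mono sum_abs)
    also have "\<dots> \<le> (\<Sum>j\<le>degree q. \<Sum>k\<le>n. \<bar>coeff q j\<bar> * (2 * (real j)\<^sup>2 / real n) * w n k)"
    proof (intro sum_mono)
      fix j k assume "j \<in> {..degree q}" "k \<in> {..n}"
      hence "\<bar>real (k choose j) / real (n choose j) - (real k / real n) ^ j\<bar> \<le> 2 * (real j)\<^sup>2 / real n"
        using n by (intro binomial_ratio_bound) auto
      thus "\<bar>coeff q j * (real (k choose j) / real (n choose j) - (real k / real n) ^ j) * w n k\<bar>
          \<le> \<bar>coeff q j\<bar> * (2 * (real j)\<^sup>2 / real n) * w n k"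
        unfolding abs_mult abs_of_nonneg[OF w_nonneg]
        by (intro mult_right_mono mult_left_mono w_nonneg abs_ge_zero)
    qed
    also have "\<dots> = (\<Sum>j\<le>degree q. \<bar>coeff q j\<bar> * (2 * (real j)\<^sup>2 / real n) * \<phi> 1)"
      by (simp only: mass sum_distrib_left[symmetric])
    also have "\<dots> = C / real n"
      by (simp add: C_def sum_distrib_right sum_divide_distrib)
    finally have 3: "\<bar>\<phi> q - (\<Sum>k\<le>n. poly q (real k / real n) * w n k)\<bar> \<le> C / real n" .
    have "\<bar>\<Sum>k\<le>n. poly q (real k / real n) * w n k\<bar> \<le> (\<Sum>k\<le>n. M * w n k)"
      using n by (intro order_trans[OF sum_abs] sum_mono)
        (auto simp: abs_mult w_nonneg divide_le_eq_1 intro!: mult_right_mono bnd)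
    also have "\<dots> = M * \<phi> 1" by (simp add: mass flip: sum_distrib_left)
    finally show ?thesis using 3 by linarith
  qed
  have "(\<lambda>n. M * \<phi> 1 + C / real n) \<longlonglongrightarrow> M * \<phi> 1 + 0"
    by (intro tendsto_intros lim_const_over_n)
  moreover have "\<forall>\<^sub>F n in sequentially. \<bar>\<phi> q\<bar> \<le> M * \<phi> 1 + C / real n"
    using eventually_gt_at_top[of "2 * degree q"] by eventually_elim (rule est)
  ultimately have "\<bar>\<phi> q\<bar> \<le> M * \<phi> 1 + 0"
    by (rule tendsto_lowerbound[OF _ _ sequentially_bot])
  thus ?thesis by simp
qed

text \<open>The following setting is applied to a self-adjoint operator on the Hilbert space and to
  averages of left and right multiplications on the space of Hilbert-Schmidt operators.\<close>

locale symmetric_operator =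
  fixes S :: "'v::real_vector set" and ip :: "'v \<Rightarrow> 'v \<Rightarrow> real" and T :: "'v \<Rightarrow> 'v" and a b :: real
  assumes S_zero: "0 \<in> S"
    and S_add: "x \<in> S \<Longrightarrow> y \<in> S \<Longrightarrow> x + y \<in> S"
    and S_scale: "x \<in> S \<Longrightarrow> c *\<^sub>R x \<in> S"
    and ip_sym: "x \<in> S \<Longrightarrow> y \<in> S \<Longrightarrow> ip x y = ip y x"
    and ip_add: "x \<in> S \<Longrightarrow> y \<in> S \<Longrightarrow> z \<in> S \<Longrightarrow> ip z (x + y) = ip z x + ip z y"
    and ip_scale: "x \<in> S \<Longrightarrow> z \<in> S \<Longrightarrow> ip z (c *\<^sub>R x) = c * ip z x"
    and ip_pos: "x \<in> S \<Longrightarrow> 0 \<le> ip x x"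
    and T_in: "x \<in> S \<Longrightarrow> T x \<in> S"
    and T_add: "x \<in> S \<Longrightarrow> y \<in> S \<Longrightarrow> T (x + y) = T x + T y"
    and T_scale: "x \<in> S \<Longrightarrow> T (c *\<^sub>R x) = c *\<^sub>R T x"
    and T_sym: "x \<in> S \<Longrightarrow> y \<in> S \<Longrightarrow> ip (T x) y = ip x (T y)"
    and T_lower: "x \<in> S \<Longrightarrow> a * ip x x \<le> ip x (T x)"
    and T_upper: "x \<in> S \<Longrightarrow> ip x (T x) \<le> b * ip x x"
    and a_less_b: "a < b"
begin

definition ev :: "real poly \<Rightarrow> 'v \<Rightarrow> 'v"
  where "ev q x = (\<Sum>k\<le>degree q. coeff q k *\<^sub>R (T ^^ k) x)"

lemma T_pow_in: "x \<in> S \<Longrightarrow> (T ^^ k) x \<in> S"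
  by (induction k) (simp_all add: T_in)

lemma S_sum: "(\<And>i. i \<in> I \<Longrightarrow> f i \<in> S) \<Longrightarrow> (\<Sum>i\<in>I. f i) \<in> S"
  by (induction I rule: infinite_finite_induct) (simp_all add: S_zero S_add)

lemma ev_in: "x \<in> S \<Longrightarrow> ev q x \<in> S"
  unfolding ev_def by (intro S_sum S_scale T_pow_in)

lemma ev_eq:
  assumes "degree q \<le> n"
  shows "ev q x = (\<Sum>k\<le>n. coeff q k *\<^sub>R (T ^^ k) x)"
  unfolding ev_def using assms
  by (intro sum.mono_neutral_left) (auto simp: coeff_eq_0)

lemma ev_zero_poly: "ev 0 x = 0" by (simp add: ev_def)

lemma ev_add: "ev (p + q) x = ev p x + ev q x"
proof -
  define n where "n = max (degree p) (degree q)"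
  have "degree (p + q) \<le> n" "degree p \<le> n" "degree q \<le> n"
    by (simp_all add: n_def degree_add_le_max)
  thus ?thesis by (simp add: ev_eq scaleR_left_distrib sum.distrib)
qed

lemma ev_smult: "ev (smult c p) x = c *\<^sub>R ev p x"
  by (subst ev_eq[of _ "degree p"]) (simp_all add: ev_def scaleR_sum_right)

lemma T_zero: "T 0 = 0"
  using T_scale[OF S_zero, of 0] by simp

lemma T_sum: "(\<And>i. i \<in> I \<Longrightarrow> f i \<in> S) \<Longrightarrow> T (\<Sum>i\<in>I. f i) = (\<Sum>i\<in>I. T (f i))"
  by (induction I rule: infinite_finite_induct) (simp_all add: T_zero T_add S_sum)

lemma T_minus: "x \<in> S \<Longrightarrow> T (- x) = - T x"
  using T_scale[of x "-1"] by simp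

lemma ev_pCons:
  assumes "x \<in> S"
  shows "ev (pCons c q) x = c *\<^sub>R x + T (ev q x)"
proof -
  have "ev (pCons c q) x = (\<Sum>k\<le>Suc (degree q). coeff (pCons c q) k *\<^sub>R (T ^^ k) x)"
    by (rule ev_eq) (simp add: degree_pCons_le)
  also have "\<dots> = c *\<^sub>R x + (\<Sum>k\<le>degree q. coeff q k *\<^sub>R T ((T ^^ k) x))"
    by (subst sum.atMost_Suc_shift) simp
  also have "(\<Sum>k\<le>degree q. coeff q k *\<^sub>R T ((T ^^ k) x)) = T (ev q x)"
    unfolding ev_def using assms
    by (subst T_sum) (auto intro!: sum.cong simp: T_scale S_scale T_pow_in)
  finally show ?thesis .
qed

lemma ev_one: "ev 1 x = x" by (simp add: ev_def)

lemma ev_mult: "x \<in> S \<Longrightarrow> ev (p * q) x = ev p (ev q x)"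
proof (induction p)
  case (pCons c p)
  thus ?case by (simp add: ev_add ev_smult ev_pCons ev_in)
qed (simp add: ev_zero_poly)

lemma ev_T: "x \<in> S \<Longrightarrow> ev q (T x) = T (ev q x)"
proof (induction q)
  case (pCons c q)
  thus ?case by (simp add: ev_pCons T_in T_add T_scale S_scale ev_in)
qed (simp add: ev_zero_poly T_zero)

lemma ip_add_left:
  assumes "x \<in> S" "y \<in> S" "z \<in> S"
  shows "ip (x + y) z = ip x z + ip y z"
  using ip_sym[OF S_add[OF assms(1,2)] assms(3)] ip_add[OF assms]
    ip_sym[OF assms(1,3)] ip_sym[OF assms(2,3)] by linarith

lemma ip_scale_left: "x \<in> S \<Longrightarrow> z \<in> S \<Longrightarrow> ip (c *\<^sub>R x) z = c * ip x z"
  using ip_sym[of "c *\<^sub>R x" z] ip_sym[of x z] by (simp add: ip_scale S_scale)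

lemma ip_zero: "x \<in> S \<Longrightarrow> ip x 0 = 0" "x \<in> S \<Longrightarrow> ip 0 x = 0"
  using ip_scale[OF S_zero, of x 0] ip_scale_left[OF S_zero, of x 0] by simp_all

lemma ev_sym: "x \<in> S \<Longrightarrow> y \<in> S \<Longrightarrow> ip (ev q x) y = ip x (ev q y)"
proof (induction q arbitrary: x y)
  case (pCons c q)
  thus ?case
    by (simp add: ev_pCons ip_add ip_add_left ip_scale ip_scale_left S_scale T_in ev_in T_sym
        flip: ev_T)
qed (simp add: ev_zero_poly ip_zero)

text \<open>Squares can be moved to the other side of the form, which leaves the exponents \<open>0\<close> and
  \<open>1\<close>; the remaining mixed case follows from
  \<open>(b - a) u v = u v u + v u v\<close> for \<open>u = T - a\<close> and \<open>v = b - T\<close>.\<close>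

lemma ev_bernstein_nonneg:
  "x \<in> S \<Longrightarrow> 0 \<le> ip x (ev ([:- a, 1:] ^ k * [:b, - 1:] ^ m) x)"
proof (induction "k + m" arbitrary: k m x rule: less_induct)
  case less
  define u v :: "real poly" where "u = [:- a, 1:]" and "v = [:b, - 1:]"
  have sandwich: "ip x (ev (r * w * r) x) = ip (ev r x) (ev w (ev r x))" for r w
    using less.prems by (simp add: mult.assoc ev_mult ev_in ev_sym)
  have u1: "ev u y = T y - a *\<^sub>R y" and v1: "ev v y = b *\<^sub>R y - T y" if "y \<in> S" for y
    using that by (simp_all add: u_def v_def ev_pCons ev_zero_poly T_zero S_zero T_minus)
  have minus: "ip y (- 1 *\<^sub>R z) = - ip y z" if "y \<in> S" "z \<in> S" for y z
    using that ip_scale[of z y "-1"] by simp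
  have pos_u: "0 \<le> ip y (ev u y)" if "y \<in> S" for y
  proof -
    have "ip y (T y + (- a) *\<^sub>R y) = ip y (T y) - a * ip y y"
      using ip_add[OF T_in[OF that] S_scale[OF that] that, of "- a"] ip_scale[OF that that, of "- a"]
      by linarith
    thus ?thesis using T_lower[OF that] by (simp add: u1 that)
  qed
  have pos_v: "0 \<le> ip y (ev v y)" if "y \<in> S" for y
    using that T_upper[OF that] ip_add[of "b *\<^sub>R y" "- 1 *\<^sub>R T y" y] minus[of y "T y"]
      S_scale[OF T_in[OF that], of "-1"]
    by (simp add: v1 T_in S_scale ip_scale)
  consider k' where "k = Suc (Suc k')" | m' where "m = Suc (Suc m')" | "k \<le> 1" "m \<le> 1"
  proof (cases "k \<le> 1 \<and> m \<le> 1")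
    case False
    hence "k = Suc (Suc (k - 2)) \<or> m = Suc (Suc (m - 2))" by auto
    thus ?thesis using that(1,2) by blast
  qed (use that(3) in blast)
  thus ?case
  proof cases
    case 1
    hence "u ^ k * v ^ m = u * (u ^ k' * v ^ m) * u" by (simp add: mult_ac)
    thus ?thesis using less.hyps[of k' m "ev u x"] 1 ev_in[OF less.prems, of u]
      unfolding u_def[symmetric] v_def[symmetric] by (simp only: sandwich)
  next
    case 2
    hence "u ^ k * v ^ m = v * (u ^ k * v ^ m') * v" by (simp add: mult_ac)
    thus ?thesis using less.hyps[of k m' "ev v x"] 2 ev_in[OF less.prems, of v]
      unfolding u_def[symmetric] v_def[symmetric] by (simp only: sandwich)
  next
    case 3
    hence "k = 0 \<or> k = 1" "m = 0 \<or> m = 1" by auto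
    moreover have "0 \<le> ip x (ev (u * v) x)"
    proof -
      have "u + v = [:b - a:]" by (simp add: u_def v_def)
      hence "smult (b - a) (u * v) = (u + v) * (u * v)" by simp
      also have "\<dots> = u * v * u + v * u * v" by (simp only: distrib_left distrib_right mult_ac)
      finally have eq: "smult (b - a) (u * v) = u * v * u + v * u * v" .
      have "(b - a) * ip x (ev (u * v) x) = ip x (ev (smult (b - a) (u * v)) x)"
        unfolding ev_smult using less.prems by (intro ip_scale[symmetric] ev_in)
      also have "\<dots> = ip x (ev (u * v * u) x) + ip x (ev (v * u * v) x)"
        unfolding eq ev_add using less.prems by (intro ip_add ev_in)
      finally have "(b - a) * ip x (ev (u * v) x) = ip x (ev (u * v * u) x) + ip x (ev (v * u * v) x)" .
      also have "\<dots> \<ge> 0" using less.prems unfolding sandwich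
        by (intro add_nonneg_nonneg pos_u pos_v ev_in)
      finally show ?thesis using a_less_b by (simp add: zero_le_mult_iff)
    qed
    ultimately have "0 \<le> ip x (ev (u ^ k * v ^ m) x)"
      using ip_pos[OF less.prems] pos_u[OF less.prems] pos_v[OF less.prems]
      by (cases "k = 0"; cases "m = 0") (simp_all add: ev_one)
    thus ?thesis by (simp only: u_def v_def)
  qed
qed

text \<open>Transported from \<open>[a, b]\<close> to the unit interval by the affine map \<open>l\<close>, this is
  \<open>bernstein_functional_bound\<close>.\<close>

lemma ev_form_bound:
  assumes x: "x \<in> S" and q: "\<And>t. a \<le> t \<Longrightarrow> t \<le> b \<Longrightarrow> \<bar>poly q t\<bar> \<le> M"
  shows "\<bar>ip x (ev q x)\<bar> \<le> M * ip x x"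
proof -
  define c where "c = b - a"
  have c: "c > 0" using a_less_b by (simp add: c_def)
  define l where "l = [:- a / c, 1 / c:]"
  define \<phi> where "\<phi> r = ip x (ev (pcompose r l) x)" for r
  have lx: "pcompose [:0, 1:] l = smult (1 / c) [:- a, 1:]"
    by (simp add: l_def pcompose_pCons)
  have lv: "pcompose [:1, -1:] l = smult (1 / c) [:b, - 1:]"
    using c by (simp add: l_def pcompose_pCons c_def field_simps)
  have "\<bar>\<phi> (pcompose q [:a, c:])\<bar> \<le> M * \<phi> 1"
  proof (rule bernstein_functional_bound)
    show "\<phi> (p + q) = \<phi> p + \<phi> q" for p q
      using x by (simp add: \<phi>_def pcompose_add ev_add ip_add ev_in)
    show "\<phi> (smult d p) = d * \<phi> p" for d p
      using x by (simp add: \<phi>_def pcompose_smult ev_smult ip_scale ev_in)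
    show "0 \<le> \<phi> ([:0, 1:] ^ k * [:1, - 1:] ^ m)" for k m
    proof -
      have scaled: "smult d u ^ k * smult d v ^ m = smult (d ^ k * d ^ m) (u ^ k * v ^ m)"
        for d and u v :: "real poly"
        by (simp add: smult_power mult.commute)
      have pow: "pcompose (p ^ n) l = pcompose p l ^ n" for p n
        by (induction n) (simp_all add: pcompose_mult pcompose_1)
      have "pcompose ([:0, 1:] ^ k * [:1, - 1:] ^ m) l
          = smult ((1 / c) ^ k * (1 / c) ^ m) ([:- a, 1:] ^ k * [:b, - 1:] ^ m)"
        unfolding pcompose_mult pow lv lx by (rule scaled)
      thus ?thesis using x c ev_bernstein_nonneg[OF x, of k m]
        by (simp add: \<phi>_def ev_smult ip_scale ev_in)
    qed
    fix t :: real assume "0 \<le> t" "t \<le> 1"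
    hence "0 \<le> c * t" "c * t \<le> c * 1" "c * 1 = b - a"
      using c by (auto simp: mult_left_le c_def)
    hence "a \<le> a + c * t" "a + c * t \<le> b" by linarith+
    thus "\<bar>poly (pcompose q [:a, c:]) t\<bar> \<le> M"
      using q[of "a + c * t"] by (simp add: poly_pcompose mult.commute)
  qed
  moreover have "pcompose (pcompose q [:a, c:]) l = q"
  proof -
    have "pcompose [:a, c:] l = [:0, 1:]" using c by (simp add: l_def pcompose_pCons)
    thus ?thesis by (simp add: pcompose_assoc[symmetric] pcompose_idR)
  qed
  ultimately show ?thesis by (simp add: \<phi>_def ev_one pcompose_1)
qed

lemma ip_Cauchy_Schwarz:
  assumes "x \<in> S" "y \<in> S"
  shows "\<bar>ip x y\<bar> \<le> sqrt (ip x x) * sqrt (ip y y)"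
proof -
  have quad: "0 \<le> ip x x + 2 * t * ip x y + t\<^sup>2 * ip y y" for t
  proof -
    have "0 \<le> ip (x + t *\<^sub>R y) (x + t *\<^sub>R y)" using assms by (intro ip_pos S_add S_scale)
    also have "\<dots> = ip x x + 2 * t * ip x y + t\<^sup>2 * ip y y"
      using assms ip_sym[of y x]
      by (simp add: ip_add ip_add_left ip_scale ip_scale_left S_add S_scale power2_eq_square algebra_simps)
    finally show ?thesis .
  qed
  have "(ip x y)\<^sup>2 \<le> ip x x * ip y y"
  proof (cases "ip y y = 0")
    case True
    have "ip x y = 0"
    proof (rule ccontr)
      assume "ip x y \<noteq> 0"
      \<comment> \<open>for this argument the quadratic takes the value \<open>- 1\<close>\<close>
      hence "2 * (- (ip x x + 1) / (2 * ip x y)) * ip x y = - (ip x x + 1)" by simp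
      thus False using quad[of "- (ip x x + 1) / (2 * ip x y)"] True by simp
    qed
    thus ?thesis by (simp add: True)
  next
    case False
    hence p: "ip y y > 0" using ip_pos[OF assms(2)] by simp
    have "0 \<le> ip x x - (ip x y)\<^sup>2 / ip y y"
      using quad[of "- ip x y / ip y y"] False by (simp add: power2_eq_square)
    thus ?thesis using p by (simp add: field_simps)
  qed
  thus ?thesis by (simp add: real_sqrt_mult[symmetric] real_le_rsqrt)
qed

text \<open>This is the form bound for \<open>q\<^sup>2\<close>.\<close>

lemma ev_norm_bound:
  assumes "x \<in> S" "\<And>t. a \<le> t \<Longrightarrow> t \<le> b \<Longrightarrow> \<bar>poly q t\<bar> \<le> M"
  shows "ip (ev q x) (ev q x) \<le> M\<^sup>2 * ip x x"
proof -
  have "ip (ev q x) (ev q x) = ip x (ev (q * q) x)"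
    using assms(1) by (simp add: ev_mult ev_sym ev_in)
  also have "\<dots> \<le> M\<^sup>2 * ip x x"
  proof (rule abs_le_D1[OF ev_form_bound[OF assms(1)]])
    fix t assume "a \<le> t" "t \<le> b"
    hence "\<bar>poly q t\<bar> * \<bar>poly q t\<bar> \<le> M * M"
      using assms(2)[of t] by (intro mult_mono) auto
    thus "\<bar>poly (q * q) t\<bar> \<le> M\<^sup>2" by (simp add: power2_eq_square abs_mult)
  qed
  finally show ?thesis .
qed

lemma ev_mixed_bound:
  assumes "x \<in> S" "y \<in> S" "\<And>t. a \<le> t \<Longrightarrow> t \<le> b \<Longrightarrow> \<bar>poly q t\<bar> \<le> M"
  shows "\<bar>ip y (ev q x)\<bar> \<le> M * sqrt (ip y y) * sqrt (ip x x)"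
proof -
  have M: "0 \<le> M" using assms(3)[of a] a_less_b by linarith
  have "\<bar>ip y (ev q x)\<bar> \<le> sqrt (ip y y) * sqrt (ip (ev q x) (ev q x))"
    using assms by (intro ip_Cauchy_Schwarz ev_in)
  also have "\<dots> \<le> sqrt (ip y y) * sqrt (M\<^sup>2 * ip x x)"
    using assms by (intro mult_left_mono real_sqrt_le_mono ev_norm_bound) (auto simp: ip_pos)
  finally show ?thesis using M by (simp add: real_sqrt_mult mult_ac)
qed

end

section \<open>Self-adjoint operators between two bounds\<close>

definition sa_between :: "real \<Rightarrow> real \<Rightarrow> 'a::complex_inner bounded_op \<Rightarrow> bool"
  where "sa_between a b A \<longleftrightarrow> is_adj A A \<and>
    (\<forall>x. a * (norm x)\<^sup>2 \<le> Re (cinner x (A \<bullet>\<^sub>o x)) \<and> Re (cinner x (A \<bullet>\<^sub>o x)) \<le> b * (norm x)\<^sup>2)"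

lemma symmetric_operator_apply:
  assumes "sa_between a b A" "a < b"
  shows "symmetric_operator UNIV (\<lambda>x y. Re (cinner x y)) (op_apply A) a b"
  using assms
  by unfold_locales
    (auto simp: sa_between_def op_apply_simps cinner_add_right cinner_scaleR_right
      is_adjD Re_cinner_self intro: Re_cinner_commute)

definition rpoly :: "real poly \<Rightarrow> 'a::complex_inner bounded_op \<Rightarrow> 'a bounded_op"
  where "rpoly q A = (\<Sum>k\<le>degree q. coeff q k *\<^sub>R A ^ k)"

lemma op_power_apply: "(A ^ k) \<bullet>\<^sub>o x = (op_apply A ^^ k) x"
  by (induction k arbitrary: x) (simp_all add: op_apply_simps)

lemma is_adj_rpoly: "is_adj A A' \<Longrightarrow> is_adj (rpoly q A) (rpoly q A')"
  unfolding rpoly_def by (intro is_adj_sum is_adj_scaleR is_adj_power)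

context
  fixes a b :: real and A :: "'a::complex_inner bounded_op"
  assumes A: "sa_between a b A" and ab: "a < b"
begin

interpretation symmetric_operator UNIV "\<lambda>x y. Re (cinner x y)" "op_apply A" a b
  by (rule symmetric_operator_apply[OF A ab])

lemma rpoly_apply: "rpoly q A \<bullet>\<^sub>o x = ev q x"
  by (simp add: rpoly_def ev_def sum_op_apply scaleR_op_apply op_power_apply)

lemma rpoly_mult_apply: "rpoly (p * q) A \<bullet>\<^sub>o x = rpoly p A \<bullet>\<^sub>o (rpoly q A \<bullet>\<^sub>o x)"
  by (simp add: rpoly_apply ev_mult)

lemma rpoly_diff_apply: "rpoly (p - q) A \<bullet>\<^sub>o x = rpoly p A \<bullet>\<^sub>o x - rpoly q A \<bullet>\<^sub>o x"
  using ev_add[of p "smult (-1) q" x] ev_smult[of "-1" q x] by (simp add: rpoly_apply)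

lemma rpoly_X_apply: "rpoly [:0, 1:] A \<bullet>\<^sub>o x = A \<bullet>\<^sub>o x"
  by (simp add: rpoly_apply ev_pCons ev_zero_poly op_apply_zero)

lemma rpoly_form_bound:
  assumes "\<And>t. a \<le> t \<Longrightarrow> t \<le> b \<Longrightarrow> \<bar>poly q t\<bar> \<le> M"
  shows "\<bar>Re (cinner x (rpoly q A \<bullet>\<^sub>o x))\<bar> \<le> M * (norm x)\<^sup>2"
  using ev_form_bound[of x q M] assms by (simp add: rpoly_apply Re_cinner_self)

lemma rpoly_norm_bound:
  assumes q: "\<And>t. a \<le> t \<Longrightarrow> t \<le> b \<Longrightarrow> \<bar>poly q t\<bar> \<le> M"
  shows "norm (rpoly q A \<bullet>\<^sub>o x) \<le> M * norm x"
proof -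
  have "0 \<le> M" using q[of a] ab by linarith
  moreover have "(norm (rpoly q A \<bullet>\<^sub>o x))\<^sup>2 \<le> (M * norm x)\<^sup>2"
    using ev_norm_bound[of x q M] q by (simp add: rpoly_apply Re_cinner_self power_mult_distrib)
  ultimately show ?thesis using power2_le_imp_le[of "norm (rpoly q A \<bullet>\<^sub>o x)" "M * norm x"] by simp
qed

text \<open>This expresses that \<open>(A - a)(b - A) \<ge> 0\<close>.\<close>

lemma sa_between_shift_square:
  "(norm (A \<bullet>\<^sub>o x - a *\<^sub>R x))\<^sup>2 \<le> (b - a) * Re (cinner x (A \<bullet>\<^sub>o x - a *\<^sub>R x))"
proof -
  define y where "y = A \<bullet>\<^sub>o x - a *\<^sub>R x"
  have 1: "ev [:- a, 1:] z = A \<bullet>\<^sub>o z - a *\<^sub>R z" for z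
    by (simp add: ev_pCons ev_zero_poly op_apply_zero)
  have 2: "ev [:b, - 1:] x = (b - a) *\<^sub>R x - y"
    using op_apply_scaleR[of A "-1" x]
    by (simp add: ev_pCons ev_zero_poly op_apply_simps y_def algebra_simps)
  have "0 \<le> Re (cinner x (ev ([:- a, 1:] * [:b, - 1:]) x))"
    using ev_bernstein_nonneg[of x 1 1] by simp
  also have "\<dots> = Re (cinner (ev [:- a, 1:] x) (ev [:b, - 1:] x))"
    by (simp only: ev_mult[OF UNIV_I] ev_sym[OF UNIV_I UNIV_I])
  also have "\<dots> = (b - a) * Re (cinner y x) - (norm y)\<^sup>2"
    by (simp add: 1 2 y_def[symmetric] cinner_diff_right cinner_scaleR_right Re_cinner_self)
  finally show ?thesis using Re_cinner_commute[of x y] by (simp add: y_def)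
qed

end


section \<open>Positive square roots\<close>

instance chilbert_space \<subseteq> banach ..

lemma bounded_op_convergent:
  fixes X :: "nat \<Rightarrow> 'a::chilbert_space bounded_op"
  assumes "Cauchy X"
  shows "convergent X"
proof -
  define Z where "Z n = blinfun_of_op (X n)" for n
  have dist: "dist (Z m) (Z n) = dist (X m) (X n)" for m n
    by (simp add: Z_def dist_norm dist_bounded_op_def norm_bounded_op.rep_eq minus_bounded_op.rep_eq)
  have "Cauchy Z" using assms by (simp add: Cauchy_def dist)
  then obtain L where L: "Z \<longlonglongrightarrow> L" using Cauchy_convergent convergent_def by blast
  have lim: "(\<lambda>n. blinfun_apply (Z n) x) \<longlonglongrightarrow> blinfun_apply L x" for x
    by (rule blinfun.tendsto[OF L tendsto_const])
  have "blinfun_apply L (c *\<^sub>C x) = c *\<^sub>C blinfun_apply L x" for c x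
  proof (rule LIMSEQ_unique[OF lim])
    have "blinfun_apply (Z n) (c *\<^sub>C x) = c *\<^sub>C blinfun_apply (Z n) x" for n
      using blinfun_of_op[of "X n"] by (simp add: Z_def)
    thus "(\<lambda>n. blinfun_apply (Z n) (c *\<^sub>C x)) \<longlonglongrightarrow> c *\<^sub>C blinfun_apply L x"
      using bounded_linear.tendsto[OF bounded_linear_scaleC lim] by simp
  qed
  hence L_op: "blinfun_of_op (Abs_bounded_op L) = L" by (intro Abs_bounded_op_inverse) simp
  have "dist (X n) (Abs_bounded_op L) = dist (Z n) L" for n
    by (simp add: Z_def dist_norm dist_bounded_op_def norm_bounded_op.rep_eq minus_bounded_op.rep_eq L_op)
  hence "X \<longlonglongrightarrow> Abs_bounded_op L"
    using L by (simp add: lim_sequentially)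
  thus ?thesis by (rule convergentI)
qed

instance bounded_op :: (chilbert_space) banach
  by standard (rule bounded_op_convergent)

text \<open>The coefficients of \<open>1 - \<surd>(1 - x)\<close>: its power series \<open>y\<close> is determined by
  \<open>2 y = x + y\<^sup>2\<close>, and this recursion also shows that the coefficients are
  non-negative with sum at most \<open>1\<close>.\<close>

fun sqrt_coeff :: "nat \<Rightarrow> real" where
  "sqrt_coeff n = (if n = 0 then 0 else if n = 1 then 1 / 2
    else (\<Sum>i\<in>{1..<n}. sqrt_coeff i * sqrt_coeff (n - i)) / 2)"

declare sqrt_coeff.simps [simp del]

lemma sqrt_coeff_0 [simp]: "sqrt_coeff 0 = 0"
  by (simp add: sqrt_coeff.simps)

lemma sqrt_coeff_nonneg: "0 \<le> sqrt_coeff n"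
proof (induction n rule: less_induct)
  case (less n)
  show ?case by (subst sqrt_coeff.simps) (auto intro!: sum_nonneg mult_nonneg_nonneg less)
qed

lemma sqrt_coeff_convolution:
  "(\<Sum>i\<le>n. sqrt_coeff i * sqrt_coeff (n - i)) = 2 * sqrt_coeff n - (if n = 1 then 1 else 0)"
proof -
  have "(\<Sum>i\<le>n. sqrt_coeff i * sqrt_coeff (n - i)) = (\<Sum>i\<in>{1..<n}. sqrt_coeff i * sqrt_coeff (n - i))"
  proof (rule sum.mono_neutral_right)
    have "i = 0 \<or> i = n" if "i \<in> {..n} - {1..<n}" for i using that by auto
    thus "\<forall>i\<in>{..n} - {1..<n}. sqrt_coeff i * sqrt_coeff (n - i) = 0" by fastforce
  qed auto
  thus ?thesis by (subst (3) sqrt_coeff.simps) auto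
qed

lemma sqrt_coeff_sum_le: "(\<Sum>k\<le>n. sqrt_coeff k) \<le> 1"
proof (induction n)
  case (Suc n)
  let ?c = sqrt_coeff
  have "2 * (\<Sum>k\<le>Suc n. ?c k) = (\<Sum>k\<le>Suc n. (\<Sum>i\<le>k. ?c i * ?c (k - i)) + (if k = 1 then 1 else 0))"
    unfolding sum_distrib_left by (rule sum.cong) (simp_all add: sqrt_coeff_convolution)
  also have "\<dots> = (\<Sum>k\<le>Suc n. \<Sum>i\<le>k. ?c i * ?c (k - i)) + 1"
    by (simp add: sum.distrib del: sum.atMost_Suc)
  also have "(\<Sum>k\<le>Suc n. \<Sum>i\<le>k. ?c i * ?c (k - i)) = (\<Sum>(i, j)\<in>{(i, j). i + j \<le> Suc n}. ?c i * ?c j)"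
    by (rule sum.triangle_reindex_eq[symmetric])
  also have "\<dots> = (\<Sum>(i, j)\<in>{(i, j). i + j \<le> Suc n \<and> i \<le> n \<and> j \<le> n}. ?c i * ?c j)"
  proof (rule sum.mono_neutral_right)
    show "finite {(i, j). i + j \<le> Suc n}"
      by (rule finite_subset[of _ "{..Suc n} \<times> {..Suc n}"]) auto
    have "i = 0 \<or> j = 0" if "i + j \<le> Suc n" "\<not> (i \<le> n \<and> j \<le> n)" for i j
      using that by linarith
    thus "\<forall>ij\<in>{(i, j). i + j \<le> Suc n} - {(i, j). i + j \<le> Suc n \<and> i \<le> n \<and> j \<le> n}.
        (case ij of (i, j) \<Rightarrow> ?c i * ?c j) = 0" by fastforce
  qed auto
  also have "\<dots> \<le> (\<Sum>(i, j)\<in>{..n} \<times> {..n}. ?c i * ?c j)"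
    by (rule sum_mono2) (auto simp: sqrt_coeff_nonneg)
  also have "\<dots> = (\<Sum>k\<le>n. ?c k) * (\<Sum>k\<le>n. ?c k)"
    by (simp add: sum_product sum.cartesian_product)
  also have "\<dots> \<le> 1 * 1"
    using Suc by (intro mult_mono sum_nonneg) (auto simp: sqrt_coeff_nonneg)
  finally show ?case by simp
qed simp

lemma sqrt_coeff_summable: "summable sqrt_coeff"
  and sqrt_coeff_suminf_le: "suminf sqrt_coeff \<le> 1"
proof -
  have le: "(\<Sum>k<n. sqrt_coeff k) \<le> 1" for n
    by (rule order_trans[OF sum_mono2 sqrt_coeff_sum_le[of n]]) (auto simp: sqrt_coeff_nonneg)
  show s: "summable sqrt_coeff" by (rule summableI_nonneg_bounded[OF sqrt_coeff_nonneg le])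
  show "suminf sqrt_coeff \<le> 1" by (rule suminf_le_const[OF s le])
qed

definition op_ge0 :: "'a::complex_inner bounded_op \<Rightarrow> bool"
  where "op_ge0 A \<longleftrightarrow> is_adj A A \<and> (\<forall>x. 0 \<le> Re (cinner x (A \<bullet>\<^sub>o x)))"

lemma is_adj_real: "is_adj A A \<Longrightarrow> cinner x (A \<bullet>\<^sub>o x) = complex_of_real (Re (cinner x (A \<bullet>\<^sub>o x)))"
  by (rule complex_eqI) (simp, metis Reals_cnj_iff cinner_commute complex_is_Real_iff is_adjD Im_complex_of_real)

text \<open>Over the complex numbers a form with real values is Hermitian, by polarization.\<close>

lemma positive_op_iff: "positive_op A \<longleftrightarrow> op_ge0 A"
proof
  assume "op_ge0 A"
  thus "positive_op A"
    unfolding positive_op_def op_ge0_def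
    by (metis is_adj_real nonneg_Reals_of_real_iff)
next
  assume pos: "positive_op A"
  define D where "D x y = cinner (A \<bullet>\<^sub>o x) y - cinner x (A \<bullet>\<^sub>o y)" for x y
  have D0: "D x x = 0" for x
  proof -
    have "cinner x (A \<bullet>\<^sub>o x) \<in> \<real>"
      using pos nonneg_Reals_subset_Reals by (metis positive_op_def subsetD)
    hence "cnj (cinner x (A \<bullet>\<^sub>o x)) = cinner x (A \<bullet>\<^sub>o x)" by (simp add: Reals_cnj_iff)
    moreover have "cinner (A \<bullet>\<^sub>o x) x = cnj (cinner x (A \<bullet>\<^sub>o x))" by (rule cinner_commute)
    ultimately show ?thesis by (simp add: D_def)
  qed
  have D_add: "D (x + y) (x + y) = D x x + D x y + D y x + D y y" for x y
    by (simp add: D_def op_apply_simps cinner_add_left cinner_add_right)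
  have D_i: "D x (\<i> *\<^sub>C y) = \<i> * D x y" "D (\<i> *\<^sub>C y) x = - (\<i> * D y x)" for x y
    by (simp_all add: D_def op_apply_simps cinner_scaleC_left cinner_scaleC_right algebra_simps)
  have "D x y = 0" for x y
  proof -
    have "D x y + D y x = 0" using D_add[of x y] by (simp add: D0)
    moreover have "\<i> * (D x y - D y x) = 0"
      using D_add[of x "\<i> *\<^sub>C y"] by (simp add: D0 D_i algebra_simps)
    ultimately show ?thesis by (simp add: add_eq_0_iff)
  qed
  hence "is_adj A A" by (simp add: is_adj_def D_def)
  moreover have "0 \<le> Re (cinner x (A \<bullet>\<^sub>o x))" for x
    using pos by (auto simp: positive_op_def complex_nonneg_Reals_iff)
  ultimately show "op_ge0 A" by (simp add: op_ge0_def)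
qed

lemma op_ge0_between: "op_ge0 A \<Longrightarrow> sa_between 0 (norm A + 1) A"
proof -
  assume A: "op_ge0 A"
  have "Re (cinner x (A \<bullet>\<^sub>o x)) \<le> (norm A + 1) * (norm x)\<^sup>2" for x
  proof -
    have "Re (cinner x (A \<bullet>\<^sub>o x)) \<le> norm x * (norm A * norm x)"
      by (rule order_trans[OF abs_le_D1[OF Re_cinner_le]]) (simp add: mult_left_mono norm_op_apply)
    also have "\<dots> \<le> (norm A + 1) * (norm x)\<^sup>2"
      by (simp add: power2_eq_square distrib_right)
    finally show ?thesis .
  qed
  thus ?thesis using A by (simp add: sa_between_def op_ge0_def)
qed

lemma op_ge0_form_zero:
  assumes "op_ge0 A" "Re (cinner x (A \<bullet>\<^sub>o x)) = 0"
  shows "A \<bullet>\<^sub>o x = 0"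
  using sa_between_shift_square[OF op_ge0_between[OF assms(1)], of x] assms(2)
  by (simp add: add_nonneg_pos)

lemma op_power_le:
  fixes X :: "'a::complex_inner bounded_op"
  assumes "\<And>x. norm (X \<bullet>\<^sub>o x) \<le> norm x"
  shows "norm (X ^ k) \<le> 1"
proof (rule norm_op_bound)
  show "norm ((X ^ k) \<bullet>\<^sub>o x) \<le> 1 * norm x" for x
    by (induction k arbitrary: x) (auto simp: op_apply_simps intro: order_trans[OF assms])
qed simp

text \<open>The root is \<open>1 - \<Sum>\<^sub>k c\<^sub>k (1 - A)\<^sup>k\<close>. As a norm limit of polynomials in \<open>A\<close> it commutes with
  everything that commutes with \<open>A\<close>, which is the key to the uniqueness of positive roots.\<close>

lemma sqrt_exists_contraction:
  fixes A :: "'a::chilbert_space bounded_op"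
  assumes A: "is_adj A A" and X: "\<And>x. norm ((1 - A) \<bullet>\<^sub>o x) \<le> norm x"
  obtains P where "op_ge0 P" "P * P = A" "\<And>B. B * A = A * B \<Longrightarrow> B * P = P * B"
proof -
  define X where "X = 1 - A"
  have X_adj: "is_adj X X" using A is_adj_diff[OF is_adj_one] by (simp add: X_def)
  have X_pow: "norm (X ^ k) \<le> 1" for k using X by (intro op_power_le) (simp add: X_def)
  define f where "f k = sqrt_coeff k *\<^sub>R X ^ k" for k
  have f_norm: "norm (f k) \<le> sqrt_coeff k" for k
    using mult_left_mono[OF X_pow[of k] sqrt_coeff_nonneg[of k]]
    by (simp add: f_def abs_of_nonneg sqrt_coeff_nonneg)
  have f_abs: "summable (\<lambda>k. norm (f k))"
    by (rule summable_comparison_test'[OF sqrt_coeff_summable, of 0]) (simp add: f_norm)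
  have f_sum: "summable f" by (rule summable_norm_cancel[OF f_abs])
  define Y where "Y = suminf f"
  have f_sums: "f sums Y" using f_sum by (simp add: Y_def summable_sums)
  have "(\<lambda>k. \<Sum>i\<le>k. f i * f (k - i)) sums (Y * Y)"
    unfolding Y_def by (rule Cauchy_product_sums[OF f_abs f_abs])
  moreover have "(\<Sum>i\<le>k. f i * f (k - i)) = 2 *\<^sub>R f k - (if k = 1 then X else 0)" for k
  proof -
    have "(\<Sum>i\<le>k. f i * f (k - i)) = (\<Sum>i\<le>k. (sqrt_coeff i * sqrt_coeff (k - i)) *\<^sub>R X ^ k)"
      by (rule sum.cong) (simp_all add: f_def flip: power_add)
    also have "\<dots> = (2 * sqrt_coeff k - (if k = 1 then 1 else 0)) *\<^sub>R X ^ k"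
      by (simp add: sqrt_coeff_convolution flip: scaleR_sum_left)
    finally show ?thesis by (simp add: f_def scaleR_diff_left)
  qed
  moreover have "(\<lambda>k. 2 *\<^sub>R f k - (if k = 1 then X else 0)) sums (2 *\<^sub>R Y - X)"
    using sums_diff[OF bounded_linear.sums[OF bounded_linear_scaleR_right f_sums] sums_single[of 1 "\<lambda>_. X"]]
    by simp
  ultimately have YY: "Y * Y = 2 *\<^sub>R Y - X" by (simp add: sums_unique2)
  define P where "P = 1 - Y"
  have "P * P = 1 - 2 *\<^sub>R Y + Y * Y"
    by (simp add: P_def algebra_simps scaleR_2)
  hence PP: "P * P = A" by (simp add: YY X_def)
  have Y_form: "(\<lambda>k. cinner x (f k \<bullet>\<^sub>o y)) sums cinner x (Y \<bullet>\<^sub>o y)" for x y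
  proof -
    have "bounded_linear (\<lambda>B :: 'a bounded_op. B \<bullet>\<^sub>o y)"
      by (rule bounded_linear_intro[where K = "norm y"])
        (simp_all add: op_apply_simps norm_op_apply)
    from bounded_linear.sums[OF bounded_linear_cinner bounded_linear.sums[OF this f_sums]]
    show ?thesis .
  qed
  have "is_adj Y Y"
    unfolding is_adj_def
  proof (intro allI)
    fix x y
    have "cinner y (f k \<bullet>\<^sub>o x) = cnj (cinner x (f k \<bullet>\<^sub>o y))" for k
      using is_adjD[OF is_adj_scaleR[OF is_adj_power[OF X_adj]], of "sqrt_coeff k" k y x] cinner_commute
      unfolding f_def by metis
    hence "(\<lambda>k. cnj (cinner x (f k \<bullet>\<^sub>o y))) sums cinner y (Y \<bullet>\<^sub>o x)"
      using Y_form[of y x] by simp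
    hence "cinner y (Y \<bullet>\<^sub>o x) = cnj (cinner x (Y \<bullet>\<^sub>o y))"
      using Y_form[of x y] sums_unique2 sums_cnj by blast
    thus "cinner (Y \<bullet>\<^sub>o x) y = cinner x (Y \<bullet>\<^sub>o y)"
      by (metis cinner_commute complex_cnj_cnj)
  qed
  hence P_adj: "is_adj P P" unfolding P_def by (intro is_adj_diff is_adj_one)
  have "norm Y \<le> 1"
  proof -
    have "norm Y \<le> (\<Sum>k. norm (f k))" unfolding Y_def by (rule summable_norm[OF f_abs])
    also have "\<dots> \<le> suminf sqrt_coeff" by (rule suminf_le[OF f_norm f_abs sqrt_coeff_summable])
    finally show ?thesis using sqrt_coeff_suminf_le by simp
  qed
  have "0 \<le> Re (cinner x (P \<bullet>\<^sub>o x))" for x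
  proof -
    have "Re (cinner x (Y \<bullet>\<^sub>o x)) \<le> norm x * norm (Y \<bullet>\<^sub>o x)" by (rule abs_le_D1[OF Re_cinner_le])
    also have "\<dots> \<le> norm x * (1 * norm x)"
      by (intro mult_left_mono order_trans[OF norm_op_apply] mult_right_mono \<open>norm Y \<le> 1\<close>) auto
    finally show ?thesis
      by (simp add: P_def op_apply_simps cinner_diff_right Re_cinner_self power2_eq_square)
  qed
  hence P_pos: "op_ge0 P" using P_adj by (simp add: op_ge0_def)
  have "B * P = P * B" if "B * A = A * B" for B
  proof -
    have BX: "B * X = X * B" using that by (simp add: X_def algebra_simps)
    have "B * X ^ k = X ^ k * B" for k
    proof (induction k)
      case (Suc k)
      have "B * X ^ Suc k = X * (B * X ^ k)" by (simp add: BX flip: mult.assoc)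
      thus ?case by (simp add: Suc mult.assoc)
    qed simp
    hence "B * f k = f k * B" for k by (simp add: f_def)
    hence "B * Y = Y * B"
      using bounded_linear.sums[OF bounded_linear_mult_right f_sums, of B]
        bounded_linear.sums[OF bounded_linear_mult_left f_sums, of B] by (simp add: sums_unique2)
    thus ?thesis by (simp add: P_def algebra_simps)
  qed
  with P_pos PP show thesis using that by blast
qed

text \<open>If \<open>R\<close> is another positive root of \<open>P\<^sup>2\<close>, it commutes with \<open>P\<close>, and \<open>(R + P)(R - P) = 0\<close>.
  For \<open>y = (R - P)x\<close> the non-negative numbers \<open>\<langle>y, Ry\<rangle>\<close> and \<open>\<langle>y, Py\<rangle>\<close> then add up to \<open>0\<close>, so that
  \<open>Ry = Py = 0\<close> and \<open>\<parallel>y\<parallel>\<^sup>2 = \<langle>x, (R - P)y\<rangle> = 0\<close>.\<close>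

lemma abs_op_exists:
  fixes A :: "'a::chilbert_space bounded_op"
  assumes A: "is_adj A A'"
  shows "op_ge0 (abs_op A)" and "abs_op A * abs_op A = A' * A"
proof -
  \<comment> \<open>dividing by \<open>c\<close> makes \<open>1 - B\<close> a contraction; the summand \<open>1\<close> covers \<open>A = 0\<close>\<close>
  define c where "c = (norm A + 1)\<^sup>2"
  have "norm A + 1 > 0" using norm_ge_zero[of A] by linarith
  hence c: "c > 0" by (simp add: c_def)
  define B where "B = (1 / c) *\<^sub>R (A' * A)"
  have B_adj: "is_adj B B"
    unfolding B_def by (intro is_adj_scaleR is_adj_mult A is_adj_sym[OF A])
  have contr: "norm ((1 - B) \<bullet>\<^sub>o x) \<le> norm x" for x
  proof -
    have "norm (A' \<bullet>\<^sub>o y) \<le> (norm A + 1) * norm y" for y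
    proof (rule norm_adj_apply_le[OF A])
      show "norm (A \<bullet>\<^sub>o x) \<le> (norm A + 1) * norm x" for x
        using norm_op_apply[of A x] by (simp add: distrib_right add_increasing2)
    qed simp
    hence "(norm (A' \<bullet>\<^sub>o (A \<bullet>\<^sub>o x)))\<^sup>2 \<le> c * (norm (A \<bullet>\<^sub>o x))\<^sup>2"
      unfolding c_def power_mult_distrib[symmetric] by (intro power_mono) auto
    hence "(norm (A' \<bullet>\<^sub>o (A \<bullet>\<^sub>o x)))\<^sup>2 / c\<^sup>2 \<le> c * (norm (A \<bullet>\<^sub>o x))\<^sup>2 / c\<^sup>2"
      by (rule divide_right_mono) simp
    hence 1: "(norm (B \<bullet>\<^sub>o x))\<^sup>2 \<le> (norm (A \<bullet>\<^sub>o x))\<^sup>2 / c"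
      using c by (simp add: B_def op_apply_simps power_divide power2_eq_square)
    have "cinner x (B \<bullet>\<^sub>o x) = (1 / c) * (norm (A \<bullet>\<^sub>o x))\<^sup>2"
      by (simp add: B_def op_apply_simps cinner_scaleR_right is_adjD[OF is_adj_sym[OF A], symmetric]
          cinner_self)
    hence 2: "Re (cinner x (B \<bullet>\<^sub>o x)) = (norm (A \<bullet>\<^sub>o x))\<^sup>2 / c"
      by (simp add: of_real_divide[symmetric] of_real_power[symmetric] del: of_real_divide of_real_power)
    have "0 \<le> (norm (A \<bullet>\<^sub>o x))\<^sup>2 / c" using c by simp
    hence "(norm (x - B \<bullet>\<^sub>o x))\<^sup>2 \<le> (norm x)\<^sup>2"
      unfolding norm_diff_square 2 using 1 by linarith
    hence "norm (x - B \<bullet>\<^sub>o x) \<le> norm x" by (rule power2_le_imp_le) simp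
    thus ?thesis by (simp add: op_apply_simps)
  qed
  obtain Q where Q: "op_ge0 Q" "Q * Q = B" "\<And>C. C * B = B * C \<Longrightarrow> C * Q = Q * C"
    using sqrt_exists_contraction[OF B_adj contr] by metis
  define P where "P = sqrt c *\<^sub>R Q"
  have P_pos: "op_ge0 P" using Q(1) c
    by (auto simp: P_def op_ge0_def is_adj_scaleR op_apply_simps cinner_scaleR_right)
  have PP: "P * P = A' * A" using c by (simp add: P_def Q(2)) (simp add: B_def)
  have comm: "C * P = P * C" if "C * (A' * A) = A' * A * C" for C
    using Q(3)[of C] that by (simp add: P_def B_def)
  have adj: "adj A = A'" by (rule adj_eq[OF A])
  have "abs_op A = P"
    unfolding abs_op_def
  proof (rule the_equality)
    show "positive_op P \<and> P * P = adj A * A" by (simp add: positive_op_iff P_pos PP adj)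
    fix R assume "positive_op R \<and> R * R = adj A * A"
    hence R: "op_ge0 R" "R * R = A' * A" by (simp_all add: positive_op_iff adj)
    have "R * (A' * A) = A' * A * R" by (simp flip: R(2) add: mult.assoc)
    hence RP: "R * P = P * R" by (rule comm)
    have R_adj: "is_adj R R" and P_adj: "is_adj P P" using R P_pos by (auto simp: op_ge0_def)
    have D_adj: "is_adj (R - P) (R - P)" by (rule is_adj_diff[OF R_adj P_adj])
    show "R = P"
    proof (rule bounded_op_eqI)
      fix x
      define y where "y = (R - P) \<bullet>\<^sub>o x"
      have "(R + P) * (R - P) = 0"
        using RP R(2) PP by (simp add: algebra_simps)
      hence "R \<bullet>\<^sub>o y + P \<bullet>\<^sub>o y = 0"
        by (metis plus_op_apply times_op_apply y_def zero_op_apply)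
      hence "Re (cinner y (R \<bullet>\<^sub>o y)) + Re (cinner y (P \<bullet>\<^sub>o y)) = 0"
        by (metis cinner_add_right cinner_zero(2) plus_complex.sel(1) zero_complex.sel(1))
      moreover have "0 \<le> Re (cinner y (R \<bullet>\<^sub>o y))" "0 \<le> Re (cinner y (P \<bullet>\<^sub>o y))"
        using R(1) P_pos by (auto simp: op_ge0_def)
      ultimately have "R \<bullet>\<^sub>o y = 0" "P \<bullet>\<^sub>o y = 0"
        by (auto intro!: op_ge0_form_zero R(1) P_pos)
      hence "cinner x ((R - P) \<bullet>\<^sub>o y) = 0" by (simp add: minus_op_apply)
      hence "cinner y y = 0" by (simp add: y_def is_adjD[OF D_adj])
      thus "R \<bullet>\<^sub>o x = P \<bullet>\<^sub>o x" by (simp add: cinner_self y_def minus_op_apply)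
    qed
  qed
  thus "op_ge0 (abs_op A)" "abs_op A * abs_op A = A' * A" using P_pos PP by simp_all
qed


section \<open>Trace class operators\<close>

text \<open>The contraction \<open>U = A \<kappa>(\<bar>A\<bar>)\<close> replaces the partial isometry of the polar decomposition:
  for \<open>t \<kappa>(t) = 1 - (1 - t/c)\<^sup>n\<close> the operator \<open>U\<^sup>*A = \<kappa>(\<bar>A\<bar>)\<bar>A\<bar>\<^sup>2\<close> differs
  from \<open>\<bar>A\<bar>\<close> by at most \<open>c/n\<close>.\<close>

lemma polar_approximation:
  fixes A :: "'a::chilbert_space bounded_op"
  assumes A: "is_adj A A'" and n: "n > 0"
  obtains U U' where "is_adj U U'" "\<And>x. norm (U \<bullet>\<^sub>o x) \<le> norm x"
    "\<And>x. Re (cinner x (abs_op A \<bullet>\<^sub>o x))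
      \<le> Re (cinner (U \<bullet>\<^sub>o x) (A \<bullet>\<^sub>o x)) + (norm (abs_op A) + 1) / real n * (norm x)\<^sup>2"
proof -
  define P where "P = abs_op A"
  define c where "c = norm P + 1"
  have c: "c > 0" using norm_ge_zero[of P] unfolding c_def by linarith
  have P_pos: "op_ge0 P" and PP: "P * P = A' * A"
    using abs_op_exists[OF A] by (simp_all add: P_def)
  have P: "sa_between 0 c P" using op_ge0_between[OF P_pos] by (simp add: c_def)
  have P_adj: "is_adj P P" using P_pos by (simp add: op_ge0_def)
  define \<kappa> where "\<kappa> = smult (1 / c) (\<Sum>k<n. [:1, - 1 / c:] ^ k)"
  have \<kappa>: "t * poly \<kappa> t = 1 - (1 - t / c) ^ n" for t
    using one_diff_power_eq[of "1 - t / c" n] c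
    by (simp add: \<kappa>_def poly_sum poly_power field_simps)
  have decay: "t * (1 - t / c) ^ n \<le> c / n" "0 \<le> t * (1 - t / c) ^ n" "(1 - t / c) ^ n \<le> 1"
    "0 \<le> (1 - t / c) ^ n" if t: "0 \<le> t" "t \<le> c" for t
  proof -
    define s where "s = 1 - t / c"
    have s: "0 \<le> s" "s \<le> 1" using t c by (auto simp: s_def field_simps)
    show "(1 - t / c) ^ n \<le> 1" "0 \<le> (1 - t / c) ^ n" "0 \<le> t * (1 - t / c) ^ n"
      using s t unfolding s_def[symmetric] by (auto intro: power_le_one)
    have "(\<Sum>k<n. s ^ n) \<le> (\<Sum>k<n. s ^ k)"
      using s by (intro sum_mono power_decreasing) auto
    hence "real n * s ^ n \<le> (\<Sum>k<n. s ^ k)" by simp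
    hence "(1 - s) * (real n * s ^ n) \<le> (1 - s) * (\<Sum>k<n. s ^ k)"
      using s by (intro mult_left_mono) auto
    also have "\<dots> = 1 - s ^ n" by (rule one_diff_power_eq[symmetric])
    also have "\<dots> \<le> 1" using s by simp
    finally have "t / c * (real n * s ^ n) \<le> 1" by (simp add: s_def)
    thus "t * (1 - t / c) ^ n \<le> c / n"
      using c n by (simp add: field_simps s_def[symmetric])
  qed
  define K where "K = rpoly \<kappa> P"
  have K_adj: "is_adj K K" unfolding K_def by (rule is_adj_rpoly[OF P_adj])
  have PK: "P \<bullet>\<^sub>o (K \<bullet>\<^sub>o x) = rpoly ([:0, 1:] * \<kappa>) P \<bullet>\<^sub>o x" for x
    unfolding K_def rpoly_mult_apply[OF P c] rpoly_X_apply[OF P c] ..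
  have AA: "cinner (A \<bullet>\<^sub>o x) (A \<bullet>\<^sub>o y) = cinner (P \<bullet>\<^sub>o x) (P \<bullet>\<^sub>o y)" for x y
    by (metis A P_adj PP is_adjD is_adj_sym times_op_apply)
  show thesis
  proof (rule that)
    show "is_adj (A * K) (K * A')" by (rule is_adj_mult[OF A K_adj])
    fix x
    have "(norm ((A * K) \<bullet>\<^sub>o x))\<^sup>2 = (norm (P \<bullet>\<^sub>o (K \<bullet>\<^sub>o x)))\<^sup>2"
      unfolding Re_cinner_self[symmetric] times_op_apply AA ..
    moreover have "norm (P \<bullet>\<^sub>o (K \<bullet>\<^sub>o x)) \<le> 1 * norm x"
      unfolding PK
    proof (rule rpoly_norm_bound[OF P c])
      fix t assume "0 \<le> t" "t \<le> c"
      from decay[OF this] show "\<bar>poly ([:0, 1:] * \<kappa>) t\<bar> \<le> 1" by (simp add: \<kappa>)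
    qed
    ultimately show "norm ((A * K) \<bullet>\<^sub>o x) \<le> norm x"
      by (simp add: power2_eq_iff_nonneg)
    define q where "q = [:0, 1:] - [:0, 1:] * \<kappa> * [:0, 1:]"
    have "\<bar>Re (cinner x (rpoly q P \<bullet>\<^sub>o x))\<bar> \<le> c / real n * (norm x)\<^sup>2"
    proof (rule rpoly_form_bound[OF P c])
      fix t assume t: "0 \<le> t" "t \<le> c"
      have "poly q t = t - t * (t * poly \<kappa> t)" by (simp add: q_def right_diff_distrib)
      also have "\<dots> = t * (1 - t / c) ^ n" unfolding \<kappa> by (simp add: algebra_simps)
      finally show "\<bar>poly q t\<bar> \<le> c / real n" using decay[OF t] by simp
    qed
    moreover have "Re (cinner x (rpoly q P \<bullet>\<^sub>o x))
        = Re (cinner x (P \<bullet>\<^sub>o x)) - Re (cinner ((A * K) \<bullet>\<^sub>o x) (A \<bullet>\<^sub>o x))"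
    proof -
      have "cinner x (P \<bullet>\<^sub>o K \<bullet>\<^sub>o P \<bullet>\<^sub>o x) = cinner (P \<bullet>\<^sub>o x) (K \<bullet>\<^sub>o P \<bullet>\<^sub>o x)"
        by (rule is_adjD[OF P_adj, symmetric])
      also have "\<dots> = cinner (K \<bullet>\<^sub>o P \<bullet>\<^sub>o x) (P \<bullet>\<^sub>o x)"
        by (rule is_adjD[OF K_adj, symmetric])
      also have "\<dots> = cinner ((A * K) \<bullet>\<^sub>o x) (A \<bullet>\<^sub>o x)"
      proof -
        have "K \<bullet>\<^sub>o P \<bullet>\<^sub>o x = P \<bullet>\<^sub>o K \<bullet>\<^sub>o x"
          unfolding PK unfolding K_def
          by (metis rpoly_mult_apply[OF P c] rpoly_X_apply[OF P c] mult.commute)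
        thus ?thesis by (simp add: AA times_op_apply)
      qed
      finally have "cinner x (P \<bullet>\<^sub>o K \<bullet>\<^sub>o P \<bullet>\<^sub>o x) = cinner ((A * K) \<bullet>\<^sub>o x) (A \<bullet>\<^sub>o x)" .
      moreover have "rpoly q P \<bullet>\<^sub>o x = P \<bullet>\<^sub>o x - P \<bullet>\<^sub>o K \<bullet>\<^sub>o P \<bullet>\<^sub>o x"
        unfolding q_def rpoly_diff_apply[OF P c] rpoly_mult_apply[OF P c, of "_ * _"]
          rpoly_X_apply[OF P c] PK ..
      ultimately show ?thesis by (simp add: cinner_diff_right)
    qed
    ultimately show "Re (cinner x (abs_op A \<bullet>\<^sub>o x))
        \<le> Re (cinner ((A * K) \<bullet>\<^sub>o x) (A \<bullet>\<^sub>o x)) + (norm (abs_op A) + 1) / real n * (norm x)\<^sup>2"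
      by (simp add: P_def c_def)
  qed
qed

text \<open>The partial sums of \<open>\<Sum>\<^sub>e \<langle>e, \<bar>A\<bar>e\<rangle>\<close> are bounded up to \<open>O(1/n)\<close> by the pairing of \<open>A\<close> with the
  contraction from \<open>polar_approximation\<close>.\<close>

lemma (in onb) TC_trace_class:
  assumes "A \<in> TC"
  shows "trace_class A"
proof -
  obtain A' where A': "is_adj A A'" using assms by (rule TC_adjE)
  define P where "P = abs_op A"
  have P: "op_ge0 P" using abs_op_exists[OF A'] by (simp add: P_def)
  obtain C where C: "\<And>U U' F. is_adj U U' \<Longrightarrow> (\<forall>x. norm (U \<bullet>\<^sub>o x) \<le> norm x) \<Longrightarrow> finite F \<Longrightarrow> F \<subseteq> E \<Longrightarrow>
      (\<Sum>e\<in>F. Re (cinner (U \<bullet>\<^sub>o e) (A \<bullet>\<^sub>o e))) \<le> C"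
    using TC_contraction_bound[OF assms] by metis
  have bound: "(\<Sum>e\<in>F. Re (cinner e (P \<bullet>\<^sub>o e))) \<le> C" if F: "finite F" "F \<subseteq> E" for F
  proof -
    define D where "D = (norm P + 1) * real (card F)"
    have "(\<Sum>e\<in>F. Re (cinner e (P \<bullet>\<^sub>o e))) \<le> C + D / real n" if "n > 0" for n
    proof -
      obtain U U' where U: "is_adj U U'" "\<And>x. norm (U \<bullet>\<^sub>o x) \<le> norm x"
        "\<And>x. Re (cinner x (P \<bullet>\<^sub>o x))
          \<le> Re (cinner (U \<bullet>\<^sub>o x) (A \<bullet>\<^sub>o x)) + (norm P + 1) / real n * (norm x)\<^sup>2"
        using polar_approximation[OF A' \<open>n > 0\<close>] unfolding P_def by metis
      have "(\<Sum>e\<in>F. Re (cinner e (P \<bullet>\<^sub>o e)))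
          \<le> (\<Sum>e\<in>F. Re (cinner (U \<bullet>\<^sub>o e) (A \<bullet>\<^sub>o e)) + (norm P + 1) / real n)"
        using U(3) F onb_norm by (intro sum_mono) (metis mult.right_neutral one_power2 subsetD)
      also have "\<dots> = (\<Sum>e\<in>F. Re (cinner (U \<bullet>\<^sub>o e) (A \<bullet>\<^sub>o e))) + D / real n"
        by (simp add: sum.distrib D_def mult.commute)
      also have "\<dots> \<le> C + D / real n" using C[OF U(1) _ F] U(2) by simp
      finally show ?thesis .
    qed
    hence "\<forall>\<^sub>F n in sequentially. (\<Sum>e\<in>F. Re (cinner e (P \<bullet>\<^sub>o e))) \<le> C + D / real n"
      by (rule eventually_mono[OF eventually_gt_at_top[of 0]])
    moreover have "(\<lambda>n. C + D / real n) \<longlonglongrightarrow> C + 0"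
      by (intro tendsto_intros lim_const_over_n)
    ultimately have "(\<Sum>e\<in>F. Re (cinner e (P \<bullet>\<^sub>o e))) \<le> C + 0"
      by (intro tendsto_lowerbound[OF _ _ sequentially_bot])
    thus ?thesis by simp
  qed
  have "(\<lambda>e. Re (cinner e (P \<bullet>\<^sub>o e))) summable_on E"
  proof (rule nonneg_bdd_above_summable_on)
    show "0 \<le> Re (cinner e (P \<bullet>\<^sub>o e))" for e using P by (simp add: op_ge0_def)
    show "bdd_above (sum (\<lambda>e. Re (cinner e (P \<bullet>\<^sub>o e))) ` {F. F \<subseteq> E \<and> finite F})"
      by (rule bdd_aboveI2[where M = C]) (use bound in auto)
  qed
  hence "(\<lambda>e. complex_of_real (Re (cinner e (P \<bullet>\<^sub>o e)))) summable_on E"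
    by (rule summable_on_of_real)
  hence "(\<lambda>e. cinner e (P \<bullet>\<^sub>o e)) summable_on E"
    using P is_adj_real by (metis (no_types, lifting) op_ge0_def summable_on_cong)
  thus ?thesis using onb by (auto simp: trace_class_def P_def)
qed

section \<open>Lipschitz bounds in the Hilbert-Schmidt norm\<close>

lemma op_power_diff:
  fixes A B :: "'a::complex_inner bounded_op"
  shows "B ^ k - A ^ k = (\<Sum>j<k. B ^ (k - j - 1) * (B - A) * A ^ j)"
proof (induction k)
  case (Suc k)
  have "B ^ Suc k - A ^ Suc k = B * (B ^ k - A ^ k) + (B - A) * A ^ k"
    by (simp add: algebra_simps)
  also have "B * (B ^ k - A ^ k) = (\<Sum>j<k. B ^ (Suc k - j - 1) * (B - A) * A ^ j)"
    unfolding Suc sum_distrib_left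
  proof (rule sum.cong[OF refl])
    fix j assume "j \<in> {..<k}"
    hence "Suc k - j - 1 = Suc (k - j - 1)" by simp
    thus "B * (B ^ (k - j - 1) * (B - A) * A ^ j) = B ^ (Suc k - j - 1) * (B - A) * A ^ j"
      by (simp only: power_Suc mult.assoc)
  qed
  finally show ?case by simp
qed simp

lemma sa_between_adj: "sa_between a b A \<Longrightarrow> is_adj A A"
  by (simp add: sa_between_def)

lemma sa_between_segment:
  assumes A: "sa_between a b A" and B: "sa_between a b B" and s: "0 \<le> s" "s \<le> 1"
  shows "sa_between a b (A + s *\<^sub>R (B - A))"
proof -
  have form: "Re (cinner x ((A + s *\<^sub>R (B - A)) \<bullet>\<^sub>o x))
      = (1 - s) * Re (cinner x (A \<bullet>\<^sub>o x)) + s * Re (cinner x (B \<bullet>\<^sub>o x))" for x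
    by (simp add: op_apply_simps cinner_add_right cinner_scaleR_right cinner_diff_right algebra_simps)
  have "(1 - s) * (a * (norm x)\<^sup>2) + s * (a * (norm x)\<^sup>2) \<le> Re (cinner x ((A + s *\<^sub>R (B - A)) \<bullet>\<^sub>o x))"
    "Re (cinner x ((A + s *\<^sub>R (B - A)) \<bullet>\<^sub>o x)) \<le> (1 - s) * (b * (norm x)\<^sup>2) + s * (b * (norm x)\<^sup>2)" for x
    unfolding form using A B s by (auto simp: sa_between_def intro!: add_mono mult_left_mono)
  hence "a * (norm x)\<^sup>2 \<le> Re (cinner x ((A + s *\<^sub>R (B - A)) \<bullet>\<^sub>o x))"
    "Re (cinner x ((A + s *\<^sub>R (B - A)) \<bullet>\<^sub>o x)) \<le> b * (norm x)\<^sup>2" for x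
    by (simp_all add: left_diff_distrib)
  moreover have "is_adj (A + s *\<^sub>R (B - A)) (A + s *\<^sub>R (B - A))"
    using A B by (intro is_adj_add is_adj_scaleR is_adj_diff sa_between_adj)
  ultimately show ?thesis by (simp add: sa_between_def)
qed

lemma rpoly_eq:
  assumes "degree q \<le> n"
  shows "rpoly q A = (\<Sum>k\<le>n. coeff q k *\<^sub>R A ^ k)"
  unfolding rpoly_def using assms
  by (intro sum.mono_neutral_left) (auto simp: coeff_eq_0)

lemma rpoly_pderiv: "rpoly (pderiv p) A = (\<Sum>k\<le>degree p. (coeff p k * real k) *\<^sub>R A ^ (k - 1))"
proof -
  have "rpoly (pderiv p) A = (\<Sum>k\<le>degree p. coeff (pderiv p) k *\<^sub>R A ^ k)"
    by (rule rpoly_eq) (simp add: degree_pderiv)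
  also have "\<dots> = (\<Sum>k\<le>degree p. (coeff p (Suc k) * real (Suc k)) *\<^sub>R A ^ (Suc k - 1))"
    by (rule sum.cong) (simp_all add: coeff_pderiv mult.commute)
  also have "\<dots> = (\<Sum>k\<le>Suc (degree p). (coeff p k * real k) *\<^sub>R A ^ (k - 1))"
    by (simp add: sum.atMost_Suc_shift del: sum.atMost_Suc)
  also have "\<dots> = (\<Sum>k\<le>degree p. (coeff p k * real k) *\<^sub>R A ^ (k - 1))"
    by (simp add: coeff_eq_0)
  finally show ?thesis .
qed

lemma poly_bounded_on_interval: "\<exists>M\<ge>0. \<forall>t. a \<le> t \<longrightarrow> t \<le> b \<longrightarrow> \<bar>poly q (t :: real)\<bar> \<le> M"
proof -
  have "compact ((\<lambda>t. poly q t) ` {a..b})"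
    by (intro compact_continuous_image continuous_intros) simp
  then obtain M where "\<forall>x\<in>(\<lambda>t. poly q t) ` {a..b}. norm x \<le> M"
    using bounded_iff compact_imp_bounded by blast
  thus ?thesis by (intro exI[of _ "max M 0"]) (auto simp: le_max_iff_disj)
qed

lemma bernstein_integral:
  assumes "i \<le> m"
  shows "((\<lambda>t. real (m choose i) * t ^ i * (1 - t) ^ (m - i)) has_integral 1 / real (Suc m)) {0..1}"
proof -
  have "((\<lambda>t. t powr (real i + 1 - 1) * (1 - t) powr (real (m - i) + 1 - 1)) has_integral
      Beta (real i + 1) (real (m - i) + 1)) {0<..<1}"
    using has_integral_Beta_real[of "real i + 1" "real (m - i) + 1"]
    by (simp add: has_integral_Icc_iff_Ioo)
  hence "((\<lambda>t. t ^ i * (1 - t) ^ (m - i)) has_integral Beta (real i + 1) (real (m - i) + 1)) {0<..<1}"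
    by (rule has_integral_cong[THEN iffD1, rotated]) (simp add: powr_realpow)
  hence "((\<lambda>t. real (m choose i) * (t ^ i * (1 - t) ^ (m - i))) has_integral
      real (m choose i) * Beta (real i + 1) (real (m - i) + 1)) {0..1}"
    by (intro has_integral_mult_right) (simp add: has_integral_Icc_iff_Ioo)
  also have "real (m choose i) * Beta (real i + 1) (real (m - i) + 1) = 1 / real (Suc m)"
  proof -
    have eq: "real i + 1 + (real (m - i) + 1) = 1 + real (Suc m)" using assms by (simp add: of_nat_diff)
    have "Beta (real i + 1) (real (m - i) + 1) = fact i * fact (m - i) / fact (Suc m)"
      unfolding Beta_def eq using Gamma_fact[of i, where 'a = real] Gamma_fact[of "m - i", where 'a = real]
        Gamma_fact[of "Suc m", where 'a = real] by (simp add: add.commute)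
    thus ?thesis using assms by (simp add: binomial_fact)
  qed
  finally show ?thesis by (simp add: mult.assoc)
qed

text \<open>Left and right multiplications commute, so this is the binomial theorem.\<close>

lemma two_sided_power:
  fixes A B :: "'a::complex_inner bounded_op"
  shows "((\<lambda>X. t *\<^sub>R (B * X) + (1 - t) *\<^sub>R (X * A)) ^^ m) X
    = (\<Sum>i\<le>m. (real (m choose i) * t ^ i * (1 - t) ^ (m - i)) *\<^sub>R (B ^ i * X * A ^ (m - i)))"
proof (induction m)
  case (Suc m)
  define g where "g m i = real (m choose i) * t ^ i * (1 - t) ^ (m - i)" for m i
  define Z where "Z i = B ^ i * X * A ^ (Suc m - i)" for i
  have g0: "g (Suc m) 0 = (1 - t) * g m 0" by (simp add: g_def)
  have gSuc: "g (Suc m) (Suc i) = t * g m i + (1 - t) * g m (Suc i)" if "i \<le> m" for i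
  proof (cases "i = m")
    case False
    hence "m - i = Suc (m - Suc i)" using that by simp
    thus ?thesis by (simp add: g_def algebra_simps)
  qed (simp add: g_def)
  have left: "t *\<^sub>R (B * (g m i *\<^sub>R (B ^ i * X * A ^ (m - i)))) = (t * g m i) *\<^sub>R Z (Suc i)" for i
    by (simp add: Z_def mult.assoc)
  have right: "(1 - t) *\<^sub>R ((g m i *\<^sub>R (B ^ i * X * A ^ (m - i))) * A) = ((1 - t) * g m i) *\<^sub>R Z i"
    if "i \<le> m" for i
    using that by (simp add: Z_def Suc_diff_le power_Suc2 mult.assoc del: power_Suc)
  have "((\<lambda>X. t *\<^sub>R (B * X) + (1 - t) *\<^sub>R (X * A)) ^^ Suc m) X
      = (\<Sum>i\<le>m. (t * g m i) *\<^sub>R Z (Suc i)) + (\<Sum>i\<le>m. ((1 - t) * g m i) *\<^sub>R Z i)"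
    by (simp add: Suc g_def[symmetric] sum_distrib_left sum_distrib_right scaleR_sum_right left right
        del: mult_scaleR_left mult_scaleR_right scaleR_scaleR)
  also have "(\<Sum>i\<le>m. ((1 - t) * g m i) *\<^sub>R Z i) = (\<Sum>i\<le>Suc m. ((1 - t) * g m i) *\<^sub>R Z i)"
    by (simp add: g_def)
  also have "\<dots> = ((1 - t) * g m 0) *\<^sub>R Z 0 + (\<Sum>i\<le>m. ((1 - t) * g m (Suc i)) *\<^sub>R Z (Suc i))"
    by (rule sum.atMost_Suc_shift)
  also have "(\<Sum>i\<le>m. (t * g m i) *\<^sub>R Z (Suc i)) + \<dots>
      = g (Suc m) 0 *\<^sub>R Z 0 + (\<Sum>i\<le>m. g (Suc m) (Suc i) *\<^sub>R Z (Suc i))"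
    by (simp add: g0 gSuc scaleR_left_distrib sum.distrib)
  also have "\<dots> = (\<Sum>i\<le>Suc m. g (Suc m) i *\<^sub>R Z i)"
    by (rule sum.atMost_Suc_shift[symmetric])
  finally show ?case by (simp only: g_def Z_def)
qed simp

context onb
begin

lemma hip_sa_between_left:
  assumes A: "sa_between a b A" and X: "X \<in> HS"
  shows "a * hip X X \<le> hip X (A * X)" "hip X (A * X) \<le> b * hip X X"
proof -
  have AX: "A * X \<in> HS" by (rule HS_mult_left[OF sa_between_adj[OF A] X])
  have s: "((\<lambda>e. (norm (X \<bullet>\<^sub>o e))\<^sup>2) has_sum hip X X) E"
    using hip_has_sum[OF X X] by (simp add: Re_cinner_self)
  show "a * hip X X \<le> hip X (A * X)"
    by (rule has_sum_mono[OF has_sum_cmult_right[OF s] hip_has_sum[OF X AX]])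
      (use A in \<open>auto simp: sa_between_def times_op_apply\<close>)
  show "hip X (A * X) \<le> b * hip X X"
    by (rule has_sum_mono[OF hip_has_sum[OF X AX] has_sum_cmult_right[OF s]])
      (use A in \<open>auto simp: sa_between_def times_op_apply\<close>)
qed

lemma hip_sa_between_right:
  assumes A: "sa_between a b A" and X: "X \<in> HS"
  shows "a * hip X X \<le> hip X (X * A)" "hip X (X * A) \<le> b * hip X X"
proof -
  obtain X' where X': "is_adj X X'" using X by (rule HS_adjE)
  note A_adj = sa_between_adj[OF A]
  have "hip X (X * A) = hip (A * X') X'"
    by (rule hip_adj[OF X' is_adj_mult[OF X' A_adj] X HS_mult_right[OF A_adj X]])
  moreover have "hip X X = hip X' X'" by (rule hip_adj[OF X' X' X X])
  ultimately show "a * hip X X \<le> hip X (X * A)" "hip X (X * A) \<le> b * hip X X"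
    using hip_sa_between_left[OF A HS_adj[OF X' X]] by (simp_all add: hip_commute)
qed

text \<open>Both multiplications inherit the bounds of the operators: the left one termwise in the
  series \<open>\<Sum>\<^sub>e \<langle>Xe, BXe\<rangle>\<close>, the right one after passing to adjoints.\<close>

lemma symmetric_operator_two_sided:
  assumes A: "sa_between a b A" and B: "sa_between a b B" and "a < b" and t: "0 \<le> t" "t \<le> 1"
  shows "symmetric_operator HS hip (\<lambda>X. t *\<^sub>R (B * X) + (1 - t) *\<^sub>R (X * A)) a b"
proof
  note adj = sa_between_adj[OF A] sa_between_adj[OF B]
  note HS = HS_mult_left[OF adj(2)] HS_mult_right[OF adj(1)]
  note simps = HS HS_scaleR HS_add hip_add_left hip_add_right hip_scaleR_left hip_scaleR_right
  show "t *\<^sub>R (B * X) + (1 - t) *\<^sub>R (X * A) \<in> HS" if "X \<in> HS" for X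
    using that by (simp add: simps)
  show "hip (t *\<^sub>R (B * X) + (1 - t) *\<^sub>R (X * A)) Y = hip X (t *\<^sub>R (B * Y) + (1 - t) *\<^sub>R (Y * A))"
    if "X \<in> HS" "Y \<in> HS" for X Y
    using that by (simp add: simps hip_mult_left[OF adj(2)] hip_mult_right[OF adj(1)])
  fix X assume X: "X \<in> HS"
  have eq: "hip X (t *\<^sub>R (B * X) + (1 - t) *\<^sub>R (X * A)) = t * hip X (B * X) + (1 - t) * hip X (X * A)"
    using X by (simp add: simps)
  have "t * (a * hip X X) + (1 - t) * (a * hip X X) \<le> hip X (t *\<^sub>R (B * X) + (1 - t) *\<^sub>R (X * A))"
    unfolding eq using t by (intro add_mono mult_left_mono hip_sa_between_left(1)[OF B X]
        hip_sa_between_right(1)[OF A X]) auto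
  thus "a * hip X X \<le> hip X (t *\<^sub>R (B * X) + (1 - t) *\<^sub>R (X * A))"
    by (simp add: left_diff_distrib)
  have "hip X (t *\<^sub>R (B * X) + (1 - t) *\<^sub>R (X * A)) \<le> t * (b * hip X X) + (1 - t) * (b * hip X X)"
    unfolding eq using t by (intro add_mono mult_left_mono hip_sa_between_left(2)[OF B X]
        hip_sa_between_right(2)[OF A X]) auto
  thus "hip X (t *\<^sub>R (B * X) + (1 - t) *\<^sub>R (X * A)) \<le> b * hip X X"
    by (simp add: left_diff_distrib)
qed (use \<open>a < b\<close> in \<open>auto simp: HS_zero HS_add HS_scaleR hip_add_right hip_scaleR_right hip_nonneg
    algebra_simps intro: hip_commute\<close>)

lemma HS_power_diff:
  assumes "is_adj A A" "is_adj B B" "B - A \<in> HS"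
  shows "B ^ k - A ^ k \<in> HS"
  unfolding op_power_diff using assms
  by (intro HS_sum HS_mult_right[OF is_adj_power] HS_mult_left[OF is_adj_power])

lemma rpoly_diff: "rpoly q B - rpoly q A = (\<Sum>k\<le>degree q. coeff q k *\<^sub>R (B ^ k - A ^ k))"
  by (simp add: rpoly_def sum_subtractf scaleR_diff_right)

lemma HS_rpoly_diff:
  assumes "is_adj A A" "is_adj B B" "B - A \<in> HS"
  shows "rpoly q B - rpoly q A \<in> HS"
  unfolding rpoly_diff by (intro HS_sum HS_scaleR HS_power_diff assms)

text \<open>The divided difference \<open>(q(\<lambda>) - q(\<mu>)) / (\<lambda> - \<mu>)\<close> is the mean of \<open>q'\<close> over the segment
  from \<open>\<mu>\<close> to \<open>\<lambda>\<close>, and so \<open>q(B) - q(A)\<close> is the mean of the operators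
  \<open>q'(T\<^sub>t)(B - A)\<close> with \<open>T\<^sub>t X = t B X + (1 - t) X A\<close>.\<close>

lemma hip_rpoly_diff_bound:
  assumes A: "sa_between a b A" and B: "sa_between a b B" and ab: "a < b"
    and D: "B - A \<in> HS" and W: "W \<in> HS"
    and q: "\<And>t. a \<le> t \<Longrightarrow> t \<le> b \<Longrightarrow> \<bar>poly (pderiv q) t\<bar> \<le> M"
  shows "\<bar>hip W (rpoly q B - rpoly q A)\<bar> \<le> M * sqrt (hip W W) * sqrt (hip (B - A) (B - A))"
proof -
  note adj = sa_between_adj[OF A] sa_between_adj[OF B]
  define V where "V = B - A"
  define T where "T t X = t *\<^sub>R (B * X) + (1 - t) *\<^sub>R (X * A)" for t X
  define ev where "ev t = symmetric_operator.ev (T t)" for t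
  have sym: "symmetric_operator HS hip (T t) a b" if "0 \<le> t" "t \<le> 1" for t
    unfolding T_def using symmetric_operator_two_sided[OF A B ab that] .
  define h where "h t = hip W (ev t (pderiv q) V)" for t
  have h_bound: "\<bar>h t\<bar> \<le> M * sqrt (hip W W) * sqrt (hip V V)" if "0 \<le> t" "t \<le> 1" for t
    unfolding h_def ev_def
    by (rule symmetric_operator.ev_mixed_bound[OF sym[OF that]]) (use D W q in \<open>auto simp: V_def\<close>)
  have in_HS: "B ^ i * V * A ^ j \<in> HS" for i j
    using D adj unfolding V_def by (intro HS_mult_right[OF is_adj_power] HS_mult_left[OF is_adj_power])
  have h_eq: "h t = (\<Sum>m\<le>degree (pderiv q). coeff (pderiv q) m *
      (\<Sum>i\<le>m. (real (m choose i) * t ^ i * (1 - t) ^ (m - i)) * hip W (B ^ i * V * A ^ (m - i))))"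
    if "0 \<le> t" "t \<le> 1" for t
    unfolding h_def ev_def symmetric_operator.ev_def[OF sym[OF that]] T_def two_sided_power
    by (simp add: hip_sum_right hip_scaleR_right HS_scaleR HS_sum in_HS W)
  have "((\<lambda>t. \<Sum>m\<le>degree (pderiv q). coeff (pderiv q) m *
      (\<Sum>i\<le>m. (real (m choose i) * t ^ i * (1 - t) ^ (m - i)) * hip W (B ^ i * V * A ^ (m - i))))
    has_integral (\<Sum>m\<le>degree (pderiv q). coeff (pderiv q) m *
      (\<Sum>i\<le>m. 1 / real (Suc m) * hip W (B ^ i * V * A ^ (m - i))))) {0..1}"
    by (intro has_integral_sum has_integral_mult_right has_integral_mult_left bernstein_integral) auto
  hence int: "(h has_integral (\<Sum>m\<le>degree (pderiv q). coeff (pderiv q) m *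
      (\<Sum>i\<le>m. 1 / real (Suc m) * hip W (B ^ i * V * A ^ (m - i))))) {0..1}"
    by (rule has_integral_cong[THEN iffD1, rotated]) (simp add: h_eq)
  have mono: "hip W (B ^ Suc m - A ^ Suc m) = (\<Sum>i\<le>m. hip W (B ^ i * V * A ^ (m - i)))" for m
  proof -
    have "hip W (B ^ Suc m - A ^ Suc m) = (\<Sum>j<Suc m. hip W (B ^ (Suc m - j - 1) * V * A ^ j))"
      unfolding op_power_diff V_def[symmetric] by (intro hip_sum_right in_HS W)
    also have "\<dots> = (\<Sum>i\<le>m. hip W (B ^ i * V * A ^ (m - i)))"
      by (rule sum.reindex_bij_witness[where i = "\<lambda>i. m - i" and j = "\<lambda>j. m - j"]) auto
    finally show ?thesis .
  qed
  have "hip W (rpoly q B - rpoly q A) = (\<Sum>k\<le>degree q. coeff q k * hip W (B ^ k - A ^ k))"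
    unfolding rpoly_diff using W D adj
    by (simp add: hip_sum_right hip_scaleR_right HS_scaleR HS_power_diff)
  also have "\<dots> = (\<Sum>k\<le>Suc (degree (pderiv q)). coeff q k * hip W (B ^ k - A ^ k))"
    by (rule sum.mono_neutral_left) (auto simp: degree_pderiv coeff_eq_0)
  also have "\<dots> = (\<Sum>m\<le>degree (pderiv q). coeff q (Suc m) * hip W (B ^ Suc m - A ^ Suc m))"
    by (subst sum.atMost_Suc_shift) (simp add: hip_def zero_op_apply)
  also have "\<dots> = (\<Sum>m\<le>degree (pderiv q). coeff (pderiv q) m *
      (\<Sum>i\<le>m. 1 / real (Suc m) * hip W (B ^ i * V * A ^ (m - i))))"
    unfolding mono by (rule sum.cong) (simp_all add: coeff_pderiv sum_divide_distrib[symmetric])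
  finally have "(h has_integral hip W (rpoly q B - rpoly q A)) (cbox 0 1)" using int by simp
  moreover have "0 \<le> M * sqrt (hip W W) * sqrt (hip V V)"
    using h_bound[of 0] by linarith
  ultimately have "norm (hip W (rpoly q B - rpoly q A)) \<le> M * sqrt (hip W W) * sqrt (hip V V) * measure lborel (cbox 0 (1::real))"
    using h_bound by (intro has_integral_bound) auto
  thus ?thesis by (simp add: V_def)
qed

text \<open>Pair the difference with itself.\<close>

lemma HS_rpoly_diff_norm:
  assumes A: "sa_between a b A" and B: "sa_between a b B" and ab: "a < b" and D: "B - A \<in> HS"
    and q: "\<And>t. a \<le> t \<Longrightarrow> t \<le> b \<Longrightarrow> \<bar>poly (pderiv q) t\<bar> \<le> M"
  shows "sqrt (hip (rpoly q B - rpoly q A) (rpoly q B - rpoly q A)) \<le> M * sqrt (hip (B - A) (B - A))"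
proof -
  define Z where "Z = rpoly q B - rpoly q A"
  have Z: "Z \<in> HS" unfolding Z_def by (intro HS_rpoly_diff sa_between_adj[OF A] sa_between_adj[OF B] D)
  have M: "0 \<le> M" using q[of a] ab by linarith
  have "hip Z Z \<le> M * sqrt (hip Z Z) * sqrt (hip (B - A) (B - A))"
    using hip_rpoly_diff_bound[OF A B ab D Z q] by (simp add: Z_def)
  hence "sqrt (hip Z Z) * sqrt (hip Z Z) \<le> sqrt (hip Z Z) * (M * sqrt (hip (B - A) (B - A)))"
    using hip_nonneg[of Z] by (simp add: mult_ac)
  hence "sqrt (hip Z Z) \<le> M * sqrt (hip (B - A) (B - A))" if "hip Z Z \<noteq> 0"
    by (rule mult_left_le_imp_le) (use that hip_nonneg[of Z] in simp)
  moreover have "0 \<le> M * sqrt (hip (B - A) (B - A))" using M hip_nonneg[of "B - A"] by simp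
  ultimately show ?thesis unfolding Z_def[symmetric] by (cases "hip Z Z = 0") auto
qed

lemma hip_Cauchy_Schwarz:
  assumes "X \<in> HS" "Y \<in> HS"
  shows "\<bar>hip X Y\<bar> \<le> sqrt (hip X X) * sqrt (hip Y Y)"
proof -
  \<comment> \<open>the inequality concerns only the form; the operator is an arbitrary one\<close>
  have "sa_between 0 1 (0 :: 'a bounded_op)"
    by (simp add: sa_between_def is_adj_zero zero_op_apply)
  from symmetric_operator_two_sided[OF this this, of 0]
  have "symmetric_operator HS hip (\<lambda>X. 0 *\<^sub>R (0 * X) + (1 - 0) *\<^sub>R (X * 0)) 0 1" by simp
  from symmetric_operator.ip_Cauchy_Schwarz[OF this assms] show ?thesis .
qed

end

section \<open>The trace of the second order Taylor remainder\<close>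

definition power_remainder :: "nat \<Rightarrow> 'a::complex_inner bounded_op \<Rightarrow> 'a bounded_op \<Rightarrow> 'a bounded_op"
  where "power_remainder k A B = B ^ k - A ^ k - (\<Sum>j<k. A ^ (k - j - 1) * (B - A) * A ^ j)"

text \<open>Telescoping \<open>B\<^sup>k - A\<^sup>k\<close>, and then each \<open>B\<^sup>i - A\<^sup>i\<close>, shows that every term contains the factor
  \<open>B - A\<close> twice.\<close>

lemma power_remainder_eq:
  "power_remainder k A B = (\<Sum>j<k. (B ^ (k - j - 1) - A ^ (k - j - 1)) * ((B - A) * A ^ j))"
  unfolding power_remainder_def op_power_diff[of B k A]
  by (simp add: left_diff_distrib mult.assoc flip: sum_subtractf)

lemma is_adj_power_remainder:
  assumes "is_adj A A" "is_adj B B"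
  shows "is_adj (power_remainder k A B) (power_remainder k A B)"
proof -
  note BA = is_adj_diff[OF assms(2,1)]
  have "is_adj (\<Sum>j<k. A ^ (k - j - 1) * (B - A) * A ^ j) (\<Sum>j<k. A ^ j * ((B - A) * A ^ (k - j - 1)))"
    by (intro is_adj_sum is_adj_mult is_adj_power assms BA)
  also have "(\<Sum>j<k. A ^ j * ((B - A) * A ^ (k - j - 1))) = (\<Sum>j<k. A ^ (k - j - 1) * (B - A) * A ^ j)"
    by (rule sum.reindex_bij_witness[where i = "\<lambda>j. k - j - 1" and j = "\<lambda>j. k - j - 1"])
      (auto simp: mult.assoc)
  finally show ?thesis
    unfolding power_remainder_def by (intro is_adj_diff is_adj_power assms)
qed

context onb
begin

lemma power_remainder_terms:
  assumes A: "is_adj A A" and B: "is_adj B B" and D: "B - A \<in> HS"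
  shows "(B ^ i - A ^ i) * ((B - A) * A ^ j) \<in> TC"
    and "rtr ((B ^ i - A ^ i) * ((B - A) * A ^ j)) = hip (B ^ i - A ^ i) ((B - A) * A ^ j)"
proof -
  show "(B ^ i - A ^ i) * ((B - A) * A ^ j) \<in> TC"
    by (intro TC_mult HS_power_diff HS_mult_right[OF is_adj_power[OF A]] assms)
  show "rtr ((B ^ i - A ^ i) * ((B - A) * A ^ j)) = hip (B ^ i - A ^ i) ((B - A) * A ^ j)"
    by (intro rtr_mult is_adj_diff is_adj_power assms)
qed

lemma power_remainder_TC:
  "is_adj A A \<Longrightarrow> is_adj B B \<Longrightarrow> B - A \<in> HS \<Longrightarrow> power_remainder k A B \<in> TC"
  unfolding power_remainder_eq by (intro TC_sum power_remainder_terms)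

lemma rtr_power_remainder:
  "is_adj A A \<Longrightarrow> is_adj B B \<Longrightarrow> B - A \<in> HS \<Longrightarrow>
    rtr (power_remainder k A B) = (\<Sum>j<k. hip (B ^ (k - j - 1) - A ^ (k - j - 1)) ((B - A) * A ^ j))"
  unfolding power_remainder_eq by (simp add: rtr_sum power_remainder_terms)

definition trace_remainder :: "real poly \<Rightarrow> 'a bounded_op \<Rightarrow> 'a bounded_op \<Rightarrow> real"
  where "trace_remainder p A B = (\<Sum>k\<le>degree p. coeff p k * rtr (power_remainder k A B))"

text \<open>By cyclicity, the trace of a difference of two derivatives \<open>D p(B) W - D p(A) W\<close> is that of
  \<open>W (p'(B) - p'(A))\<close>; this makes the remainder additive up to such a pairing.\<close>

lemma rtr_two_sided_diff:
  assumes A: "is_adj A A" and B: "is_adj B B" and D: "B - A \<in> HS" and W: "is_adj W W" "W \<in> HS"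
  shows "B ^ i * W * B ^ j - A ^ i * W * A ^ j \<in> TC"
    and "rtr (B ^ i * W * B ^ j - A ^ i * W * A ^ j) = hip W (B ^ (i + j) - A ^ (i + j))"
proof -
  note Ak = is_adj_power[OF A] and Bk = is_adj_power[OF B]
  note Dk = HS_power_diff[OF A B D]
  note WB = HS_mult_right[OF Bk W(2)] and AW = HS_mult_left[OF Ak W(2)]
  have split: "B ^ i * W * B ^ j - A ^ i * W * A ^ j
      = (B ^ i - A ^ i) * (W * B ^ j) + (A ^ i * W) * (B ^ j - A ^ j)"
    by (simp add: algebra_simps)
  have TC1: "(B ^ i - A ^ i) * (W * B ^ j) \<in> TC" and TC2: "(A ^ i * W) * (B ^ j - A ^ j) \<in> TC"
    by (intro TC_mult Dk WB AW)+
  show "B ^ i * W * B ^ j - A ^ i * W * A ^ j \<in> TC"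
    unfolding split by (intro TC_add TC1 TC2)
  have "rtr ((B ^ i - A ^ i) * (W * B ^ j)) = rtr ((W * B ^ j) * (B ^ i - A ^ i))"
    by (rule rtr_commute_HS[OF Dk WB])
  also have "\<dots> = hip (B ^ j * W) (B ^ i - A ^ i)"
    by (rule rtr_mult[OF is_adj_mult[OF W(1) Bk]])
  also have "\<dots> = hip W (B ^ j * (B ^ i - A ^ i))"
    by (rule hip_mult_left[OF Bk W(2) Dk])
  finally have 1: "rtr ((B ^ i - A ^ i) * (W * B ^ j)) = hip W (B ^ j * (B ^ i - A ^ i))" .
  have "rtr ((A ^ i * W) * (B ^ j - A ^ j)) = hip (W * A ^ i) (B ^ j - A ^ j)"
    by (rule rtr_mult[OF is_adj_mult[OF Ak W(1)]])
  also have "\<dots> = hip W ((B ^ j - A ^ j) * A ^ i)"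
    by (rule hip_mult_right[OF Ak W(2) Dk])
  finally have 2: "rtr ((A ^ i * W) * (B ^ j - A ^ j)) = hip W ((B ^ j - A ^ j) * A ^ i)" .
  have "rtr (B ^ i * W * B ^ j - A ^ i * W * A ^ j)
      = hip W (B ^ j * (B ^ i - A ^ i) + (B ^ j - A ^ j) * A ^ i)"
    unfolding split rtr_add[OF TC1 TC2] 1 2
    by (intro hip_add_right[symmetric] HS_mult_left[OF Bk] HS_mult_right[OF Ak] Dk W(2))
  also have "B ^ j * (B ^ i - A ^ i) + (B ^ j - A ^ j) * A ^ i = B ^ (i + j) - A ^ (i + j)"
    by (simp add: algebra_simps flip: power_add)
  finally show "rtr (B ^ i * W * B ^ j - A ^ i * W * A ^ j) = hip W (B ^ (i + j) - A ^ (i + j))" .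
qed

lemma rtr_power_remainder_chain:
  assumes A: "is_adj A A" and B: "is_adj B B" and C: "is_adj C C"
    and AB: "B - A \<in> HS" and BC: "C - B \<in> HS"
  shows "rtr (power_remainder k A C) = rtr (power_remainder k A B) + rtr (power_remainder k B C)
    + hip (C - B) (real k *\<^sub>R (B ^ (k - 1) - A ^ (k - 1)))"
proof -
  define W where "W = C - B"
  have W: "is_adj W W" "W \<in> HS" using BC is_adj_diff[OF C B] by (simp_all add: W_def)
  define G where "G j = B ^ (k - j - 1) * W * B ^ j - A ^ (k - j - 1) * W * A ^ j" for j
  have "(\<Sum>j<k. A ^ (k - j - 1) * (C - A) * A ^ j)
      = (\<Sum>j<k. A ^ (k - j - 1) * (B - A) * A ^ j) + (\<Sum>j<k. A ^ (k - j - 1) * W * A ^ j)"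
    unfolding W_def by (simp add: algebra_simps flip: sum.distrib)
  hence split: "power_remainder k A C = power_remainder k A B + power_remainder k B C + (\<Sum>j<k. G j)"
    unfolding power_remainder_def G_def sum_subtractf W_def by (simp add: algebra_simps)
  have G: "G j \<in> TC" "rtr (G j) = hip W (B ^ (k - 1) - A ^ (k - 1))" if "j < k" for j
    using rtr_two_sided_diff[OF A B AB W, of "k - j - 1" j] that by (simp_all add: G_def)
  have "rtr (\<Sum>j<k. G j) = (\<Sum>j<k. hip W (B ^ (k - 1) - A ^ (k - 1)))"
    by (subst rtr_sum) (auto simp: G)
  also have "\<dots> = hip W (real k *\<^sub>R (B ^ (k - 1) - A ^ (k - 1)))"
    using W by (simp add: hip_scaleR_right HS_power_diff A B AB)
  finally have "rtr (\<Sum>j<k. G j) = hip W (real k *\<^sub>R (B ^ (k - 1) - A ^ (k - 1)))" .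
  moreover have "(\<Sum>j<k. G j) \<in> TC" using G by (intro TC_sum) auto
  ultimately show ?thesis
    unfolding split W_def[symmetric] using A B C AB BC
    by (simp add: rtr_add TC_add power_remainder_TC)
qed

lemma trace_remainder_chain:
  assumes A: "is_adj A A" and B: "is_adj B B" and C: "is_adj C C"
    and AB: "B - A \<in> HS" and BC: "C - B \<in> HS"
  shows "trace_remainder p A C = trace_remainder p A B + trace_remainder p B C
    + hip (C - B) (rpoly (pderiv p) B - rpoly (pderiv p) A)"
proof -
  have "hip (C - B) (rpoly (pderiv p) B - rpoly (pderiv p) A)
      = hip (C - B) (\<Sum>k\<le>degree p. coeff p k *\<^sub>R (real k *\<^sub>R (B ^ (k - 1) - A ^ (k - 1))))"
    unfolding rpoly_pderiv by (simp add: scaleR_diff_right flip: sum_subtractf)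
  also have "\<dots> = (\<Sum>k\<le>degree p. coeff p k * hip (C - B) (real k *\<^sub>R (B ^ (k - 1) - A ^ (k - 1))))"
    using BC by (simp add: hip_sum_right hip_scaleR_right HS_scaleR HS_power_diff A B AB mult.assoc)
  finally show ?thesis
    unfolding trace_remainder_def rtr_power_remainder_chain[OF assms]
    by (simp add: distrib_left sum.distrib)
qed

text \<open>A crude bound, with a constant that depends on the polynomial; it makes the remainder
  differentiable along segments.\<close>

lemma trace_remainder_quadratic:
  assumes A: "sa_between a b A" and ab: "a < b"
  shows "\<exists>C\<ge>0. \<forall>B. sa_between a b B \<longrightarrow> B - A \<in> HS \<longrightarrow> \<bar>trace_remainder p A B\<bar> \<le> C * hip (B - A) (B - A)"
proof -
  have "\<exists>M\<ge>0. \<forall>t. a \<le> t \<longrightarrow> t \<le> b \<longrightarrow> \<bar>poly (pderiv (monom 1 i)) t\<bar> \<le> M" for i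
    by (rule poly_bounded_on_interval)
  then obtain M where M: "\<And>i. 0 \<le> M i"
    "\<And>i t. a \<le> t \<Longrightarrow> t \<le> b \<Longrightarrow> \<bar>poly (pderiv (monom 1 i)) t\<bar> \<le> M i"
    by metis
  define C where "C = (\<Sum>k\<le>degree p. \<bar>coeff p k\<bar> * (\<Sum>j<k. M (k - j - 1) * norm (A ^ j)))"
  have "\<bar>trace_remainder p A B\<bar> \<le> C * hip (B - A) (B - A)" if B: "sa_between a b B" and D: "B - A \<in> HS" for B
  proof -
    note adj = sa_between_adj[OF A] sa_between_adj[OF B]
    define d where "d = sqrt (hip (B - A) (B - A))"
    have d: "0 \<le> d" "hip (B - A) (B - A) = d * d" using hip_nonneg[of "B - A"] by (simp_all add: d_def)
    have pw: "rpoly (monom 1 i) B - rpoly (monom 1 i) A = B ^ i - A ^ i" for i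
    proof -
      have "rpoly (monom 1 i) X = X ^ i" for X :: "'a bounded_op"
      proof -
        have "rpoly (monom 1 i) X = (\<Sum>k\<le>i. (if k = i then X ^ k else 0))"
          unfolding rpoly_def degree_monom_eq[OF one_neq_zero] by (rule sum.cong) auto
        thus ?thesis by simp
      qed
      thus ?thesis by simp
    qed
    have 1: "sqrt (hip (B ^ i - A ^ i) (B ^ i - A ^ i)) \<le> M i * d" for i
      unfolding pw[symmetric] d_def by (rule HS_rpoly_diff_norm[OF A B ab D M(2)])
    have 2: "sqrt (hip ((B - A) * A ^ j) ((B - A) * A ^ j)) \<le> norm (A ^ j) * d" for j
    proof -
      have "hip ((B - A) * A ^ j) ((B - A) * A ^ j) \<le> (norm (A ^ j))\<^sup>2 * hip (B - A) (B - A)"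
        by (rule hip_mult_right_le[OF is_adj_power[OF adj(1)] _ norm_op_apply D]) simp
      from real_sqrt_le_mono[OF this] show ?thesis by (simp add: real_sqrt_mult d_def)
    qed
    have pairing: "\<bar>hip (B ^ i - A ^ i) ((B - A) * A ^ j)\<bar> \<le> M i * norm (A ^ j) * (d * d)" for i j
    proof -
      have "\<bar>hip (B ^ i - A ^ i) ((B - A) * A ^ j)\<bar> \<le> sqrt (hip (B ^ i - A ^ i) (B ^ i - A ^ i))
          * sqrt (hip ((B - A) * A ^ j) ((B - A) * A ^ j))"
        by (intro hip_Cauchy_Schwarz HS_power_diff HS_mult_right[OF is_adj_power[OF adj(1)]] adj D)
      also have "\<dots> \<le> (M i * d) * (norm (A ^ j) * d)"
        using M(1)[of i] d(1) by (intro mult_mono 1 2) (auto simp: hip_nonneg)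
      finally show ?thesis by (simp add: mult_ac)
    qed
    have "\<bar>trace_remainder p A B\<bar> \<le> (\<Sum>k\<le>degree p. \<bar>coeff p k\<bar> * \<bar>rtr (power_remainder k A B)\<bar>)"
      unfolding trace_remainder_def by (rule order_trans[OF sum_abs]) (simp add: abs_mult)
    also have "\<dots> \<le> (\<Sum>k\<le>degree p. \<bar>coeff p k\<bar> * (\<Sum>j<k. M (k - j - 1) * norm (A ^ j) * (d * d)))"
      unfolding rtr_power_remainder[OF adj D]
      by (intro sum_mono mult_left_mono order_trans[OF sum_abs] pairing) auto
    also have "\<dots> = C * (d * d)"
      by (simp only: C_def sum_distrib_right mult.assoc)
    finally show ?thesis by (simp add: d)
  qed
  moreover have "0 \<le> C" unfolding C_def by (intro sum_nonneg mult_nonneg_nonneg M(1)) auto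
  ultimately show ?thesis by blast
qed

text \<open>Along the segment from \<open>A\<close> to \<open>B\<close> the remainder has derivative
  \<open>Tr (V (p'(A\<^sub>s) - p'(A)))\<close>, so that any bound on this pairing can be integrated.\<close>

lemma trace_remainder_le:
  assumes A: "sa_between a b A" and B: "sa_between a b B" and ab: "a < b" and D: "B - A \<in> HS"
    and bound: "\<And>s. 0 \<le> s \<Longrightarrow> s \<le> 1 \<Longrightarrow>
      \<bar>hip (B - A) (rpoly (pderiv p) (A + s *\<^sub>R (B - A)) - rpoly (pderiv p) A)\<bar> \<le> K + L * s"
  shows "\<bar>trace_remainder p A B\<bar> \<le> K + L / 2"
proof -
  define V where "V = B - A"
  define S where "S s = A + s *\<^sub>R V" for s
  define F where "F s = trace_remainder p A (S s)" for s
  define g where "g s = hip V (rpoly (pderiv p) (S s) - rpoly (pderiv p) A)" for s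
  have S: "sa_between a b (S s)" if "0 \<le> s" "s \<le> 1" for s
    unfolding S_def V_def using sa_between_segment[OF A B that] .
  have S_diff: "S t - S s = (t - s) *\<^sub>R V" for s t
    by (simp add: S_def scaleR_diff_left)
  have V: "V \<in> HS" using D by (simp add: V_def)
  have SA: "S s - A \<in> HS" for s by (simp add: S_def HS_scaleR V)
  have deriv: "(F has_vector_derivative g s) (at s within {0..1})" if s: "s \<in> {0..1}" for s
    unfolding has_vector_derivative_def has_derivative_within_alt
  proof (intro conjI allI impI)
    show "bounded_linear (\<lambda>h. h *\<^sub>R g s)" by (rule bounded_linear_scaleR_left)
    obtain C where C: "0 \<le> C" "\<And>B. sa_between a b B \<Longrightarrow> B - S s \<in> HS \<Longrightarrow>
        \<bar>trace_remainder p (S s) B\<bar> \<le> C * hip (B - S s) (B - S s)"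
      using trace_remainder_quadratic[OF S ab, of s p] s by auto
    fix e :: real assume e: "e > 0"
    define C' where "C' = C * hip V V"
    have C': "0 \<le> C'" using C(1) hip_nonneg[of V] by (simp add: C'_def)
    have "norm (F t - F s - (t - s) *\<^sub>R g s) \<le> e * norm (t - s)"
      if t: "t \<in> {0..1}" "norm (t - s) < e / (C' + 1)" for t
    proof -
      have "F t = F s + trace_remainder p (S s) (S t) + hip (S t - S s) (rpoly (pderiv p) (S s) - rpoly (pderiv p) A)"
        unfolding F_def using s t
        by (intro trace_remainder_chain sa_between_adj[OF A] sa_between_adj[OF S] SA)
          (auto simp: S_diff HS_scaleR V)
      also have "hip (S t - S s) (rpoly (pderiv p) (S s) - rpoly (pderiv p) A) = (t - s) * g s"
        unfolding S_diff g_def using s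
        by (intro hip_scaleR_left V HS_rpoly_diff sa_between_adj[OF A] sa_between_adj[OF S] SA) auto
      finally have "norm (F t - F s - (t - s) *\<^sub>R g s) = \<bar>trace_remainder p (S s) (S t)\<bar>" by simp
      also have "\<dots> \<le> C * hip (S t - S s) (S t - S s)"
        using t by (intro C(2) S) (auto simp: S_diff HS_scaleR V)
      also have "\<dots> = C' * \<bar>t - s\<bar> * \<bar>t - s\<bar>"
        unfolding S_diff by (simp add: hip_scaleR_left hip_scaleR_right HS_scaleR V C'_def)
      also have "\<dots> \<le> e * \<bar>t - s\<bar>"
      proof (rule mult_right_mono)
        have "C' * \<bar>t - s\<bar> \<le> (C' + 1) * \<bar>t - s\<bar>" by (simp add: distrib_right)
        also have "\<dots> \<le> e" using t(2) C' by (simp add: field_simps)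
        finally show "C' * \<bar>t - s\<bar> \<le> e" .
      qed simp
      finally show ?thesis by simp
    qed
    thus "\<exists>d>0. \<forall>t\<in>{0..1}. norm (t - s) < d \<longrightarrow> norm (F t - F s - (t - s) *\<^sub>R g s) \<le> e * norm (t - s)"
      using e C' by (intro exI[of _ "e / (C' + 1)"]) auto
  qed
  have int: "(g has_integral (F 1 - F 0)) {0..1}"
    by (rule fundamental_theorem_of_calculus[OF _ deriv]) auto
  have F0: "F 0 = 0"
  proof -
    have "rtr 0 = 0" by (simp add: rtr_def zero_op_apply)
    thus ?thesis by (simp add: F_def S_def trace_remainder_def power_remainder_def)
  qed
  have KL: "((\<lambda>s. K + L * s) has_integral (K + L / 2)) {0..1}"
  proof -
    have "((\<lambda>s. K + L * s) has_integral ((K * 1 + L * 1\<^sup>2 / 2) - (K * 0 + L * 0\<^sup>2 / 2))) {0..1}"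
      by (rule fundamental_theorem_of_calculus)
        (auto intro!: derivative_eq_intros simp flip: has_real_derivative_iff_has_vector_derivative)
    thus ?thesis by simp
  qed
  have g_bound: "\<bar>g s\<bar> \<le> K + L * s" if "s \<in> {0..1}" for s
    using bound[of s] that by (simp add: g_def S_def V_def)
  have "F 1 - F 0 \<le> K + L / 2"
    by (rule has_integral_le[OF int KL]) (use g_bound in force)
  moreover have "- (F 1 - F 0) \<le> K + L / 2"
    by (rule has_integral_le[OF has_integral_neg[OF int] KL]) (use g_bound in force)
  moreover have "F 1 = trace_remainder p A B" by (simp add: F_def S_def V_def)
  ultimately show ?thesis by (simp add: F0)
qed

text \<open>The pairing at \<open>s\<close> is at most \<open>M \<parallel>B - A\<parallel>\<^sub>2\<^sup>2 s\<close> by \<open>hip_rpoly_diff_bound\<close>, and integration over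
  \<open>s\<close> gives the factor \<open>1/2\<close>.\<close>

lemma trace_remainder_bound:
  assumes A: "sa_between a b A" and B: "sa_between a b B" and ab: "a < b" and D: "B - A \<in> HS"
    and p: "\<And>t. a \<le> t \<Longrightarrow> t \<le> b \<Longrightarrow> \<bar>poly (pderiv (pderiv p)) t\<bar> \<le> M"
  shows "\<bar>trace_remainder p A B\<bar> \<le> M * hip (B - A) (B - A) / 2"
proof -
  have "\<bar>trace_remainder p A B\<bar> \<le> 0 + M * hip (B - A) (B - A) / 2"
  proof (rule trace_remainder_le[OF A B ab D])
    fix s :: real assume s: "0 \<le> s" "s \<le> 1"
    have "\<bar>hip (B - A) (rpoly (pderiv p) (A + s *\<^sub>R (B - A)) - rpoly (pderiv p) A)\<bar>
        \<le> M * sqrt (hip (B - A) (B - A)) * sqrt (hip (A + s *\<^sub>R (B - A) - A) (A + s *\<^sub>R (B - A) - A))"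
      by (rule hip_rpoly_diff_bound[OF A sa_between_segment[OF A B s] ab _ D p])
        (simp_all add: HS_scaleR D)
    also have "hip (A + s *\<^sub>R (B - A) - A) (A + s *\<^sub>R (B - A) - A) = s\<^sup>2 * hip (B - A) (B - A)"
      by (simp add: hip_scaleR_left hip_scaleR_right HS_scaleR D power2_eq_square)
    also have "M * sqrt (hip (B - A) (B - A)) * sqrt (s\<^sup>2 * hip (B - A) (B - A)) = 0 + M * hip (B - A) (B - A) * s"
      using s hip_nonneg[of "B - A"] by (simp add: real_sqrt_mult mult_ac)
    finally show "\<bar>hip (B - A) (rpoly (pderiv p) (A + s *\<^sub>R (B - A)) - rpoly (pderiv p) A)\<bar>
        \<le> 0 + M * hip (B - A) (B - A) * s" .
  qed
  thus ?thesis by simp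
qed

text \<open>Relative to the supremum norm of \<open>p''\<close>, the remainder is continuous in the Hilbert-Schmidt norm of
  the perturbation.\<close>

lemma trace_remainder_diff_bound:
  assumes A: "sa_between a b A" and B: "sa_between a b B" and C: "sa_between a b C" and ab: "a < b"
    and AB: "B - A \<in> HS" and BC: "C - B \<in> HS"
    and p: "\<And>t. a \<le> t \<Longrightarrow> t \<le> b \<Longrightarrow> \<bar>poly (pderiv (pderiv p)) t\<bar> \<le> M"
  shows "\<bar>trace_remainder p A C - trace_remainder p A B\<bar>
    \<le> M * (hip (C - B) (C - B) / 2 + sqrt (hip (C - B) (C - B)) * sqrt (hip (B - A) (B - A)))"
proof -
  have "trace_remainder p A C - trace_remainder p A B
      = trace_remainder p B C + hip (C - B) (rpoly (pderiv p) B - rpoly (pderiv p) A)"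
    using trace_remainder_chain[OF sa_between_adj[OF A] sa_between_adj[OF B] sa_between_adj[OF C] AB BC]
    by simp
  moreover have "\<bar>trace_remainder p B C\<bar> \<le> M * hip (C - B) (C - B) / 2"
    by (rule trace_remainder_bound[OF B C ab BC p])
  moreover have "\<bar>hip (C - B) (rpoly (pderiv p) B - rpoly (pderiv p) A)\<bar>
      \<le> M * sqrt (hip (C - B) (C - B)) * sqrt (hip (B - A) (B - A))"
    by (rule hip_rpoly_diff_bound[OF A B ab AB BC p])
  ultimately show ?thesis by (simp add: distrib_left mult.assoc)
qed

text \<open>The pairing involves only the basis vectors in \<open>F\<close>, where \<open>p'(A\<^sub>s) - p'(A)\<close> is bounded in operator
  norm by \<open>2 sup \<bar>p'\<bar>\<close>.\<close>

lemma trace_remainder_finite_rank_bound: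
  assumes A: "sa_between a b A" and B: "sa_between a b B" and ab: "a < b" and D: "B - A \<in> HS"
    and F: "finite F" "F \<subseteq> E" "\<And>e. e \<in> E - F \<Longrightarrow> (B - A) \<bullet>\<^sub>o e = 0"
    and p: "\<And>t. a \<le> t \<Longrightarrow> t \<le> b \<Longrightarrow> \<bar>poly (pderiv p) t\<bar> \<le> M"
  shows "\<bar>trace_remainder p A B\<bar> \<le> 2 * (\<Sum>e\<in>F. norm ((B - A) \<bullet>\<^sub>o e)) * M"
proof -
  define V where "V = B - A"
  define c where "c = (\<Sum>e\<in>F. norm (V \<bullet>\<^sub>o e))"
  have "\<bar>trace_remainder p A B\<bar> \<le> 2 * c * M + 0 / 2"
  proof (rule trace_remainder_le[OF A B ab D])
    fix s :: real assume s: "0 \<le> s" "s \<le> 1"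
    define B' where "B' = A + s *\<^sub>R (B - A)"
    have B': "sa_between a b B'" unfolding B'_def by (rule sa_between_segment[OF A B s])
    define Z where "Z = rpoly (pderiv p) B' - rpoly (pderiv p) A"
    have Z_le: "norm (Z \<bullet>\<^sub>o e) \<le> 2 * M" if "e \<in> F" for e
    proof -
      have "norm (Z \<bullet>\<^sub>o e) \<le> norm (rpoly (pderiv p) B' \<bullet>\<^sub>o e) + norm (rpoly (pderiv p) A \<bullet>\<^sub>o e)"
        unfolding Z_def minus_op_apply by (rule norm_triangle_ineq4)
      also have "\<dots> \<le> M * norm e + M * norm e"
        by (intro add_mono rpoly_norm_bound[OF _ ab] A B' p)
      finally show ?thesis using that F(2) by (simp add: onb_norm subset_iff)
    qed
    have "hip V Z = (\<Sum>\<^sub>\<infinity>e\<in>F. Re (cinner (V \<bullet>\<^sub>o e) (Z \<bullet>\<^sub>o e)))"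
      unfolding hip_def using F by (intro infsum_cong_neutral) (auto simp: V_def)
    hence "\<bar>hip V Z\<bar> \<le> (\<Sum>e\<in>F. \<bar>Re (cinner (V \<bullet>\<^sub>o e) (Z \<bullet>\<^sub>o e))\<bar>)"
      using F(1) by simp
    also have "\<dots> \<le> (\<Sum>e\<in>F. norm (V \<bullet>\<^sub>o e) * (2 * M))"
      by (intro sum_mono order_trans[OF Re_cinner_le] mult_left_mono Z_le) auto
    also have "\<dots> = 2 * c * M + 0 * s" by (simp add: c_def flip: sum_distrib_right)
    finally show "\<bar>hip (B - A) (rpoly (pderiv p) (A + s *\<^sub>R (B - A)) - rpoly (pderiv p) A)\<bar>
        \<le> 2 * c * M + 0 * s"
      by (simp only: V_def Z_def B'_def)
  qed
  thus ?thesis by (simp add: c_def V_def)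
qed

lemma trace_remainder_square:
  assumes "is_adj A A" "is_adj B B" "B - A \<in> HS"
  shows "rtr (power_remainder 2 A B) = hip (B - A) (B - A)"
  unfolding rtr_power_remainder[OF assms]
  by (simp add: numeral_2_eq_2 hip_def zero_op_apply)

end

section \<open>Integrable functions as functionals on polynomials\<close>

lemma integrable_mult_continuous:
  fixes \<eta> :: "real \<Rightarrow> real"
  assumes \<eta>: "integrable lebesgue \<eta>" and supp: "\<And>t. t \<notin> {a..b} \<Longrightarrow> \<eta> t = 0"
    and f: "continuous_on UNIV f" and M: "\<And>t. t \<in> {a..b} \<Longrightarrow> \<bar>f t\<bar> \<le> M"
  shows "integrable lebesgue (\<lambda>t. f t * \<eta> t)"
    and "\<bar>LINT t|lebesgue. f t * \<eta> t\<bar> \<le> M * (LINT t|lebesgue. \<bar>\<eta> t\<bar>)"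
proof -
  have meas: "f \<in> borel_measurable lebesgue"
    using f by (intro measurable_completion) (simp add: borel_measurable_continuous_onI)
  have le: "\<bar>f t * \<eta> t\<bar> \<le> M * \<bar>\<eta> t\<bar>" for t
    using M[of t] supp[of t] by (cases "t \<in> {a..b}") (auto simp: abs_mult intro!: mult_right_mono)
  have int: "integrable lebesgue (\<lambda>t. M * \<bar>\<eta> t\<bar>)" using \<eta> by simp
  show *: "integrable lebesgue (\<lambda>t. f t * \<eta> t)"
    by (rule Bochner_Integration.integrable_bound[OF int])
      (use le meas \<eta> in \<open>auto intro!: AE_I2 order_trans[OF le] borel_measurable_times\<close>)
  have "\<bar>LINT t|lebesgue. f t * \<eta> t\<bar> \<le> (LINT t|lebesgue. \<bar>f t * \<eta> t\<bar>)"
    using integral_norm_bound[of lebesgue "\<lambda>t. f t * \<eta> t"] by simp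
  also have "\<dots> \<le> (LINT t|lebesgue. M * \<bar>\<eta> t\<bar>)"
    by (rule integral_mono[OF _ int le]) (use * in simp)
  finally show "\<bar>LINT t|lebesgue. f t * \<eta> t\<bar> \<le> M * (LINT t|lebesgue. \<bar>\<eta> t\<bar>)" by simp
qed

lemma polynomial_approximation:
  fixes f :: "real \<Rightarrow> real"
  assumes "continuous_on UNIV f" "\<delta> > 0"
  obtains q where "\<And>t. t \<in> {a..b} \<Longrightarrow> \<bar>f t - poly q t\<bar> < \<delta>"
proof -
  have "continuous_on {a..b} f" using assms(1) continuous_on_subset by blast
  from Stone_Weierstrass_real_polynomial_function[OF _ this assms(2)]
  obtain g where g: "real_polynomial_function g" "\<And>t. t \<in> {a..b} \<Longrightarrow> \<bar>f t - g t\<bar> < \<delta>" by auto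
  from g(1) obtain c n where "g = (\<lambda>x. \<Sum>i\<le>n. c i * x ^ i)"
    by (auto simp: real_polynomial_function_iff_sum)
  hence "g t = poly (\<Sum>i\<le>n. monom (c i) i) t" for t by (simp add: poly_sum poly_monom)
  thus thesis using g(2) that by metis
qed

text \<open>The sign of an integrable function is almost everywhere a limit of continuous functions with
  values in \<open>[-1, 1]\<close>, and those are uniform limits of polynomials on the interval. So the
  \<open>L\<^sup>1\<close>-norm is the dual norm on polynomials.\<close>

lemma L1_norm_le_by_polynomials:
  fixes g :: "real \<Rightarrow> real"
  assumes g: "integrable lebesgue g" and supp: "\<And>t. t \<notin> {a..b} \<Longrightarrow> g t = 0"
    and bound: "\<And>q M. (\<And>t. t \<in> {a..b} \<Longrightarrow> \<bar>poly q t\<bar> \<le> M) \<Longrightarrow> 0 \<le> M \<Longrightarrow>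
      \<bar>LINT t|lebesgue. poly q t * g t\<bar> \<le> \<epsilon> * M"
  shows "(LINT t|lebesgue. \<bar>g t\<bar>) \<le> \<epsilon>"
proof -
  define I where "I = (LINT t|lebesgue. \<bar>g t\<bar>)"
  have I: "0 \<le> I" unfolding I_def by (rule Bochner_Integration.integral_nonneg) simp
  have cont_bound: "\<bar>LINT t|lebesgue. f t * g t\<bar> \<le> \<epsilon>"
    if f: "continuous_on UNIV f" "\<And>t. \<bar>f t\<bar> \<le> 1" for f
  proof (rule field_le_epsilon)
    fix e :: real assume e: "e > 0"
    define \<delta> where "\<delta> = e / (\<bar>\<epsilon>\<bar> + I + 1)"
    have \<delta>: "\<delta> > 0" using e I by (simp add: \<delta>_def add_nonneg_pos)
    obtain q where q: "\<And>t. t \<in> {a..b} \<Longrightarrow> \<bar>f t - poly q t\<bar> < \<delta>"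
      using polynomial_approximation[OF f(1) \<delta>] by metis
    have q_le: "\<bar>poly q t\<bar> \<le> 1 + \<delta>" if "t \<in> {a..b}" for t
      using q[OF that] f(2)[of t] by linarith
    have cq: "continuous_on UNIV (\<lambda>t. poly q t)" by (intro continuous_intros)
    have int_f: "integrable lebesgue (\<lambda>t. f t * g t)"
      by (rule integrable_mult_continuous(1)[OF g supp f(1) f(2)])
    have int_q: "integrable lebesgue (\<lambda>t. poly q t * g t)"
      by (rule integrable_mult_continuous(1)[OF g supp cq q_le])
    have "(LINT t|lebesgue. f t * g t) = (LINT t|lebesgue. poly q t * g t) + (LINT t|lebesgue. (f t - poly q t) * g t)"
      using int_f int_q by (simp add: left_diff_distrib)
    moreover have "\<bar>LINT t|lebesgue. (f t - poly q t) * g t\<bar> \<le> \<delta> * I"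
      unfolding I_def
      by (rule integrable_mult_continuous(2)[OF g supp]) (use q f(1) cq in \<open>auto intro!: continuous_on_diff less_imp_le\<close>)
    moreover have "\<bar>LINT t|lebesgue. poly q t * g t\<bar> \<le> \<epsilon> * (1 + \<delta>)"
      by (rule bound[OF q_le]) (use \<delta> in auto)
    ultimately have "\<bar>LINT t|lebesgue. f t * g t\<bar> \<le> \<epsilon> + \<delta> * (\<epsilon> + I)"
      by (simp add: algebra_simps)
    also have "\<delta> * (\<epsilon> + I) \<le> \<delta> * (\<bar>\<epsilon>\<bar> + I + 1)" using \<delta> by (intro mult_left_mono) auto
    also have "\<dots> = e" using I by (simp add: \<delta>_def)
    finally show "\<bar>LINT t|lebesgue. f t * g t\<bar> \<le> \<epsilon> + e" by simp
  qed
  have meas: "(\<lambda>t. sgn (g t)) \<in> borel_measurable lebesgue"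
    using borel_measurable_integrable[OF g] unfolding sgn_if by measurable
  hence "(\<lambda>t. sgn (g t)) measurable_on UNIV"
    by (rule lebesgue_measurable_imp_measurable_on) simp
  then obtain N h where N: "negligible N" and h: "\<And>n :: nat. continuous_on UNIV (h n)"
    and lim: "\<And>t. t \<notin> N \<Longrightarrow> (\<lambda>n. h n t) \<longlonglongrightarrow> sgn (g t)"
    unfolding measurable_on_def by auto
  define f where "f n t = max (- 1) (min 1 (h n t))" for n t
  have f: "continuous_on UNIV (f n)" "\<bar>f n t\<bar> \<le> 1" for n t
    unfolding f_def by (intro continuous_intros h) auto
  have AE_N: "AE t in lebesgue. t \<notin> N"
    using N by (intro AE_not_in) (simp add: negligible_iff_null_sets)
  have "(\<lambda>n. LINT t|lebesgue. f n t * g t) \<longlonglongrightarrow> (LINT t|lebesgue. \<bar>g t\<bar>)"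
  proof (rule integral_dominated_convergence)
    show "integrable lebesgue (\<lambda>t. \<bar>g t\<bar>)" "(\<lambda>t. \<bar>g t\<bar>) \<in> borel_measurable lebesgue"
      using g by auto
    show "(\<lambda>t. f n t * g t) \<in> borel_measurable lebesgue" for n
      using integrable_mult_continuous(1)[OF g supp f] by auto
    show "AE t in lebesgue. norm (f n t * g t) \<le> \<bar>g t\<bar>" for n
      using f(2) by (intro AE_I2) (simp add: abs_mult mult_left_le_one_le)
    show "AE t in lebesgue. (\<lambda>n. f n t * g t) \<longlonglongrightarrow> \<bar>g t\<bar>"
      using AE_N
    proof eventually_elim
      fix t assume "t \<notin> N"
      from lim[OF this] have "(\<lambda>n. f n t * g t) \<longlonglongrightarrow> max (- 1) (min 1 (sgn (g t))) * g t"
        unfolding f_def by (intro tendsto_intros)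
      also have "max (- 1) (min 1 (sgn (g t))) * g t = \<bar>g t\<bar>" by (simp add: sgn_if abs_if)
      finally show "(\<lambda>n. f n t * g t) \<longlonglongrightarrow> \<bar>g t\<bar>" .
    qed
  qed
  moreover have "(LINT t|lebesgue. f n t * g t) \<le> \<epsilon>" for n
    using cont_bound[OF f, of n] by linarith
  ultimately show ?thesis by (intro LIMSEQ_le_const2) auto
qed

text \<open>For an approximate minimizer \<open>g\<close> of \<open>\<integral> q\<^sup>2 - 2 \<Lambda>(q)\<close> the first variation
  \<open>\<integral> g q - \<Lambda>(q)\<close> is small. This is the variational proof of the Riesz representation theorem in
  \<open>L\<^sup>2\<close>, stopped at an approximate minimizer. The bound by the \<open>L\<^sup>1\<close>-norm makes the quadratic functional
  bounded below, by completing the square pointwise.\<close>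

lemma approximate_riesz:
  fixes \<Lambda> :: "real poly \<Rightarrow> real"
  assumes ab: "a < b" and add: "\<And>p q. \<Lambda> (p + q) = \<Lambda> p + \<Lambda> q" and smult: "\<And>c p. \<Lambda> (smult c p) = c * \<Lambda> p"
    and bound: "\<And>q. \<bar>\<Lambda> q\<bar> \<le> C * integral {a..b} (\<lambda>t. \<bar>poly q t\<bar>)"
    and \<epsilon>: "\<epsilon> > 0"
  obtains g where "\<And>q M. (\<And>t. t \<in> {a..b} \<Longrightarrow> \<bar>poly q t\<bar> \<le> M) \<Longrightarrow>
    \<bar>\<Lambda> q - integral {a..b} (\<lambda>t. poly q t * poly g t)\<bar> \<le> \<epsilon> * M"
proof -
  have int: "f integrable_on {a..b}" if "continuous_on {a..b} f" for f :: "real \<Rightarrow> real"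
    using that by (rule integrable_continuous_real)
  define J where "J q = integral {a..b} (\<lambda>t. (poly q t)\<^sup>2) - 2 * \<Lambda> q" for q
  have J_lower: "- (C\<^sup>2 * (b - a)) \<le> J q" for q
  proof -
    have "0 \<le> integral {a..b} (\<lambda>t. (\<bar>poly q t\<bar> - C)\<^sup>2)"
      by (intro integral_nonneg int continuous_intros) auto
    also have "\<dots> = integral {a..b} (\<lambda>t. (poly q t)\<^sup>2 - (2 * C) * \<bar>poly q t\<bar> + C\<^sup>2)"
      by (rule integral_cong) (simp add: power2_diff)
    also have "\<dots> = integral {a..b} (\<lambda>t. (poly q t)\<^sup>2) - (2 * C) * integral {a..b} (\<lambda>t. \<bar>poly q t\<bar>)
        + C\<^sup>2 * (b - a)"
      using ab by (subst integral_add integral_diff, intro int continuous_intros, intro int continuous_intros)+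
        simp
    finally show ?thesis using bound[of q] unfolding J_def by linarith
  qed
  \<comment> \<open>chosen so that \<open>\<delta> \<integral> q\<^sup>2 \<le> (\<epsilon> M)\<^sup>2\<close> if \<open>\<bar>q\<bar> \<le> M\<close>\<close>
  define \<delta> where "\<delta> = \<epsilon>\<^sup>2 / (b - a)"
  have \<delta>: "\<delta> > 0" using ab \<epsilon> by (simp add: \<delta>_def)
  have bdd: "bdd_below (range J)" using J_lower by (intro bdd_belowI2)
  obtain g where g: "J g < Inf (range J) + \<delta>"
    using cInf_lessD[of "range J" "Inf (range J) + \<delta>"] \<delta> by auto
  have J_min: "J g - \<delta> \<le> J q" for q
    using g cInf_lower[OF rangeI bdd, of q] by linarith
  have main: "\<bar>integral {a..b} (\<lambda>t. poly q t * poly g t) - \<Lambda> q\<bar> \<le> \<epsilon> * M"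
    if q: "\<And>t. t \<in> {a..b} \<Longrightarrow> \<bar>poly q t\<bar> \<le> M" and M: "M > 0" for q M
  proof -
    define D where "D = integral {a..b} (\<lambda>t. poly q t * poly g t) - \<Lambda> q"
    define Q where "Q = M\<^sup>2 * (b - a)"
    have Q: "Q > 0" using M ab by (simp add: Q_def)
    have "integral {a..b} (\<lambda>t. (poly q t)\<^sup>2) \<le> integral {a..b} (\<lambda>_. M\<^sup>2)"
    proof (intro integral_le int continuous_intros)
      fix t assume "t \<in> {a..b}"
      thus "(poly q t)\<^sup>2 \<le> M\<^sup>2" using power_mono[OF q, of t 2] by simp
    qed
    hence Q_le: "integral {a..b} (\<lambda>t. (poly q t)\<^sup>2) \<le> Q" using ab by (simp add: Q_def mult.commute)
    have quad: "0 \<le> 2 * s * D + s\<^sup>2 * Q + \<delta>" for s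
    proof -
      have "J (g + smult s q) = integral {a..b} (\<lambda>t. (poly g t)\<^sup>2 + (2 * s) * (poly q t * poly g t) + s\<^sup>2 * (poly q t)\<^sup>2)
          - 2 * (\<Lambda> g + s * \<Lambda> q)"
        unfolding J_def add smult by (simp add: power2_sum power_mult_distrib algebra_simps)
      also have "integral {a..b} (\<lambda>t. (poly g t)\<^sup>2 + (2 * s) * (poly q t * poly g t) + s\<^sup>2 * (poly q t)\<^sup>2)
        = integral {a..b} (\<lambda>t. (poly g t)\<^sup>2) + (2 * s) * integral {a..b} (\<lambda>t. poly q t * poly g t)
          + s\<^sup>2 * integral {a..b} (\<lambda>t. (poly q t)\<^sup>2)"
        by (subst integral_add, intro int continuous_intros, intro int continuous_intros)+ simp
      finally have "J (g + smult s q) = J g + 2 * s * D + s\<^sup>2 * integral {a..b} (\<lambda>t. (poly q t)\<^sup>2)"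
        by (simp add: J_def D_def algebra_simps)
      moreover have "s\<^sup>2 * integral {a..b} (\<lambda>t. (poly q t)\<^sup>2) \<le> s\<^sup>2 * Q"
        using Q_le by (intro mult_left_mono) auto
      ultimately show ?thesis using J_min[of "g + smult s q"] by linarith
    qed
    have "0 \<le> \<delta> - D\<^sup>2 / Q"
      using quad[of "- D / Q"] Q by (simp add: power2_eq_square)
    hence "D\<^sup>2 \<le> \<delta> * Q" using Q by (simp add: field_simps)
    also have "\<delta> * Q = (\<epsilon> * M)\<^sup>2" using ab by (simp add: \<delta>_def Q_def power_mult_distrib)
    finally have "\<bar>D\<bar> \<le> \<bar>\<epsilon> * M\<bar>" by (simp add: abs_le_square_iff)
    thus ?thesis using \<epsilon> M by (simp add: D_def)
  qed
  show thesis
  proof (rule that)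
    fix q M assume q: "\<And>t. t \<in> {a..b} \<Longrightarrow> \<bar>poly q t\<bar> \<le> M"
    have M: "0 \<le> M" using q[of a] ab by force
    have "\<bar>integral {a..b} (\<lambda>t. poly q t * poly g t) - \<Lambda> q\<bar> \<le> \<epsilon> * M + e" if e: "e > 0" for e
    proof -
      have "\<bar>integral {a..b} (\<lambda>t. poly q t * poly g t) - \<Lambda> q\<bar> \<le> \<epsilon> * (M + e / \<epsilon>)"
        using e \<epsilon> M by (intro main) (force intro: order_trans[OF q] add_nonneg_pos)+
      thus ?thesis using \<epsilon> by (simp add: distrib_left)
    qed
    hence "\<bar>integral {a..b} (\<lambda>t. poly q t * poly g t) - \<Lambda> q\<bar> \<le> \<epsilon> * M" by (rule field_le_epsilon)
    thus "\<bar>\<Lambda> q - integral {a..b} (\<lambda>t. poly q t * poly g t)\<bar> \<le> \<epsilon> * M" by (simp add: abs_minus_commute)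
  qed
qed

lemma restricted_poly:
  fixes g :: "real poly" and a b :: real
  shows "integrable lebesgue (\<lambda>t. indicat_real {a..b} t * poly g t)"
    and "(LINT t|lebesgue. poly q t * (indicat_real {a..b} t * poly g t)) = integral {a..b} (\<lambda>t. poly q t * poly g t)"
proof -
  have si: "set_integrable lebesgue {a..b} (\<lambda>t. poly r t)" for r :: "real poly"
    by (rule absolutely_integrable_continuous_real) (intro continuous_intros)
  show "integrable lebesgue (\<lambda>t. indicat_real {a..b} t * poly g t)"
    using si[of g] by (simp add: set_integrable_def)
  have "(LINT t:{a..b}|lebesgue. poly (q * g) t) = integral {a..b} (\<lambda>t. poly (q * g) t)"
    by (rule set_lebesgue_integral_eq_integral[OF si])
  thus "(LINT t|lebesgue. poly q t * (indicat_real {a..b} t * poly g t)) = integral {a..b} (\<lambda>t. poly q t * poly g t)"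
    by (simp add: set_lebesgue_integral_def mult_ac)
qed

text \<open>The approximating densities for \<open>\<epsilon> = 2\<^sup>-\<^sup>n\<close> have increments \<open>f n\<close> with summable \<open>L\<^sup>1\<close>-norms,
  since the dual norm of a density is its \<open>L\<^sup>1\<close>-norm. The function \<open>\<eta>\<close> is the sum of the increments.\<close>

lemma density_of_approximable:
  fixes L :: "real poly \<Rightarrow> real"
  assumes approx: "\<And>\<epsilon>. \<epsilon> > 0 \<Longrightarrow> \<exists>g. \<forall>q M. (\<forall>t\<in>{a..b}. \<bar>poly q t\<bar> \<le> M) \<longrightarrow>
      \<bar>L q - integral {a..b} (\<lambda>t. poly q t * poly g t)\<bar> \<le> \<epsilon> * M"
  obtains \<eta> :: "real \<Rightarrow> real" where "integrable lebesgue \<eta>" "\<And>t. t \<notin> {a..b} \<Longrightarrow> \<eta> t = 0"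
    "\<And>q. L q = (LINT t|lebesgue. poly q t * \<eta> t)"
proof -
  define \<epsilon> where "\<epsilon> n = (1 / 2 :: real) ^ n" for n
  have \<epsilon>: "\<epsilon> n > 0" "\<epsilon> (Suc n) \<le> \<epsilon> n" for n by (simp_all add: \<epsilon>_def)
  have "\<exists>g. \<forall>n q M. (\<forall>t\<in>{a..b}. \<bar>poly q t\<bar> \<le> M) \<longrightarrow>
      \<bar>L q - integral {a..b} (\<lambda>t. poly q t * poly (g n) t)\<bar> \<le> \<epsilon> n * M"
    using approx[OF \<epsilon>(1)] by (intro choice) blast
  then obtain g where g: "\<And>n q M. (\<And>t. t \<in> {a..b} \<Longrightarrow> \<bar>poly q t\<bar> \<le> M) \<Longrightarrow>
      \<bar>L q - integral {a..b} (\<lambda>t. poly q t * poly (g n) t)\<bar> \<le> \<epsilon> n * M"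
    by blast
  define h where "h n = (case n of 0 \<Rightarrow> g 0 | Suc m \<Rightarrow> g (Suc m) - g m)" for n
  have h_sum: "(\<Sum>n\<le>N. h n) = g N" for N
    by (induction N) (simp_all add: h_def)
  define f where "f n t = indicat_real {a..b} t * poly (h n) t" for n t
  have f_int: "integrable lebesgue (f n)" for n unfolding f_def by (rule restricted_poly)
  have f_supp: "f n t = 0" if "t \<notin> {a..b}" for n t using that by (simp add: f_def)
  have qf: "(LINT t|lebesgue. poly q t * f n t) = integral {a..b} (\<lambda>t. poly q t * poly (h n) t)" for q n
    unfolding f_def by (rule restricted_poly)
  have qf_sum: "(\<Sum>n\<le>N. LINT t|lebesgue. poly q t * f n t) = integral {a..b} (\<lambda>t. poly q t * poly (g N) t)" for q N
  proof -
    have "(\<Sum>n\<le>N. LINT t|lebesgue. poly q t * f n t) = integral {a..b} (\<lambda>t. \<Sum>n\<le>N. poly q t * poly (h n) t)"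
      unfolding qf by (intro integral_sum[symmetric] integrable_continuous_real continuous_intros) auto
    thus ?thesis by (simp add: h_sum flip: sum_distrib_left poly_sum)
  qed
  have f_norm: "(LINT t|lebesgue. \<bar>f (Suc n) t\<bar>) \<le> 2 * \<epsilon> n" for n
  proof (rule L1_norm_le_by_polynomials[OF f_int f_supp])
    fix q M assume q: "\<And>t. t \<in> {a..b} \<Longrightarrow> \<bar>poly q t\<bar> \<le> M" and M: "0 \<le> M"
    have "(LINT t|lebesgue. poly q t * f (Suc n) t)
        = integral {a..b} (\<lambda>t. poly q t * poly (g (Suc n)) t) - integral {a..b} (\<lambda>t. poly q t * poly (g n) t)"
      using qf_sum[where N = "Suc n" and q = q] qf_sum[where N = n and q = q] by simp
    moreover have "\<bar>L q - integral {a..b} (\<lambda>t. poly q t * poly (g (Suc n)) t)\<bar> \<le> \<epsilon> (Suc n) * M"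
      and "\<bar>L q - integral {a..b} (\<lambda>t. poly q t * poly (g n) t)\<bar> \<le> \<epsilon> n * M"
      using g[OF q] by auto
    moreover have "\<epsilon> (Suc n) * M \<le> \<epsilon> n * M" using \<epsilon>(2) M by (rule mult_right_mono)
    ultimately show "\<bar>LINT t|lebesgue. poly q t * f (Suc n) t\<bar> \<le> 2 * \<epsilon> n * M" by linarith
  qed
  have f_summable: "summable (\<lambda>n. LINT t|lebesgue. \<bar>f n t\<bar>)"
  proof (subst summable_Suc_iff[symmetric], rule summable_comparison_test'[of "\<lambda>n. 2 * \<epsilon> n" 0])
    show "summable (\<lambda>n. 2 * \<epsilon> n)" unfolding \<epsilon>_def by (intro summable_mult summable_geometric) simp
    show "norm (LINT t|lebesgue. \<bar>f (Suc n) t\<bar>) \<le> 2 * \<epsilon> n" for n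
      using f_norm[of n] by (simp add: Bochner_Integration.integral_nonneg)
  qed
  have AE_summable: "AE t in lebesgue. summable (\<lambda>n. \<bar>f n t\<bar>)"
  proof -
    have "(\<integral>\<^sup>+t. (\<Sum>n. ennreal \<bar>f n t\<bar>) \<partial>lebesgue) = (\<Sum>n. \<integral>\<^sup>+t. ennreal \<bar>f n t\<bar> \<partial>lebesgue)"
      using f_int by (intro nn_integral_suminf) auto
    also have "\<dots> = (\<Sum>n. ennreal (LINT t|lebesgue. \<bar>f n t\<bar>))"
      using f_int by (intro arg_cong[where f = suminf] ext nn_integral_eq_integral) auto
    also have "\<dots> \<noteq> top" using f_summable by (intro ennreal_suminf_neq_top) (auto intro: Bochner_Integration.integral_nonneg)
    finally have "AE t in lebesgue. (\<Sum>n. ennreal \<bar>f n t\<bar>) \<noteq> \<infinity>"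
      using f_int by (intro nn_integral_PInf_AE) auto
    thus ?thesis by eventually_elim (auto intro: summable_suminf_not_top)
  qed
  define \<eta> where "\<eta> t = (\<Sum>n. f n t)" for t
  show thesis
  proof (rule that)
    show "integrable lebesgue \<eta>"
      unfolding \<eta>_def using f_int AE_summable f_summable by (intro integrable_suminf) auto
    show "\<eta> t = 0" if "t \<notin> {a..b}" for t using that by (simp add: \<eta>_def f_supp)
    fix q :: "real poly"
    obtain M where M: "0 \<le> M" "\<And>t. t \<in> {a..b} \<Longrightarrow> \<bar>poly q t\<bar> \<le> M"
      using poly_bounded_on_interval[of a b q] by auto
    have cq: "continuous_on UNIV (\<lambda>t. poly q t)" by (intro continuous_intros)
    have le: "\<bar>poly q t * f n t\<bar> \<le> M * \<bar>f n t\<bar>" for n t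
      using M(2)[of t] f_supp[of t n] by (cases "t \<in> {a..b}") (auto simp: abs_mult intro!: mult_right_mono)
    have int_qf: "integrable lebesgue (\<lambda>t. poly q t * f n t)" for n
      by (rule integrable_mult_continuous(1)[OF f_int f_supp cq M(2)])
    have AE_q: "AE t in lebesgue. summable (\<lambda>n. norm (poly q t * f n t))"
      using AE_summable
    proof eventually_elim
      fix t assume "summable (\<lambda>n. \<bar>f n t\<bar>)"
      hence "summable (\<lambda>n. M * \<bar>f n t\<bar>)" by (rule summable_mult)
      thus "summable (\<lambda>n. norm (poly q t * f n t))"
        by (rule summable_comparison_test'[where N = 0]) (simp only: real_norm_def abs_abs le)
    qed
    have sum_q: "summable (\<lambda>n. LINT t|lebesgue. norm (poly q t * f n t))"
    proof (rule summable_comparison_test'[OF summable_mult[OF f_summable, of M], of 0])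
      fix n :: nat
      have "(LINT t|lebesgue. norm (poly q t * f n t)) \<le> (LINT t|lebesgue. M * \<bar>f n t\<bar>)"
        by (rule integral_mono) (use int_qf f_int le in auto)
      thus "norm (LINT t|lebesgue. norm (poly q t * f n t)) \<le> M * (LINT t|lebesgue. \<bar>f n t\<bar>)"
        by (simp add: Bochner_Integration.integral_nonneg)
    qed
    have "(\<lambda>n. LINT t|lebesgue. poly q t * f n t) sums (LINT t|lebesgue. (\<Sum>n. poly q t * f n t))"
      by (rule sums_integral[OF int_qf AE_q sum_q])
    moreover have "AE t in lebesgue. (\<Sum>n. poly q t * f n t) = poly q t * \<eta> t"
      using AE_summable by eventually_elim (simp add: \<eta>_def suminf_mult summable_rabs_cancel)
    hence "(LINT t|lebesgue. (\<Sum>n. poly q t * f n t)) = (LINT t|lebesgue. poly q t * \<eta> t)"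
    proof (rule integral_cong_AE[rotated 2])
      show "(\<lambda>t. \<Sum>n. poly q t * f n t) \<in> borel_measurable lebesgue"
        using int_qf by (intro borel_measurable_suminf) auto
      have "poly q \<in> borel_measurable lebesgue"
        using cq by (intro measurable_completion) (simp add: borel_measurable_continuous_onI)
      thus "(\<lambda>t. poly q t * \<eta> t) \<in> borel_measurable lebesgue"
        unfolding \<eta>_def using f_int by (intro borel_measurable_times borel_measurable_suminf) auto
    qed
    ultimately have "(\<lambda>N. \<Sum>n\<le>N. LINT t|lebesgue. poly q t * f n t) \<longlonglongrightarrow> (LINT t|lebesgue. poly q t * \<eta> t)"
      by (simp add: sums_def_le)
    hence lim: "(\<lambda>N. integral {a..b} (\<lambda>t. poly q t * poly (g N) t)) \<longlonglongrightarrow> (LINT t|lebesgue. poly q t * \<eta> t)"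
      by (simp add: qf_sum)
    have "(\<lambda>N. L q - integral {a..b} (\<lambda>t. poly q t * poly (g N) t)) \<longlonglongrightarrow> 0"
    proof (rule Lim_null_comparison)
      show "\<forall>\<^sub>F N in sequentially. norm (L q - integral {a..b} (\<lambda>t. poly q t * poly (g N) t)) \<le> \<epsilon> N * M"
        using g[OF M(2)] by simp
      show "(\<lambda>N. \<epsilon> N * M) \<longlonglongrightarrow> 0"
        unfolding \<epsilon>_def by (intro tendsto_mult_left_zero LIMSEQ_power_zero) simp
    qed
    moreover have "(\<lambda>N. L q - integral {a..b} (\<lambda>t. poly q t * poly (g N) t)) \<longlonglongrightarrow> L q - (LINT t|lebesgue. poly q t * \<eta> t)"
      by (intro tendsto_diff tendsto_const lim)
    ultimately have "L q - (LINT t|lebesgue. poly q t * \<eta> t) = 0" using LIMSEQ_unique by blast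
    thus "L q = (LINT t|lebesgue. poly q t * \<eta> t)" by simp
  qed
qed

text \<open>Since \<open>\<integral> \<bar>\<eta>\<bar> \<le> c = \<integral> \<eta>\<close>, the non-negative function \<open>\<bar>\<eta>\<bar> - \<eta>\<close> has integral \<open>0\<close>.\<close>

lemma nonneg_density:
  fixes L :: "real poly \<Rightarrow> real" and \<eta> :: "real \<Rightarrow> real"
  assumes \<eta>: "integrable lebesgue \<eta>" and supp: "\<And>t. t \<notin> {a..b} \<Longrightarrow> \<eta> t = 0"
    and bound: "\<And>q M. (\<And>t. t \<in> {a..b} \<Longrightarrow> \<bar>poly q t\<bar> \<le> M) \<Longrightarrow> 0 \<le> M \<Longrightarrow>
      \<bar>LINT t|lebesgue. poly q t * \<eta> t\<bar> \<le> c * M"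
    and mass: "(LINT t|lebesgue. \<eta> t) = c"
  shows "AE t in lebesgue. \<bar>\<eta> t\<bar> = \<eta> t" and "(LINT t|lebesgue. \<bar>\<eta> t\<bar>) = c"
proof -
  have "(LINT t|lebesgue. \<bar>\<eta> t\<bar>) \<le> c"
    by (rule L1_norm_le_by_polynomials[OF \<eta> supp bound])
  moreover have int: "integrable lebesgue (\<lambda>t. \<bar>\<eta> t\<bar> - \<eta> t)" using \<eta> by simp
  have diff: "(LINT t|lebesgue. \<bar>\<eta> t\<bar> - \<eta> t) = (LINT t|lebesgue. \<bar>\<eta> t\<bar>) - c"
    using \<eta> by (simp add: mass)
  have "0 \<le> (LINT t|lebesgue. \<bar>\<eta> t\<bar> - \<eta> t)" by (rule Bochner_Integration.integral_nonneg) simp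
  ultimately show eq: "(LINT t|lebesgue. \<bar>\<eta> t\<bar>) = c" using diff by linarith
  hence "(LINT t|lebesgue. \<bar>\<eta> t\<bar> - \<eta> t) = 0" using diff by simp
  hence "AE t in lebesgue. \<bar>\<eta> t\<bar> - \<eta> t = 0"
    using integral_nonneg_eq_0_iff_AE[OF int] by simp
  thus "AE t in lebesgue. \<bar>\<eta> t\<bar> = \<eta> t" by eventually_elim simp
qed

lemma density_unique:
  fixes \<eta> \<theta> :: "real \<Rightarrow> real"
  assumes \<eta>: "integrable lebesgue \<eta>" "\<And>t. t \<notin> {a..b} \<Longrightarrow> \<eta> t = 0"
    and \<theta>: "integrable lebesgue \<theta>" "\<And>t. t \<notin> {a..b} \<Longrightarrow> \<theta> t = 0"
    and eq: "\<And>q. (LINT t|lebesgue. poly q t * \<eta> t) = (LINT t|lebesgue. poly q t * \<theta> t)"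
  shows "AE t in lebesgue. \<eta> t = \<theta> t"
proof -
  have int: "integrable lebesgue (\<lambda>t. \<eta> t - \<theta> t)" using \<eta> \<theta> by simp
  have "(LINT t|lebesgue. \<bar>\<eta> t - \<theta> t\<bar>) \<le> 0"
  proof (rule L1_norm_le_by_polynomials[OF int])
    show "\<eta> t - \<theta> t = 0" if "t \<notin> {a..b}" for t using that \<eta> \<theta> by simp
    fix q M assume M: "\<And>t. t \<in> {a..b} \<Longrightarrow> \<bar>poly q t\<bar> \<le> M"
    have cq: "continuous_on UNIV (\<lambda>t. poly q t)" by (intro continuous_intros)
    have "(LINT t|lebesgue. poly q t * (\<eta> t - \<theta> t)) = 0"
      using integrable_mult_continuous(1)[OF \<eta> cq M] integrable_mult_continuous(1)[OF \<theta> cq M] eq[of q]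
      by (simp add: right_diff_distrib)
    thus "\<bar>LINT t|lebesgue. poly q t * (\<eta> t - \<theta> t)\<bar> \<le> 0 * M" by simp
  qed
  moreover have "0 \<le> (LINT t|lebesgue. \<bar>\<eta> t - \<theta> t\<bar>)" by (rule Bochner_Integration.integral_nonneg) simp
  ultimately have "(LINT t|lebesgue. \<bar>\<eta> t - \<theta> t\<bar>) = 0" by simp
  hence "AE t in lebesgue. \<bar>\<eta> t - \<theta> t\<bar> = 0"
    using integral_nonneg_eq_0_iff_AE[of lebesgue "\<lambda>t. \<bar>\<eta> t - \<theta> t\<bar>"] int by simp
  thus ?thesis by eventually_elim simp
qed

section \<open>The spectrum and the numerical range\<close>

text \<open>For \<open>\<bar>t\<bar> > \<parallel>A\<parallel>\<close> the Neumann series inverts \<open>A - t\<close>.\<close>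

lemma op_spectrum_real_bound:
  fixes A :: "'a::chilbert_space bounded_op"
  assumes "complex_of_real t \<in> op_spectrum A"
  shows "\<bar>t\<bar> \<le> norm A"
proof (rule ccontr)
  assume "\<not> \<bar>t\<bar> \<le> norm A"
  hence t: "norm A < \<bar>t\<bar>" "t \<noteq> 0" using norm_ge_zero[of A] by (auto simp del: norm_ge_zero)
  define X where "X = (1 / t) *\<^sub>R A"
  have X: "norm X < 1" using t by (simp add: X_def divide_less_eq)
  have X_pow: "norm (X ^ k) \<le> norm X ^ k" for k
  proof (induction k)
    case 0
    show ?case using norm_op_bound[of 1 "1 :: 'a bounded_op"] by (simp add: one_op_apply)
  next
    case (Suc k)
    have "norm (X ^ Suc k) \<le> norm X * norm (X ^ k)" using norm_mult_ineq[of X "X ^ k"] by simp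
    also have "\<dots> \<le> norm X * norm X ^ k" by (rule mult_left_mono[OF Suc]) simp
    finally show ?case by simp
  qed
  have "summable (\<lambda>k. X ^ k)"
    by (rule summable_norm_cancel, rule summable_comparison_test'[OF summable_geometric[of "norm X"], of 0])
      (use X X_pow in auto)
  then obtain N where N: "(\<lambda>k. X ^ k) sums N" by (auto simp: summable_def)
  have shift: "(\<lambda>k. X ^ Suc k) sums (N - 1)"
    using N by (subst sums_Suc_iff) simp
  have "X * N = N - 1"
    using bounded_linear.sums[OF bounded_linear_mult_right N, of X] shift by (simp add: sums_unique2)
  moreover have "(\<lambda>k. X ^ Suc k) sums (N * X)"
    using bounded_linear.sums[OF bounded_linear_mult_left N, of X] by (simp only: power_Suc2)
  hence "N * X = N - 1" using shift by (rule sums_unique2)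
  moreover have "A - complex_of_real t *\<^sub>C 1 = (- t) *\<^sub>R (1 - X)"
    using t by (simp add: X_def scaleR_scaleC[symmetric] algebra_simps)
  moreover have "N * (1 - X) = 1" "(1 - X) * N = 1"
    using calculation by (simp_all add: left_diff_distrib right_diff_distrib)
  ultimately have "((- 1 / t) *\<^sub>R N) * (A - complex_of_real t *\<^sub>C 1) = 1"
    "(A - complex_of_real t *\<^sub>C 1) * ((- 1 / t) *\<^sub>R N) = 1"
    using t(2) by simp_all
  thus False using assms unfolding op_spectrum_def by blast
qed

text \<open>The infimum \<open>m\<close> of the quadratic form lies in the spectrum: if \<open>A - m\<close> had a bounded inverse,
  then \<open>\<parallel>(A - m)x\<parallel>\<^sup>2 \<le> c \<langle>x, (A - m)x\<rangle>\<close> would bound the form of \<open>A - m\<close> away from \<open>0\<close>.\<close>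

lemma spectrum_form_lower_bound:
  fixes A :: "'a::chilbert_space bounded_op"
  assumes A: "is_adj A A" and z: "(z :: 'a) \<noteq> 0"
  obtains m where "complex_of_real m \<in> op_spectrum A" "\<And>x. m * (norm x)\<^sup>2 \<le> Re (cinner x (A \<bullet>\<^sub>o x))"
proof -
  define S where "S = {Re (cinner x (A \<bullet>\<^sub>o x)) |x. norm x = 1}"
  define m where "m = Inf S"
  have form_le: "\<bar>Re (cinner x (A \<bullet>\<^sub>o x))\<bar> \<le> norm A * (norm x)\<^sup>2" for x
  proof -
    have "\<bar>Re (cinner x (A \<bullet>\<^sub>o x))\<bar> \<le> norm x * (norm A * norm x)"
      by (rule order_trans[OF Re_cinner_le]) (simp add: mult_left_mono norm_op_apply)
    thus ?thesis by (simp add: power2_eq_square mult_ac)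
  qed
  have bdd: "bdd_below S"
  proof (rule bdd_belowI)
    fix r assume "r \<in> S"
    then obtain x where "r = Re (cinner x (A \<bullet>\<^sub>o x))" "norm x = 1" by (auto simp: S_def)
    thus "- norm A \<le> r" using form_le[of x] by simp
  qed
  have unit: "Re (cinner (x /\<^sub>R norm x) (A \<bullet>\<^sub>o (x /\<^sub>R norm x))) = Re (cinner x (A \<bullet>\<^sub>o x)) / (norm x)\<^sup>2" for x
    by (simp add: op_apply_scaleR cinner_scaleR_left cinner_scaleR_right power2_eq_square divide_inverse mult_ac
        flip: of_real_inverse)
  have S_ne: "S \<noteq> {}"
  proof -
    have "norm (z /\<^sub>R norm z) = 1" using z by simp
    thus ?thesis unfolding S_def by blast
  qed
  have lower: "m * (norm x)\<^sup>2 \<le> Re (cinner x (A \<bullet>\<^sub>o x))" for x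
  proof (cases "x = 0")
    case False
    hence "norm (x /\<^sub>R norm x) = 1" by simp
    hence "Re (cinner x (A \<bullet>\<^sub>o x)) / (norm x)\<^sup>2 \<in> S" unfolding S_def using unit[of x, symmetric] by blast
    hence "m \<le> Re (cinner x (A \<bullet>\<^sub>o x)) / (norm x)\<^sup>2" unfolding m_def by (rule cInf_lower[OF _ bdd])
    thus ?thesis using False by (simp add: le_divide_eq)
  qed (simp add: op_apply_zero)
  have "complex_of_real m \<in> op_spectrum A"
  proof (rule ccontr)
    assume "complex_of_real m \<notin> op_spectrum A"
    then obtain B where B: "B * (A - complex_of_real m *\<^sub>C 1) = 1" by (auto simp: op_spectrum_def)
    have Am: "(A - complex_of_real m *\<^sub>C 1) \<bullet>\<^sub>o x = A \<bullet>\<^sub>o x - m *\<^sub>R x" for x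
      by (simp add: op_apply_simps scaleR_scaleC)
    define c where "c = norm A + \<bar>m\<bar> + 1 - m"
    have c: "c > 0" using norm_ge_zero[of A] unfolding c_def by linarith
    have "sa_between m (norm A + \<bar>m\<bar> + 1) A"
      unfolding sa_between_def
    proof (intro conjI allI A lower)
      fix x :: 'a
      have "norm A * (norm x)\<^sup>2 \<le> (norm A + \<bar>m\<bar> + 1) * (norm x)\<^sup>2" by (intro mult_right_mono) auto
      thus "Re (cinner x (A \<bullet>\<^sub>o x)) \<le> (norm A + \<bar>m\<bar> + 1) * (norm x)\<^sup>2" using form_le[of x] by linarith
    qed
    hence sq: "(norm (A \<bullet>\<^sub>o x - m *\<^sub>R x))\<^sup>2 \<le> c * Re (cinner x (A \<bullet>\<^sub>o x - m *\<^sub>R x))" for x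
      using sa_between_shift_square[of m "norm A + \<bar>m\<bar> + 1" A x] c by (simp add: c_def)
    define k where "k = (norm B + 1)\<^sup>2 * c"
    have k: "k > 0" using c norm_ge_zero[of B] unfolding k_def by (intro mult_pos_pos zero_less_power) linarith+
    have "m + 1 / k \<le> r" if r: "r \<in> S" for r
    proof -
      from r obtain x where x: "r = Re (cinner x (A \<bullet>\<^sub>o x))" "norm x = 1" by (auto simp: S_def)
      have "x = B \<bullet>\<^sub>o (A \<bullet>\<^sub>o x - m *\<^sub>R x)" by (metis Am B one_op_apply times_op_apply)
      hence "1 \<le> norm B * norm (A \<bullet>\<^sub>o x - m *\<^sub>R x)" using norm_op_apply x(2) by metis
      also have "\<dots> \<le> (norm B + 1) * norm (A \<bullet>\<^sub>o x - m *\<^sub>R x)" by (intro mult_right_mono) auto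
      finally have "1\<^sup>2 \<le> ((norm B + 1) * norm (A \<bullet>\<^sub>o x - m *\<^sub>R x))\<^sup>2" by (rule power_mono) simp
      also have "\<dots> \<le> (norm B + 1)\<^sup>2 * (c * Re (cinner x (A \<bullet>\<^sub>o x - m *\<^sub>R x)))"
        unfolding power_mult_distrib by (rule mult_left_mono[OF sq]) simp
      also have "Re (cinner x (A \<bullet>\<^sub>o x - m *\<^sub>R x)) = r - m"
        using x by (simp add: cinner_diff_right cinner_scaleR_right Re_cinner_self cinner_self)
      finally have "1 \<le> k * (r - m)" by (simp add: k_def mult.assoc)
      thus ?thesis using k by (simp add: field_simps)
    qed
    hence "m + 1 / k \<le> m" unfolding m_def by (rule cInf_greatest[OF S_ne])
    thus False using k by simp
  qed
  thus thesis using lower that by blast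
qed

lemma spectrum_form_upper_bound:
  fixes A :: "'a::chilbert_space bounded_op"
  assumes A: "is_adj A A" and z: "(z :: 'a) \<noteq> 0"
  obtains m where "complex_of_real m \<in> op_spectrum A" "\<And>x. Re (cinner x (A \<bullet>\<^sub>o x)) \<le> m * (norm x)\<^sup>2"
proof -
  have "is_adj (- A) (- A)" using is_adj_diff[OF is_adj_zero A] by simp
  from spectrum_form_lower_bound[OF this z] obtain m where
    m: "complex_of_real m \<in> op_spectrum (- A)" "\<And>x. m * (norm x)\<^sup>2 \<le> Re (cinner x ((- A) \<bullet>\<^sub>o x))"
    by metis
  have eq: "- A - complex_of_real m *\<^sub>C 1 = - (A - complex_of_real (- m) *\<^sub>C 1)"
    by (simp only: scaleR_scaleC[symmetric]) simp
  have "complex_of_real (- m) \<in> op_spectrum A"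
  proof (rule ccontr)
    assume "complex_of_real (- m) \<notin> op_spectrum A"
    then obtain B where "B * (A - complex_of_real (- m) *\<^sub>C 1) = 1"
      "(A - complex_of_real (- m) *\<^sub>C 1) * B = 1" by (auto simp: op_spectrum_def)
    hence "(- B) * (- A - complex_of_real m *\<^sub>C 1) = 1 \<and> (- A - complex_of_real m *\<^sub>C 1) * (- B) = 1"
      unfolding eq by (simp only: minus_mult_minus simp_thms)
    thus False using m(1) unfolding op_spectrum_def by blast
  qed
  moreover have "Re (cinner x (A \<bullet>\<^sub>o x)) \<le> - m * (norm x)\<^sup>2" for x
    using m(2)[of x] by (simp add: uminus_op_apply cinner_minus_right)
  ultimately show thesis by (rule that)
qed

lemma sa_between_spectrum:
  fixes A :: "'a::chilbert_space bounded_op"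
  assumes A: "is_adj A A" and z: "(z :: 'a) \<noteq> 0"
  defines "S \<equiv> {t. complex_of_real t \<in> op_spectrum A}"
  shows "sa_between (Inf S) (Sup S) A" and "Inf S \<le> Sup S"
proof -
  have bdd: "bdd_below S" "bdd_above S"
    using op_spectrum_real_bound[of _ A] unfolding S_def
    by (auto intro!: bdd_belowI[of _ "- norm A"] bdd_aboveI[of _ "norm A"] simp: abs_le_iff)
      (metis abs_le_iff minus_le_iff)
  obtain l where l: "l \<in> S" "\<And>x. l * (norm x)\<^sup>2 \<le> Re (cinner x (A \<bullet>\<^sub>o x))"
    using spectrum_form_lower_bound[OF A z] unfolding S_def by blast
  obtain u where u: "u \<in> S" "\<And>x. Re (cinner x (A \<bullet>\<^sub>o x)) \<le> u * (norm x)\<^sup>2"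
    using spectrum_form_upper_bound[OF A z] unfolding S_def by blast
  have Inf_le: "Inf S \<le> l" and Sup_ge: "u \<le> Sup S"
    using bdd l(1) u(1) by (auto intro: cInf_lower cSup_upper)
  show "sa_between (Inf S) (Sup S) A"
    unfolding sa_between_def
    using A l(2) u(2) mult_right_mono[OF Inf_le zero_le_power2] mult_right_mono[OF Sup_ge zero_le_power2]
    by (blast intro: order_trans)
  show "Inf S \<le> Sup S"
    using bdd u(1) cInf_lower[OF u(1) bdd(1)] Sup_ge by linarith
qed

lemma sa_between_perturb:
  assumes A: "sa_between a b A" and W: "is_adj W W" "\<And>x. norm (W \<bullet>\<^sub>o x) \<le> c * norm x"
  shows "sa_between (a - c) (b + c) (A + W)"
proof -
  have "\<bar>Re (cinner x (W \<bullet>\<^sub>o x))\<bar> \<le> c * (norm x)\<^sup>2" for x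
  proof -
    have "\<bar>Re (cinner x (W \<bullet>\<^sub>o x))\<bar> \<le> norm x * (c * norm x)"
      by (rule order_trans[OF Re_cinner_le]) (simp add: mult_left_mono W)
    thus ?thesis by (simp add: power2_eq_square mult_ac)
  qed
  hence "- (c * (norm x)\<^sup>2) \<le> Re (cinner x (W \<bullet>\<^sub>o x))" "Re (cinner x (W \<bullet>\<^sub>o x)) \<le> c * (norm x)\<^sup>2" for x
    by (simp_all add: abs_le_iff) (smt (verit))
  moreover have "a * (norm x)\<^sup>2 \<le> Re (cinner x (A \<bullet>\<^sub>o x))" "Re (cinner x (A \<bullet>\<^sub>o x)) \<le> b * (norm x)\<^sup>2" for x
    using A by (simp_all add: sa_between_def)
  ultimately have "(a - c) * (norm x)\<^sup>2 \<le> Re (cinner x ((A + W) \<bullet>\<^sub>o x))"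
    "Re (cinner x ((A + W) \<bullet>\<^sub>o x)) \<le> (b + c) * (norm x)\<^sup>2" for x
    unfolding plus_op_apply cinner_add_right plus_complex.sel left_diff_distrib distrib_right
    by (smt (verit))+
  thus ?thesis using is_adj_add[OF sa_between_adj[OF A] W(1)] by (simp add: sa_between_def)
qed

lemma infinite_dim_nonzero:
  assumes "infinite_dim TYPE('a::chilbert_space)"
  obtains z :: "'a::chilbert_space" where "z \<noteq> 0"
proof -
  interpret vector_space "scaleC :: complex \<Rightarrow> 'a \<Rightarrow> 'a" by (rule vector_space_scaleC)
  have "cspan {} \<noteq> (UNIV :: 'a set)" using assms unfolding infinite_dim_def by blast
  thus thesis using that unfolding span_empty by blast
qed


section \<open>Approximation by operators of finite rank\<close>

context onb
begin

lemma finite_projection: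
  assumes F: "finite F" "F \<subseteq> E"
  obtains P where "is_adj P P" "\<And>x. norm (P \<bullet>\<^sub>o x) \<le> norm x"
    "\<And>e. e \<in> F \<Longrightarrow> P \<bullet>\<^sub>o e = e" "\<And>e. e \<in> E - F \<Longrightarrow> P \<bullet>\<^sub>o e = 0"
proof -
  define f where "f x = (\<Sum>e\<in>F. cinner e x *\<^sub>C e)" for x
  have lin: "bounded_linear f"
  proof -
    have "bounded_linear (\<lambda>x. cinner e x *\<^sub>C e)" for e :: 'a
    proof (rule bounded_linear_intro[where K = "norm e * norm e"])
      show "cinner e (x + y) *\<^sub>C e = cinner e x *\<^sub>C e + cinner e y *\<^sub>C e" for x y
        by (simp add: cinner_add_right scaleC_add_left)
      show "cinner e (r *\<^sub>R x) *\<^sub>C e = r *\<^sub>R cinner e x *\<^sub>C e" for r x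
        by (simp only: cinner_scaleR_right) (simp only: scaleR_scaleC scaleC_scaleC)
      show "norm (cinner e x *\<^sub>C e) \<le> norm x * (norm e * norm e)" for x
        using mult_right_mono[OF Cauchy_Schwarz_cinner[of e x] norm_ge_zero[of e]]
        by (simp add: norm_scaleC mult_ac)
    qed
    thus ?thesis unfolding f_def by (intro bounded_linear_sum)
  qed
  have "f (c *\<^sub>C x) = c *\<^sub>C f x" for c x
  proof -
    interpret vector_space "scaleC :: complex \<Rightarrow> 'a \<Rightarrow> 'a" by (rule vector_space_scaleC)
    show ?thesis by (simp add: f_def cinner_scaleC_right scale_sum_right scaleC_scaleC)
  qed
  hence mem: "Blinfun f \<in> {A. \<forall>c x. blinfun_apply A (c *\<^sub>C x) = c *\<^sub>C blinfun_apply A x}"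
    by (simp add: bounded_linear_Blinfun_apply lin)
  define P where "P = Abs_bounded_op (Blinfun f)"
  have P: "P \<bullet>\<^sub>o x = f x" for x
    by (simp add: P_def op_apply.rep_eq Abs_bounded_op_inverse[OF mem] bounded_linear_Blinfun_apply lin)
  have ef: "cinner e e' = (if e = e' then 1 else 0)" if "e \<in> F" "e' \<in> E" for e e'
    using that F onb_cinner by auto
  have z: "0 *\<^sub>C e = 0" for e :: 'a using scaleR_scaleC[of 0 e] by simp
  have adj: "is_adj P P"
    unfolding is_adj_def P f_def cinner_sum_left cinner_sum_right cinner_scaleC_left cinner_scaleC_right
    by (auto intro!: sum.cong simp: mult.commute cinner_commute[symmetric])
  have Pe: "P \<bullet>\<^sub>o e = e" if "e \<in> F" for e
  proof -
    have "P \<bullet>\<^sub>o e = (\<Sum>e'\<in>F. if e' = e then e else 0)"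
      unfolding P f_def by (rule sum.cong) (use that F in \<open>auto simp: ef subset_iff z scaleC_one\<close>)
    thus ?thesis using F(1) that by simp
  qed
  have P0: "P \<bullet>\<^sub>o e = 0" if "e \<in> E - F" for e
    unfolding P f_def by (rule sum.neutral) (use that in \<open>auto simp: ef z\<close>)
  have idem: "P \<bullet>\<^sub>o (P \<bullet>\<^sub>o x) = P \<bullet>\<^sub>o x" for x
  proof -
    have "P \<bullet>\<^sub>o (P \<bullet>\<^sub>o x) = (\<Sum>e\<in>F. cinner e x *\<^sub>C (P \<bullet>\<^sub>o e))"
      by (subst (2) P) (simp add: f_def op_apply_sum op_apply_scaleC)
    also have "\<dots> = P \<bullet>\<^sub>o x" unfolding P[of x] f_def by (rule sum.cong) (simp_all add: Pe)
    finally show ?thesis .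
  qed
  have "norm (P \<bullet>\<^sub>o x) \<le> norm x" for x
  proof (cases "P \<bullet>\<^sub>o x = 0")
    case False
    have "(norm (P \<bullet>\<^sub>o x))\<^sup>2 = Re (cinner x (P \<bullet>\<^sub>o x))"
      by (simp add: Re_cinner_self[symmetric] is_adjD[OF adj] idem)
    also have "\<dots> \<le> norm x * norm (P \<bullet>\<^sub>o x)" by (rule abs_le_D1[OF Re_cinner_le])
    finally show ?thesis using False by (simp add: power2_eq_square)
  qed simp
  thus thesis using that adj Pe P0 by blast
qed

text \<open>The compression \<open>P V P\<close> to the span of finitely many basis vectors is self-adjoint and does not
  increase the operator norm. The error is the sum of \<open>(1 - P) V = (V (1 - P))\<^sup>*\<close> and of
  \<open>P V (1 - P)\<close>, and \<open>V (1 - P)\<close> is the tail of \<open>V\<close> on the remaining basis vectors.\<close>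

lemma finite_rank_approximation:
  assumes V: "is_adj V V" "V \<in> HS" and d: "d > 0"
  obtains F W where "finite F" "F \<subseteq> E" "is_adj W W" "W \<in> HS" "\<And>x. norm (W \<bullet>\<^sub>o x) \<le> norm V * norm x"
    "\<And>e. e \<in> E - F \<Longrightarrow> W \<bullet>\<^sub>o e = 0" "hip W W \<le> hip V V" "hip (V - W) (V - W) \<le> d\<^sup>2"
proof -
  have V_sum: "((\<lambda>e. (norm (V \<bullet>\<^sub>o e))\<^sup>2) has_sum hip V V) E"
    using hip_has_sum[OF V(2) V(2)] by (simp add: Re_cinner_self)
  from has_sum_finite_approximation[OF V_sum, of "d\<^sup>2 / 4"] d
  obtain F where F: "finite F" "F \<subseteq> E" "dist (\<Sum>e\<in>F. (norm (V \<bullet>\<^sub>o e))\<^sup>2) (hip V V) \<le> d\<^sup>2 / 4"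
    by auto
  obtain P where P: "is_adj P P" "\<And>x. norm (P \<bullet>\<^sub>o x) \<le> norm x"
    "\<And>e. e \<in> F \<Longrightarrow> P \<bullet>\<^sub>o e = e" "\<And>e. e \<in> E - F \<Longrightarrow> P \<bullet>\<^sub>o e = 0"
    using finite_projection[OF F(1,2)] by metis
  define W where "W = P * V * P"
  note PV = HS_mult_left[OF P(1) V(2)] and VP = HS_mult_right[OF P(1) V(2)]
  have W_HS: "W \<in> HS" unfolding W_def by (rule HS_mult_right[OF P(1) PV])
  define Z where "Z = V - V * P"
  have Z: "Z \<in> HS" unfolding Z_def by (rule HS_diff[OF V(2) VP])
  have Z_adj: "is_adj Z (V - P * V)"
    unfolding Z_def by (intro is_adj_diff is_adj_mult V P)
  have ZZ: "hip Z Z \<le> d\<^sup>2 / 4"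
  proof -
    have "((\<lambda>e. (norm (V \<bullet>\<^sub>o e))\<^sup>2) has_sum (hip V V - (\<Sum>e\<in>F. (norm (V \<bullet>\<^sub>o e))\<^sup>2))) (E - F)"
      by (rule has_sum_Diff[OF V_sum _ F(2)]) (use F(1) in simp)
    hence "hip V V - (\<Sum>e\<in>F. (norm (V \<bullet>\<^sub>o e))\<^sup>2) = (\<Sum>\<^sub>\<infinity>e\<in>E - F. (norm (V \<bullet>\<^sub>o e))\<^sup>2)"
      by (simp add: infsumI)
    also have "\<dots> = hip Z Z"
      unfolding hip_self using F(2)
      by (intro infsum_cong_neutral) (auto simp: Z_def op_apply_simps P(3,4))
    finally show ?thesis using F(3) unfolding dist_real_def by linarith
  qed
  define X where "X = V - P * V"
  define Y where "Y = P * Z"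
  have X: "X \<in> HS" unfolding X_def by (rule HS_diff[OF V(2) PV])
  have Y: "Y \<in> HS" unfolding Y_def by (rule HS_mult_left[OF P(1) Z])
  have XX: "hip X X \<le> d\<^sup>2 / 4"
    using hip_adj[OF Z_adj Z_adj Z Z] ZZ by (simp add: X_def)
  have YY: "hip Y Y \<le> d\<^sup>2 / 4"
    using hip_mult_left_le[OF P(1) Z, of 1] P(2) ZZ unfolding Y_def by simp
  have "V - W = X + Y" by (simp add: X_def Y_def Z_def W_def algebra_simps)
  moreover have "hip (X + Y) (X + Y) \<le> 2 * hip X X + 2 * hip Y Y"
  proof -
    have "\<bar>hip X Y\<bar> \<le> sqrt (hip X X) * sqrt (hip Y Y)" by (rule hip_Cauchy_Schwarz[OF X Y])
    moreover have "2 * (sqrt (hip X X) * sqrt (hip Y Y)) \<le> hip X X + hip Y Y"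
      using sum_squares_bound[of "sqrt (hip X X)" "sqrt (hip Y Y)"] by (simp add: hip_nonneg)
    ultimately show ?thesis
      using X Y by (simp add: hip_add_left hip_add_right HS_add hip_commute[of Y X])
  qed
  ultimately have VW: "hip (V - W) (V - W) \<le> d\<^sup>2" using XX YY by simp
  have W_le: "norm (W \<bullet>\<^sub>o x) \<le> norm V * norm x" for x
  proof -
    have "norm (W \<bullet>\<^sub>o x) \<le> norm (V \<bullet>\<^sub>o P \<bullet>\<^sub>o x)" unfolding W_def times_op_apply by (rule P(2))
    also have "\<dots> \<le> norm V * norm x"
      by (rule order_trans[OF norm_op_apply]) (simp add: mult_left_mono P(2))
    finally show ?thesis .
  qed
  have WW: "hip W W \<le> hip V V"
  proof -
    have "hip W W \<le> 1\<^sup>2 * hip (P * V) (P * V)"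
      unfolding W_def by (rule hip_mult_right_le[OF P(1) _ _ PV]) (simp_all add: P(2))
    also have "hip (P * V) (P * V) \<le> 1\<^sup>2 * hip V V"
      by (rule hip_mult_left_le[OF P(1) V(2)]) (simp_all add: P(2))
    finally show ?thesis by simp
  qed
  have W_adj: "is_adj W W"
    unfolding W_def using is_adj_mult[OF is_adj_mult[OF P(1) V(1)] P(1)] by (simp add: mult.assoc)
  show thesis
    by (rule that[OF F(1,2) W_adj W_HS W_le _ WW VW]) (simp_all add: W_def op_apply_simps P(4))
qed


section \<open>The trace functional and its density\<close>

lemma trace_remainder_eq:
  assumes "degree p \<le> n"
  shows "trace_remainder p A B = (\<Sum>k\<le>n. coeff p k * rtr (power_remainder k A B))"
  unfolding trace_remainder_def using assms
  by (intro sum.mono_neutral_left) (auto simp: coeff_eq_0)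

lemma trace_remainder_add: "trace_remainder (p + q) A B = trace_remainder p A B + trace_remainder q A B"
proof -
  define n where "n = max (degree p) (degree q)"
  have "degree (p + q) \<le> n" "degree p \<le> n" "degree q \<le> n"
    by (simp_all add: n_def degree_add_le_max)
  thus ?thesis by (simp add: trace_remainder_eq distrib_right sum.distrib)
qed

lemma trace_remainder_smult: "trace_remainder (smult c p) A B = c * trace_remainder p A B"
  by (subst trace_remainder_eq[of _ "degree p"])
    (simp_all add: trace_remainder_def sum_distrib_left mult.assoc)

lemma trace_remainder_monom: "trace_remainder (monom c k) A B = c * rtr (power_remainder k A B)"
proof -
  have "trace_remainder (monom c k) A B = (\<Sum>j\<le>k. coeff (monom c k) j * rtr (power_remainder j A B))"
    by (rule trace_remainder_eq[OF degree_monom_le])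
  also have "\<dots> = (\<Sum>j\<le>k. if j = k then c * rtr (power_remainder j A B) else 0)"
    by (rule sum.cong) auto
  finally show ?thesis by simp
qed

end

lemma pderiv_sum: "pderiv (\<Sum>i\<in>I. f i) = (\<Sum>i\<in>I. pderiv (f i))"
  by (induction I rule: infinite_finite_induct) (simp_all add: pderiv_add)

lemma poly_antiderivative: "\<exists>p :: real poly. pderiv p = q \<and> poly p a = 0"
proof -
  define r where "r = (\<Sum>k\<le>degree q. monom (coeff q k / real (Suc k)) (Suc k))"
  have "pderiv r = (\<Sum>k\<le>degree q. monom (coeff q k) k)"
    unfolding r_def pderiv_sum pderiv_monom
    by (rule sum.cong) (simp_all add: field_simps del: of_nat_Suc)
  hence r: "pderiv r = q" by (simp add: poly_as_sum_of_monoms)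
  have "pderiv (r - [:poly r a:]) = q \<and> poly (r - [:poly r a:]) a = 0"
    by (simp add: pderiv_diff pderiv_pCons r)
  thus ?thesis by blast
qed

lemma poly_bound_by_derivative_integral:
  fixes r :: "real poly"
  assumes r: "poly r a = 0" and t: "a \<le> t" "t \<le> b"
  shows "\<bar>poly r t\<bar> \<le> integral {a..b} (\<lambda>t. \<bar>poly (pderiv r) t\<bar>)"
proof -
  have int: "f integrable_on {c..d}" if "continuous_on {c..d} f" for f :: "real \<Rightarrow> real" and c d
    using that by (rule integrable_continuous_real)
  have "((\<lambda>t. poly (pderiv r) t) has_integral (poly r t - poly r a)) {a..t}"
    using t(1) by (intro fundamental_theorem_of_calculus)
      (auto intro!: poly_DERIV[THEN DERIV_subset] simp flip: has_real_derivative_iff_has_vector_derivative)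
  hence "poly r t = integral {a..t} (\<lambda>t. poly (pderiv r) t)"
    using r by (simp add: integral_unique)
  also have "\<bar>\<dots>\<bar> \<le> integral {a..t} (\<lambda>t. \<bar>poly (pderiv r) t\<bar>)"
    unfolding real_norm_def[symmetric]
    by (intro integral_norm_bound_integral int continuous_intros) auto
  also have "\<dots> \<le> integral {a..b} (\<lambda>t. \<bar>poly (pderiv r) t\<bar>)"
    using t by (intro integral_subset_le int continuous_intros) auto
  finally show ?thesis .
qed

definition double_antiderivative :: "real poly \<Rightarrow> real poly"
  where "double_antiderivative q = (SOME p. pderiv (pderiv p) = q)"

lemma double_antiderivative: "pderiv (pderiv (double_antiderivative q)) = q"
proof -
  have "\<exists>p. pderiv (pderiv p) = q" using poly_antiderivative[of _ 0] by metis
  thus ?thesis unfolding double_antiderivative_def by (rule someI_ex)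
qed

context onb
begin

text \<open>The remainder as a functional of \<open>p''\<close>. It is well defined, as the remainder vanishes if
  \<open>p'' = 0\<close>; this is \<open>trace_functional_eq\<close> below.\<close>

definition trace_functional :: "'a bounded_op \<Rightarrow> 'a bounded_op \<Rightarrow> real poly \<Rightarrow> real"
  where "trace_functional A B q = trace_remainder (double_antiderivative q) A B"

context
  fixes a b :: real and A B :: "'a bounded_op"
  assumes A: "sa_between a b A" and B: "sa_between a b B" and ab: "a < b" and D: "B - A \<in> HS"
begin

lemma trace_functional_bound:
  "(\<And>t. t \<in> {a..b} \<Longrightarrow> \<bar>poly q t\<bar> \<le> M) \<Longrightarrow> \<bar>trace_functional A B q\<bar> \<le> M * hip (B - A) (B - A) / 2"
  unfolding trace_functional_def
  by (rule trace_remainder_bound[OF A B ab D]) (simp add: double_antiderivative)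

lemma trace_functional_eq: "trace_functional A B (pderiv (pderiv p)) = trace_remainder p A B"
proof -
  define r where "r = double_antiderivative (pderiv (pderiv p)) + smult (- 1) p"
  have "pderiv (pderiv r) = 0"
    by (simp only: r_def pderiv_add pderiv_smult double_antiderivative) simp
  hence "\<bar>trace_remainder r A B\<bar> \<le> 0 * hip (B - A) (B - A) / 2"
    by (intro trace_remainder_bound[OF A B ab D]) simp
  thus ?thesis by (simp add: r_def trace_remainder_add trace_remainder_smult trace_functional_def
    del: smult_minus_left)
qed

lemma trace_functional_add: "trace_functional A B (p + q) = trace_functional A B p + trace_functional A B q"
proof -
  have "p + q = pderiv (pderiv (double_antiderivative p + double_antiderivative q))"
    by (simp add: pderiv_add double_antiderivative)
  thus ?thesis by (metis trace_functional_def trace_functional_eq trace_remainder_add)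
qed

lemma trace_functional_smult: "trace_functional A B (smult c q) = c * trace_functional A B q"
proof -
  have "smult c q = pderiv (pderiv (smult c (double_antiderivative q)))"
    by (simp add: pderiv_smult double_antiderivative)
  thus ?thesis by (metis trace_functional_def trace_functional_eq trace_remainder_smult)
qed

text \<open>For a perturbation of finite rank the remainder is controlled by the supremum of \<open>p'\<close>, and so
  by the \<open>L\<^sup>1\<close>-norm of \<open>p''\<close> after normalizing \<open>p'(a) = 0\<close>.\<close>

lemma trace_functional_finite_rank_bound:
  assumes F: "finite F" "F \<subseteq> E" "\<And>e. e \<in> E - F \<Longrightarrow> (B - A) \<bullet>\<^sub>o e = 0"
  shows "\<bar>trace_functional A B q\<bar>
    \<le> 2 * (\<Sum>e\<in>F. norm ((B - A) \<bullet>\<^sub>o e)) * integral {a..b} (\<lambda>t. \<bar>poly q t\<bar>)"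
proof -
  obtain r where r: "pderiv r = q" "poly r a = 0" using poly_antiderivative by metis
  obtain p where p: "pderiv p = r" using poly_antiderivative by metis
  have "\<bar>trace_remainder p A B\<bar>
      \<le> 2 * (\<Sum>e\<in>F. norm ((B - A) \<bullet>\<^sub>o e)) * integral {a..b} (\<lambda>t. \<bar>poly (pderiv r) t\<bar>)"
    by (rule trace_remainder_finite_rank_bound[OF A B ab D F])
      (simp_all add: p poly_bound_by_derivative_integral[OF r(2)])
  thus ?thesis using trace_functional_eq[of p] by (simp add: p r)
qed

end

text \<open>The functional is a limit of those for perturbations \<open>W\<close> of finite rank with
  \<open>\<parallel>W\<parallel> \<le> \<parallel>V\<parallel>\<close>, which keeps all operators between \<open>a\<close> and \<open>b\<close>.\<close>

lemma trace_functional_density: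
  assumes A: "sa_between c c' A" and V: "is_adj V V" "V \<in> HS" and ab: "a < b"
    and a: "a = c - norm V" and b: "b = c' + norm V"
  obtains \<eta> :: "real \<Rightarrow> real" where "integrable lebesgue \<eta>" "\<And>t. t \<notin> {a..b} \<Longrightarrow> \<eta> t = 0" "\<And>t. 0 \<le> \<eta> t"
    "\<And>p. trace_remainder p A (A + V) = (LINT t|lebesgue. poly (pderiv (pderiv p)) t * \<eta> t)"
    "(LINT t|lebesgue. \<eta> t) = hip V V / 2"
proof -
  have A': "sa_between a b A"
    using sa_between_perturb[OF A is_adj_zero, of "norm V"] by (simp add: a b zero_op_apply)
  have pert: "sa_between a b (A + W)" if "is_adj W W" "\<And>x. norm (W \<bullet>\<^sub>o x) \<le> norm V * norm x" for W
    unfolding a b by (rule sa_between_perturb[OF A that])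
  have AV: "sa_between a b (A + V)" by (rule pert[OF V(1) norm_op_apply])
  have V_HS: "A + V - A \<in> HS" using V by simp
  define v where "v = sqrt (hip V V)"
  have v: "0 \<le> v" by (simp add: v_def hip_nonneg)
  have "\<exists>g. \<forall>q M. (\<forall>t\<in>{a..b}. \<bar>poly q t\<bar> \<le> M) \<longrightarrow>
      \<bar>trace_functional A (A + V) q - integral {a..b} (\<lambda>t. poly q t * poly g t)\<bar> \<le> \<epsilon> * M"
    if \<epsilon>: "\<epsilon> > 0" for \<epsilon>
  proof -
    \<comment> \<open>makes the bound \<open>d\<^sup>2/2 + d v\<close> for the change of the functional at most \<open>\<epsilon>/2\<close>\<close>
    define d where "d = min 1 (\<epsilon> / (2 * (1 + v)))"
    have d: "d > 0" "d \<le> 1" "d * (1 + v) \<le> \<epsilon> / 2"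
    proof -
      show "d > 0" "d \<le> 1" using \<epsilon> v by (simp_all add: d_def)
      have "d * (1 + v) \<le> \<epsilon> / (2 * (1 + v)) * (1 + v)"
        using v by (intro mult_right_mono) (simp_all add: d_def)
      also have "\<dots> = \<epsilon> / 2" using v by (simp add: field_simps)
      finally show "d * (1 + v) \<le> \<epsilon> / 2" .
    qed
    obtain F W where F: "finite F" "F \<subseteq> E" and W: "is_adj W W" "W \<in> HS" "\<And>x. norm (W \<bullet>\<^sub>o x) \<le> norm V * norm x"
      "\<And>e. e \<in> E - F \<Longrightarrow> W \<bullet>\<^sub>o e = 0" "hip W W \<le> hip V V" "hip (V - W) (V - W) \<le> d\<^sup>2"
      using finite_rank_approximation[OF V d(1)] by metis
    have AW: "sa_between a b (A + W)" by (rule pert[OF W(1,3)])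
    have W_HS: "A + W - A \<in> HS" using W by simp
    have VW_HS: "(A + V) - (A + W) \<in> HS" using HS_diff[OF V(2) W(2)] by simp
    have close: "\<bar>trace_functional A (A + V) q - trace_functional A (A + W) q\<bar> \<le> \<epsilon> / 2 * M"
      if q: "\<And>t. t \<in> {a..b} \<Longrightarrow> \<bar>poly q t\<bar> \<le> M" for q M
    proof -
      have M: "0 \<le> M" using q[of a] ab by force
      have "\<bar>trace_functional A (A + V) q - trace_functional A (A + W) q\<bar>
          \<le> M * (hip (A + V - (A + W)) (A + V - (A + W)) / 2
            + sqrt (hip (A + V - (A + W)) (A + V - (A + W))) * sqrt (hip (A + W - A) (A + W - A)))"
        unfolding trace_functional_def
        by (rule trace_remainder_diff_bound[OF A' AW AV ab W_HS VW_HS]) (simp add: double_antiderivative q)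
      also have "\<dots> = M * (hip (V - W) (V - W) / 2 + sqrt (hip (V - W) (V - W)) * sqrt (hip W W))"
        by simp
      also have "\<dots> \<le> M * (d\<^sup>2 / 2 + d * v)"
      proof (intro mult_left_mono add_mono mult_mono M)
        show "sqrt (hip (V - W) (V - W)) \<le> d"
          using real_sqrt_le_mono[OF W(6)] d(1) by simp
        show "sqrt (hip W W) \<le> v" unfolding v_def by (rule real_sqrt_le_mono[OF W(5)])
      qed (use W(6) d(1) in \<open>simp_all add: hip_nonneg\<close>)
      also have "\<dots> \<le> M * (d * (1 + v))"
      proof (rule mult_left_mono[OF _ M])
        have "d\<^sup>2 \<le> d" using d mult_left_mono[of d 1 d] by (simp add: power2_eq_square)
        thus "d\<^sup>2 / 2 + d * v \<le> d * (1 + v)" using d(1) unfolding distrib_left by linarith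
      qed
      also have "\<dots> \<le> \<epsilon> / 2 * M" using mult_left_mono[OF d(3) M] by (simp add: mult.commute)
      finally show ?thesis .
    qed
    have fr: "\<bar>trace_functional A (A + W) q\<bar>
        \<le> 2 * (\<Sum>e\<in>F. norm ((A + W - A) \<bullet>\<^sub>o e)) * integral {a..b} (\<lambda>t. \<bar>poly q t\<bar>)" for q
      by (rule trace_functional_finite_rank_bound[OF A' AW ab W_HS F]) (simp add: W(4))
    obtain g where g: "\<And>q M. (\<And>t. t \<in> {a..b} \<Longrightarrow> \<bar>poly q t\<bar> \<le> M) \<Longrightarrow>
        \<bar>trace_functional A (A + W) q - integral {a..b} (\<lambda>t. poly q t * poly g t)\<bar> \<le> \<epsilon> / 2 * M"
    proof (rule approximate_riesz[OF ab trace_functional_add[OF A' AW ab W_HS]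
          trace_functional_smult[OF A' AW ab W_HS] fr half_gt_zero[OF \<epsilon>]])
      fix g assume "\<And>q M. (\<And>t. t \<in> {a..b} \<Longrightarrow> \<bar>poly q t\<bar> \<le> M) \<Longrightarrow>
        \<bar>trace_functional A (A + W) q - integral {a..b} (\<lambda>t. poly q t * poly g t)\<bar> \<le> \<epsilon> / 2 * M"
      thus thesis by (rule that)
    qed
    show ?thesis
    proof (intro exI[of _ g] allI impI)
      fix q M assume "\<forall>t\<in>{a..b}. \<bar>poly q t\<bar> \<le> M"
      hence q: "\<And>t. t \<in> {a..b} \<Longrightarrow> \<bar>poly q t\<bar> \<le> M" by blast
      show "\<bar>trace_functional A (A + V) q - integral {a..b} (\<lambda>t. poly q t * poly g t)\<bar> \<le> \<epsilon> * M"
        using close[OF q] g[OF q] by linarith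
    qed
  qed
  then obtain \<eta> :: "real \<Rightarrow> real" where \<eta>: "integrable lebesgue \<eta>" "\<And>t. t \<notin> {a..b} \<Longrightarrow> \<eta> t = 0"
    "\<And>q. trace_functional A (A + V) q = (LINT t|lebesgue. poly q t * \<eta> t)"
    using density_of_approximable[of a b "trace_functional A (A + V)"] by blast
  have mass: "(LINT t|lebesgue. \<eta> t) = hip V V / 2"
  proof -
    have "pderiv (pderiv (monom (1 / 2 :: real) 2)) = 1" by (simp add: pderiv_monom monom_eq_1)
    hence "trace_functional A (A + V) 1 = trace_remainder (monom (1 / 2) 2) A (A + V)"
      using trace_functional_eq[OF A' AV ab V_HS, of "monom (1 / 2) 2"] by simp
    also have "\<dots> = hip V V / 2"
      using trace_remainder_square[OF sa_between_adj[OF A'] sa_between_adj[OF AV] V_HS]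
      by (simp add: trace_remainder_monom)
    finally show ?thesis using \<eta>(3)[of 1] by simp
  qed
  have bound: "\<bar>LINT t|lebesgue. poly q t * \<eta> t\<bar> \<le> hip V V / 2 * M"
    if "\<And>t. t \<in> {a..b} \<Longrightarrow> \<bar>poly q t\<bar> \<le> M" for q M
    using trace_functional_bound[OF A' AV ab V_HS that] \<eta>(3)[of q] by (simp add: mult.commute)
  have AE: "AE t in lebesgue. \<bar>\<eta> t\<bar> = \<eta> t" and abs: "(LINT t|lebesgue. \<bar>\<eta> t\<bar>) = hip V V / 2"
    using nonneg_density[OF \<eta>(1,2) bound mass] by auto
  have "(LINT t|lebesgue. poly q t * \<bar>\<eta> t\<bar>) = (LINT t|lebesgue. poly q t * \<eta> t)" for q
  proof (rule integral_cong_AE)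
    have "poly q \<in> borel_measurable lebesgue"
      by (intro measurable_completion) (simp add: borel_measurable_continuous_onI continuous_intros)
    thus "(\<lambda>t. poly q t * \<bar>\<eta> t\<bar>) \<in> borel_measurable lebesgue" "(\<lambda>t. poly q t * \<eta> t) \<in> borel_measurable lebesgue"
      using \<eta>(1) by auto
    show "AE t in lebesgue. poly q t * \<bar>\<eta> t\<bar> = poly q t * \<eta> t" using AE by eventually_elim simp
  qed
  hence "trace_remainder p A (A + V) = (LINT t|lebesgue. poly (pderiv (pderiv p)) t * \<bar>\<eta> t\<bar>)" for p
    using \<eta>(3)[of "pderiv (pderiv p)"] trace_functional_eq[OF A' AV ab V_HS, of p] by simp
  thus thesis using that[of "\<lambda>t. \<bar>\<eta> t\<bar>"] \<eta>(1,2) abs by simp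
qed

lemma trace_combination_has_sum:
  assumes "finite K" "\<And>k. k \<in> K \<Longrightarrow> T k \<in> TC" "\<And>k. k \<in> K \<Longrightarrow> is_adj (T k) (T k)"
  shows "((\<lambda>e. cinner e ((\<Sum>k\<in>K. c k *\<^sub>C T k) \<bullet>\<^sub>o e)) has_sum (\<Sum>k\<in>K. c k * complex_of_real (rtr (T k)))) E"
  using assms
proof (induction K rule: finite_induct)
  case (insert k K)
  have eq: "(\<lambda>e. cinner e (T k \<bullet>\<^sub>o e)) = (\<lambda>e. complex_of_real (Re (cinner e (T k \<bullet>\<^sub>o e))))"
    by (rule ext, rule is_adj_real) (simp add: insert.prems)
  have "((\<lambda>e. cinner e (T k \<bullet>\<^sub>o e)) has_sum complex_of_real (rtr (T k))) E"
    unfolding eq by (rule has_sum_of_real[OF rtr_has_sum]) (simp add: insert.prems)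
  from has_sum_add[OF has_sum_cmult_right[OF this, of "c k"] insert.IH] show ?case
    using insert by (simp add: plus_op_apply cinner_add_right scaleC_op_apply cinner_scaleC_right)
qed (simp add: zero_op_apply)

end


section \<open>The spectral shift function\<close>

lemma sum_coeff_monom:
  fixes f :: "nat \<Rightarrow> 'a::comm_ring_1"
  shows "(\<Sum>j\<le>degree (monom (1 :: 'a) k). coeff (monom 1 k) j * f j) = f k"
proof -
  have "(\<Sum>j\<le>k. coeff (monom (1 :: 'a) k) j * f j) = (\<Sum>j\<le>k. if j = k then f j else 0)"
    by (rule sum.cong) auto
  thus ?thesis by (simp add: degree_monom_eq)
qed

lemma pderiv2_monom: "poly (pderiv (pderiv (monom c k))) z = c * (of_nat k * of_nat (k - 1) * z ^ (k - 2))"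
  by (simp add: pderiv_monom poly_monom numeral_2_eq_2 mult_ac)

lemma pderiv2_expand:
  "poly (pderiv (pderiv p)) z = (\<Sum>k\<le>degree p. coeff p k * (of_nat k * of_nat (k - 1) * z ^ (k - 2)))"
  for p :: "'b::{idom, semiring_char_0} poly"
proof -
  have "pderiv (pderiv p) = (\<Sum>k\<le>degree p. pderiv (pderiv (monom (coeff p k) k)))"
    by (subst poly_as_sum_of_monoms[of p, symmetric]) (simp only: pderiv_sum)
  thus ?thesis by (simp only: poly_sum pderiv2_monom)
qed

context
  fixes \<eta> :: "real \<Rightarrow> real" and a b :: real
  assumes \<eta>: "integrable lebesgue \<eta>" and supp: "\<And>t. t \<notin> {a..b} \<Longrightarrow> \<eta> t = 0"
begin

lemma moment_integrable: "integrable lebesgue (\<lambda>t. (real k * real (k - 1) * t ^ (k - 2)) * \<eta> t)"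
proof -
  obtain M where M: "\<And>t. t \<in> {a..b} \<Longrightarrow> \<bar>poly (pderiv (pderiv (monom 1 k))) t\<bar> \<le> M"
    using poly_bounded_on_interval[of a b "pderiv (pderiv (monom 1 k))"] by auto
  show ?thesis
    by (rule integrable_mult_continuous(1)[OF \<eta> supp, where M = M])
      (use M in \<open>auto intro!: continuous_intros simp: pderiv2_monom\<close>)
qed

lemma real_moments:
  "(LINT t|lebesgue. poly (pderiv (pderiv p)) t * \<eta> t)
    = (\<Sum>k\<le>degree p. coeff p k * (LINT t|lebesgue. (real k * real (k - 1) * t ^ (k - 2)) * \<eta> t))"
proof -
  have "(LINT t|lebesgue. poly (pderiv (pderiv p)) t * \<eta> t)
      = (LINT t|lebesgue. (\<Sum>k\<le>degree p. coeff p k * ((real k * real (k - 1) * t ^ (k - 2)) * \<eta> t)))"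
    by (simp only: pderiv2_expand sum_distrib_right mult.assoc)
  also have "\<dots> = (\<Sum>k\<le>degree p. LINT t|lebesgue. coeff p k * ((real k * real (k - 1) * t ^ (k - 2)) * \<eta> t))"
    by (intro Bochner_Integration.integral_sum integrable_mult_right moment_integrable)
  finally show ?thesis by simp
qed

lemma complex_moments:
  "(LINT t:{a..b}|lebesgue. poly (pderiv (pderiv p)) (complex_of_real t) * complex_of_real (\<eta> t))
    = (\<Sum>k\<le>degree p. coeff p k * complex_of_real (LINT t|lebesgue. (real k * real (k - 1) * t ^ (k - 2)) * \<eta> t))"
proof -
  have "(LINT t:{a..b}|lebesgue. poly (pderiv (pderiv p)) (complex_of_real t) * complex_of_real (\<eta> t))
      = (LINT t|lebesgue. (\<Sum>k\<le>degree p. coeff p k * complex_of_real ((real k * real (k - 1) * t ^ (k - 2)) * \<eta> t)))"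
    unfolding set_lebesgue_integral_def
  proof (rule Bochner_Integration.integral_cong[OF refl])
    fix t
    have "indicat_real {a..b} t *\<^sub>R (poly (pderiv (pderiv p)) (complex_of_real t) * complex_of_real (\<eta> t))
        = poly (pderiv (pderiv p)) (complex_of_real t) * complex_of_real (\<eta> t)"
      using supp[of t] by (cases "t \<in> {a..b}") simp_all
    also have "\<dots> = (\<Sum>k\<le>degree p. coeff p k * complex_of_real ((real k * real (k - 1) * t ^ (k - 2)) * \<eta> t))"
      by (simp add: pderiv2_expand sum_distrib_right mult.assoc)
    finally show "indicat_real {a..b} t *\<^sub>R (poly (pderiv (pderiv p)) (complex_of_real t) * complex_of_real (\<eta> t))
        = (\<Sum>k\<le>degree p. coeff p k * complex_of_real ((real k * real (k - 1) * t ^ (k - 2)) * \<eta> t))" .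
  qed
  also have "\<dots> = (\<Sum>k\<le>degree p. LINT t|lebesgue. coeff p k * complex_of_real ((real k * real (k - 1) * t ^ (k - 2)) * \<eta> t))"
    by (intro Bochner_Integration.integral_sum integrable_mult_right integrable_of_real moment_integrable)
  also have "\<dots> = (\<Sum>k\<le>degree p. coeff p k * complex_of_real (LINT t|lebesgue. (real k * real (k - 1) * t ^ (k - 2)) * \<eta> t))"
    by (simp only: integral_mult_right_zero integral_complex_of_real)
  finally show ?thesis .
qed

end

text \<open>The hypothesis on \<open>V\<close> also provides an orthonormal basis, and the Hilbert-Schmidt property
  passes to any other one.\<close>

lemma hilbert_schmidt_some_onb:
  assumes V: "is_adj V V" and "hilbert_schmidt (V :: 'a::chilbert_space bounded_op)"
  shows "is_onb (some_onb :: 'a set)" and "V \<in> onb.HS some_onb"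
proof -
  obtain B :: "'a set" where B: "is_onb B" "(\<lambda>e. (norm (V \<bullet>\<^sub>o e))\<^sup>2) summable_on B"
    using assms(2) by (auto simp: hilbert_schmidt_def)
  show some: "is_onb (some_onb :: 'a set)"
    unfolding some_onb_def using B(1) by (rule someI)
  interpret B: onb B by unfold_locales (rule B(1))
  interpret onb "some_onb :: 'a set" by unfold_locales (rule some)
  have "V \<in> B.HS" by (rule B.HS_I[OF V B(2)])
  from B.hip_transfer[OF V this V this some]
  have "(\<lambda>e. (norm (V \<bullet>\<^sub>o e))\<^sup>2) summable_on some_onb"
    by (simp add: Re_cinner_self has_sum_imp_summable)
  thus "V \<in> HS" by (rule HS_I[OF V])
qed

theorem theorem4p1:
  fixes H H\<^sub>0 V :: "'a::chilbert_space bounded_op" and a b :: real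
  assumes "infinite_dim TYPE('a)"
    and "separable_space (euclidean :: 'a topology)"
    and "self_adjoint H" and "self_adjoint H\<^sub>0"
    and "V = H - H\<^sub>0" and "hilbert_schmidt V"
    and "a = Inf {t. complex_of_real t \<in> op_spectrum H\<^sub>0} - norm V"
    and "b = Sup {t. complex_of_real t \<in> op_spectrum H\<^sub>0} + norm V"
  defines "R \<equiv> \<lambda>p. op_poly p H - op_poly p H\<^sub>0 - frechet_derivative (op_poly p) (at H\<^sub>0) V"
  defines "shift_function \<equiv> \<lambda>\<eta> :: real \<Rightarrow> real.
    integrable lebesgue \<eta> \<and> (\<forall>t. 0 \<le> \<eta> t) \<and> (\<forall>t. t \<notin> {a..b} \<longrightarrow> \<eta> t = 0) \<and>
    (\<forall>p. op_trace (R p) =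
      (LINT t:{a..b}|lebesgue. poly (pderiv (pderiv p)) (complex_of_real t) * complex_of_real (\<eta> t)))"
  shows "(\<forall>p. trace_class (R p)) \<and>
    (\<exists>\<eta>. shift_function \<eta> \<and>
      (\<forall>\<eta>'. shift_function \<eta>' \<longrightarrow> (AE t in lebesgue. \<eta>' t = \<eta> t)) \<and>
      (LINT t:{a..b}|lebesgue. \<bar>\<eta> t\<bar>) = (hs_norm V)\<^sup>2 / 2)"
proof -
  obtain z :: 'a where z: "z \<noteq> 0" using infinite_dim_nonzero[OF assms(1)] .
  have adj: "is_adj H H" "is_adj H\<^sub>0 H\<^sub>0" using assms(3,4) by (simp_all add: self_adjoint_iff)
  have V_adj: "is_adj V V" unfolding assms(5) by (rule is_adj_diff[OF adj])
  have H: "H = H\<^sub>0 + V" by (simp add: assms(5))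
  interpret onb "some_onb :: 'a set"
    by unfold_locales (rule hilbert_schmidt_some_onb(1)[OF V_adj assms(6)])
  have V_HS: "V \<in> HS" by (rule hilbert_schmidt_some_onb(2)[OF V_adj assms(6)])
  hence D: "H - H\<^sub>0 \<in> HS" by (simp add: assms(5))
  have hs: "(hs_norm V)\<^sup>2 = hip V V"
    using hip_nonneg[of V] by (simp add: hs_norm_def hip_self)
  define m where "m k = rtr (power_remainder k H\<^sub>0 H)" for k
  define \<mu> where "\<mu> \<eta> k = (LINT t|lebesgue. (real k * real (k - 1) * t ^ (k - 2)) * \<eta> t)" for \<eta> :: "real \<Rightarrow> real" and k
  note rem = power_remainder_TC[OF adj(2,1) D] is_adj_power_remainder[OF adj(2,1)]
  have R_eq: "R p = (\<Sum>k\<le>degree p. coeff p k *\<^sub>C power_remainder k H\<^sub>0 H)" for p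
    unfolding R_def op_poly_def[of p] frechet_derivative_op_poly(2)
    by (simp add: power_remainder_def assms(5) scaleC_diff_right sum_subtractf)
  have R_TC: "R p \<in> TC" for p
    unfolding R_eq by (intro TC_sum TC_scaleC rem)
  have trace_R: "op_trace (R p) = (\<Sum>k\<le>degree p. coeff p k * complex_of_real (m k))" for p
    unfolding op_trace_def R_eq m_def
    by (rule infsumI[OF trace_combination_has_sum]) (simp_all add: rem)
  \<comment> \<open>both sides of the trace formula are linear in the coefficients of \<open>p\<close>, so it amounts to
    equality of moments\<close>
  have shift_iff: "shift_function \<eta> \<longleftrightarrow> (\<forall>t. 0 \<le> \<eta> t) \<and> (\<forall>k. m k = \<mu> \<eta> k)"
    if \<eta>: "integrable lebesgue \<eta>" "\<And>t. t \<notin> {a..b} \<Longrightarrow> \<eta> t = 0" for \<eta>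
  proof -
    have cm: "(LINT t:{a..b}|lebesgue. poly (pderiv (pderiv p)) (complex_of_real t) * complex_of_real (\<eta> t))
        = (\<Sum>k\<le>degree p. coeff p k * complex_of_real (\<mu> \<eta> k))" for p
      unfolding \<mu>_def by (rule complex_moments[OF \<eta>])
    have "(\<forall>p. op_trace (R p) =
        (LINT t:{a..b}|lebesgue. poly (pderiv (pderiv p)) (complex_of_real t) * complex_of_real (\<eta> t)))
      \<longleftrightarrow> (\<forall>p. (\<Sum>k\<le>degree p. coeff p k * complex_of_real (m k)) = (\<Sum>k\<le>degree p. coeff p k * complex_of_real (\<mu> \<eta> k)))"
      by (simp only: trace_R cm)
    also have "\<dots> \<longleftrightarrow> (\<forall>k. m k = \<mu> \<eta> k)"
    proof
      assume eq: "\<forall>p. (\<Sum>k\<le>degree p. coeff p k * complex_of_real (m k)) = (\<Sum>k\<le>degree p. coeff p k * complex_of_real (\<mu> \<eta> k))"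
      show "\<forall>k. m k = \<mu> \<eta> k"
      proof
        fix k
        show "m k = \<mu> \<eta> k" using eq[rule_format, of "monom 1 k"] by (simp only: sum_coeff_monom of_real_eq_iff)
      qed
    qed simp
    finally show ?thesis using \<eta> unfolding shift_function_def by blast
  qed
  have unique: "AE t in lebesgue. \<eta>' t = \<eta> t" if "shift_function \<eta>" "shift_function \<eta>'" for \<eta> \<eta>'
  proof -
    have \<eta>: "integrable lebesgue \<eta>" "\<And>t. t \<notin> {a..b} \<Longrightarrow> \<eta> t = 0"
      and \<eta>': "integrable lebesgue \<eta>'" "\<And>t. t \<notin> {a..b} \<Longrightarrow> \<eta>' t = 0"
      using that by (auto simp: shift_function_def)
    have \<mu>: "\<mu> \<eta> k = \<mu> \<eta>' k" for k
      using that shift_iff[OF \<eta>] shift_iff[OF \<eta>'] by simp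
    show ?thesis
    proof (rule density_unique[OF \<eta>' \<eta>])
      fix q :: "real poly"
      define p where "p = double_antiderivative q"
      have "(LINT t|lebesgue. poly (pderiv (pderiv p)) t * \<eta>' t) = (\<Sum>k\<le>degree p. coeff p k * \<mu> \<eta>' k)"
        unfolding \<mu>_def by (rule real_moments[OF \<eta>'])
      also have "\<dots> = (\<Sum>k\<le>degree p. coeff p k * \<mu> \<eta> k)" by (simp only: \<mu>)
      also have "\<dots> = (LINT t|lebesgue. poly (pderiv (pderiv p)) t * \<eta> t)"
        unfolding \<mu>_def by (rule real_moments[OF \<eta>, symmetric])
      finally have "(LINT t|lebesgue. poly (pderiv (pderiv p)) t * \<eta>' t) = (LINT t|lebesgue. poly (pderiv (pderiv p)) t * \<eta> t)" .
      thus "(LINT t|lebesgue. poly q t * \<eta>' t) = (LINT t|lebesgue. poly q t * \<eta> t)"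
        by (simp add: p_def double_antiderivative)
    qed
  qed
  obtain \<eta> :: "real \<Rightarrow> real" where \<eta>: "integrable lebesgue \<eta>" "\<And>t. t \<notin> {a..b} \<Longrightarrow> \<eta> t = 0" "\<And>t. 0 \<le> \<eta> t"
    "\<And>k. m k = \<mu> \<eta> k" "(LINT t|lebesgue. \<eta> t) = hip V V / 2"
  proof (cases "V = 0")
    \<comment> \<open>here \<open>[a, b]\<close> may be a single point\<close>
    case True
    hence "m k = 0" for k by (simp add: H m_def power_remainder_def rtr_def zero_op_apply)
    moreover have "hip V V = 0" by (simp add: True hip_def zero_op_apply)
    ultimately show thesis using that[of "\<lambda>_. 0"] by (simp add: \<mu>_def)
  next
    case False
    note sp = sa_between_spectrum[OF adj(2) z]
    have ab: "a < b" using False sp(2) unfolding assms(7,8) by (smt (verit) zero_less_norm_iff)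
    from trace_functional_density[OF sp(1) V_adj V_HS ab assms(7,8)]
    obtain \<eta> :: "real \<Rightarrow> real" where \<eta>: "integrable lebesgue \<eta>" "\<And>t. t \<notin> {a..b} \<Longrightarrow> \<eta> t = 0" "\<And>t. 0 \<le> \<eta> t"
      "\<And>p. trace_remainder p H\<^sub>0 H = (LINT t|lebesgue. poly (pderiv (pderiv p)) t * \<eta> t)"
      "(LINT t|lebesgue. \<eta> t) = hip V V / 2"
      unfolding H by blast
    have "m k = \<mu> \<eta> k" for k
      using \<eta>(4)[of "monom 1 k"] by (simp add: trace_remainder_monom pderiv2_monom m_def \<mu>_def)
    thus thesis using that \<eta> by blast
  qed
  have "shift_function \<eta>" using shift_iff[OF \<eta>(1,2)] \<eta>(3,4) by blast
  moreover have "(LINT t:{a..b}|lebesgue. \<bar>\<eta> t\<bar>) = (hs_norm V)\<^sup>2 / 2"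
  proof -
    have "indicat_real {a..b} t *\<^sub>R \<bar>\<eta> t\<bar> = \<eta> t" for t
      using \<eta>(2,3)[of t] by (cases "t \<in> {a..b}") simp_all
    thus ?thesis by (simp add: set_lebesgue_integral_def \<eta>(5) hs)
  qed
  ultimately show ?thesis using unique TC_trace_class[OF R_TC] by blast
qed

end
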